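(* Let $n\geq 3$ and let $a_n=\tfrac{2^{n-1}}{2^n-1}\pi$, $b_n=\tfrac{2^n}{2^n-1}\pi$, $c_n=\tfrac{2^{n-1}(2^n-2)}{2^n-1}\pi$, $d_n=\tfrac{2^{2n-1}}{2^n-1}\pi$, $e_n=\tfrac{2^n-2}{2^n-1}\pi$. Define $\psi_n\in L^2(\mathbb{R})$ by \[\hat\psi_n(\xi)=\begin{cases}1 & \text{if } \xi\in[-b_n,-a_n]\cup[c_n,\tfrac{a_n}{2}+2^{n-1}\pi]\cup[\tfrac{e_n}{2}+2^{n-1}\pi,d_n],\\ \tfrac{1}{\sqrt2} & \text{if } \xi\in[\tfrac{a_n}{2},\tfrac{e_n}{2}]\cup[a_n,e_n]\cup[\tfrac{a_n}{2}+2^{n-1}\pi,\tfrac{e_n}{2}+2^{n-1}\pi],\\ -\tfrac{1}{\sqrt2} & \text{if } \xi\in[a_n+2^n\pi,e_n+2^n\pi],\\ 0 & \text{otherwise.}\end{cases}\] Then $\psi_n$ is an orthonormal wavelet of $L^2(\mathbb{R})$ and belongs to the class $\mathcal{M}_{n-2}$.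
   Context: Fourier transform: $\hat f(\xi)=\int_{\mathbb{R}}f(x)e^{-i\xi x}\,dx$. A function $\psi\in L^2(\mathbb{R})$ is an (orthonormal) wavelet if $\{\psi_{j,k}(x)=2^{j/2}\psi(2^jx-k): j,k\in\mathbb{Z}\}$ is an orthonormal basis of $L^2(\mathbb{R})$. For a wavelet $\psi$ let $V_0=\overline{\operatorname{span}}\{\psi_{l,k}: l<0,\ k\in\mathbb{Z}\}$. For $k\geq 0$ let $\mathcal{L}_k$ be the set of wavelets $\psi$ whose space $V_0$ is invariant under all translations $f\mapsto f(\cdot-\tfrac{m}{2^k})$, $m\in\mathbb{Z}$, and let $\mathcal{M}_k=\mathcal{L}_k\setminus\mathcal{L}_{k+1}$ (Weber's equivalence classes). *)

theory Defs
  imports "HOL-Analysis.Analysis"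
begin

definition sqint :: "(real \<Rightarrow> complex) \<Rightarrow> bool" where
  "sqint f \<longleftrightarrow> f \<in> borel_measurable lborel \<and> integrable lborel (\<lambda>x. (cmod (f x))\<^sup>2)"

definition l2_inner :: "(real \<Rightarrow> complex) \<Rightarrow> (real \<Rightarrow> complex) \<Rightarrow> complex" where
  "l2_inner f g = (LINT x|lborel. f x * cnj (g x))"

definition l2_norm :: "(real \<Rightarrow> complex) \<Rightarrow> real" where
  "l2_norm f = sqrt (LINT x|lborel. (cmod (f x))\<^sup>2)"

definition in_closed_span :: "(real \<Rightarrow> complex) set \<Rightarrow> (real \<Rightarrow> complex) \<Rightarrow> bool" where
  "in_closed_span S f \<longleftrightarrow> sqint f \<and>
     (\<forall>\<epsilon>>0. \<exists>F c. finite F \<and> F \<subseteq> S \<and>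
        l2_norm (\<lambda>x. f x - (\<Sum>g\<in>F. c g * g x)) < \<epsilon>)"

definition wav :: "(real \<Rightarrow> complex) \<Rightarrow> int \<Rightarrow> int \<Rightarrow> real \<Rightarrow> complex" where
  "wav \<psi> j k x = complex_of_real (2 powr (real_of_int j / 2)) * \<psi> (2 powr (real_of_int j) * x - real_of_int k)"

definition is_wavelet :: "(real \<Rightarrow> complex) \<Rightarrow> bool" where
  "is_wavelet \<psi> \<longleftrightarrow> sqint \<psi> \<and>
     (\<forall>j k j' k'. l2_inner (wav \<psi> j k) (wav \<psi> j' k') = (if j = j' \<and> k = k' then 1 else 0)) \<and>
     (\<forall>f. sqint f \<longrightarrow> in_closed_span (range (\<lambda>(j,k). wav \<psi> j k)) f)"

definition V0 :: "(real \<Rightarrow> complex) \<Rightarrow> (real \<Rightarrow> complex) set" where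
  "V0 \<psi> = {f. in_closed_span {wav \<psi> l k | l k. l < 0} f}"

definition wclass_L :: "nat \<Rightarrow> (real \<Rightarrow> complex) set" where
  "wclass_L k = {\<psi>. is_wavelet \<psi> \<and>
     (\<forall>f\<in>V0 \<psi>. \<forall>m::int. (\<lambda>x. f (x - real_of_int m / 2 ^ k)) \<in> V0 \<psi>)}"

definition wclass_M :: "nat \<Rightarrow> (real \<Rightarrow> complex) set" where
  "wclass_M k = wclass_L k - wclass_L (Suc k)"

text \<open>Inverse Fourier transform (for integrable hat functions), matching
  \<open>\<hat>f(\<xi>) = \<integral> f(x) e^{-i\<xi>x} dx\<close>.\<close>
definition inv_fourier :: "(real \<Rightarrow> complex) \<Rightarrow> real \<Rightarrow> complex" where
  "inv_fourier h x = (LINT \<xi>|lborel. h \<xi> * cis (\<xi> * x)) / complex_of_real (2 * pi)"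

definition psi_hat :: "nat \<Rightarrow> real \<Rightarrow> complex" where
  "psi_hat n \<xi> = (let N = 2 ^ n - 1 :: real;
       a = 2 ^ (n - 1) / N * pi;
       b = 2 ^ n / N * pi;
       c = 2 ^ (n - 1) * (2 ^ n - 2) / N * pi;
       d = 2 ^ (2 * n - 1) / N * pi;
       e = (2 ^ n - 2) / N * pi;
       P = 2 ^ (n - 1) * pi
     in if \<xi> \<in> {-b..-a} \<union> {c..a/2 + P} \<union> {e/2 + P..d} then 1
        else if \<xi> \<in> {a/2..e/2} \<union> {a..e} \<union> {a/2 + P..e/2 + P} then complex_of_real (1 / sqrt 2)
        else if \<xi> \<in> {a + 2 ^ n * pi..e + 2 ^ n * pi} then complex_of_real (- 1 / sqrt 2)
        else 0)"

definition psi :: "nat \<Rightarrow> real \<Rightarrow> complex" where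
  "psi n = inv_fourier (psi_hat n)"

end

theory Submission
  imports Defs "HOL-Probability.Characteristic_Functions"
begin

text \<open>Write \<open>u\<close> for the step function \<open>psi_hat n\<close> and \<open>P = 2^(n-1)\<close>. By Plancherel every inner product
  between (translated) wavelets of levels \<open>l \<le> l'\<close> is a Fourier coefficient of \<open>u(2^j \<eta>) u(\<eta>)\<close>,
  \<open>j = l' - l\<close>. For \<open>j \<ge> 2\<close> this product vanishes; for \<open>j = 1\<close> it is \<open>1/2\<close> on \<open>[a/2, e/2]\<close> and \<open>-1/2\<close>
  on the translate of that interval by \<open>P \<pi>\<close>, so its coefficient at frequency \<open>s\<close> carries the factor
  \<open>1 - exp(i s P \<pi>)\<close>. That factor vanishes for all \<open>s\<close> in \<open>2^(2-n) \<int>\<close> but not for \<open>s = -2^(1-n)\<close>,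
  which gives both the orthogonality of the levels and the membership in \<open>\<M>\<^sub>n\<^sub>-\<^sub>2\<close>.

  For completeness, multiplying \<open>u\<close> by a periodic function cuts out a single interval of the
  support, except that \<open>[a/2, e/2]\<close> and \<open>[a, e]\<close> come together with a translate. Dilating the first
  of these pairs by 2 turns it into the second with the opposite sign, so sum and difference
  separate the two components, and the dilates of the intervals obtained tile the line.\<close>

text \<open>In units of \<pi> the number a_n is determined by \<open>2 * P * a = P + a\<close>.
  Dilation by \<open>P\<close> then carries (2 - 2a, 2a) exactly onto (P - a, P + a), so the bands
  near P \<pi> supply the part of the octave (a, 2a) that [a, 2 - 2a] misses; the same equation puts
  the higher dilates of [a/2, 1 - a] into the gaps of the support. Membership in \<open>V0\<close>
  is an approximation statement. Orthonormality together with completeness makes \<open>V0\<close>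
  the orthogonal complement of the levels \<open>l \<ge> 0\<close>, which is why invariance can be
  read off from inner products. No inversion theorem is used. \<open>psi\<close> is an integral over
  its Fourier side, so Plancherel is proved only for \<open>inv_fourier\<close> on compactly
  supported functions with finitely many jumps, and density of its range comes from the adjoint
  relation \<open>inner_inv_fourier\<close>. Frequency 0 is where the dyadic dilates accumulate, so
  completeness is tested on functions whose frequencies stay in an annulus.\<close>

section \<open>Plancherel's theorem for step-like functions\<close>

text \<open>Piecewise continuous with compact support: continuity off a finite set is all that the Gaussian
  regularisation below needs for pointwise convergence almost everywhere.\<close>

definition pcc :: "(real \<Rightarrow> complex) \<Rightarrow> bool" where
  "pcc h \<longleftrightarrow> h \<in> borel_measurable borel \<and> (\<exists>M. \<forall>x. cmod (h x) \<le> M) \<and>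
     (\<exists>R. \<forall>x. h x \<noteq> 0 \<longrightarrow> \<bar>x\<bar> \<le> R) \<and> (\<exists>D. finite D \<and> (\<forall>x. x \<notin> D \<longrightarrow> isCont h x))"

lemma pcc_measurable[measurable_dest]: "pcc h \<Longrightarrow> h \<in> borel_measurable borel"
  by (simp add: pcc_def)

lemma pccE:
  assumes "pcc h"
  obtains M R D where "0 < M" "0 < R" "finite D" "\<And>x. cmod (h x) \<le> M"
    "\<And>x. R < \<bar>x\<bar> \<Longrightarrow> h x = 0" "\<And>x. x \<notin> D \<Longrightarrow> isCont h x"
proof -
  obtain M R D where *: "\<And>x. cmod (h x) \<le> M" "\<And>x. h x \<noteq> 0 \<longrightarrow> \<bar>x\<bar> \<le> R" "finite D" "\<And>x. x \<notin> D \<Longrightarrow> isCont h x"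
    using assms unfolding pcc_def by blast
  show ?thesis
  proof (rule that[of "max 1 M" "max 1 R" D])
    show "h x = 0" if "max 1 R < \<bar>x\<bar>" for x using *(2)[of x] that by fastforce
  qed (use * in \<open>auto simp: max_def intro: order_trans[OF *(1)]\<close>)
qed

text \<open>A continuous factor may be unbounded: only its values on a compact interval containing
  the support of \<open>h\<close> enter the bound.\<close>

lemma pcc_mult_cont:
  assumes "pcc h" and q: "continuous_on UNIV q"
  shows "pcc (\<lambda>x. q x * h x)"
proof -
  obtain M R D where *: "0 < M" "0 < R" "finite D" "\<And>x. cmod (h x) \<le> M"
    "\<And>x. R < \<bar>x\<bar> \<Longrightarrow> h x = 0" "\<And>x. x \<notin> D \<Longrightarrow> isCont h x" using assms(1) by (rule pccE) blast
  have [measurable]: "h \<in> borel_measurable borel" "q \<in> borel_measurable borel"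
    using assms by (auto simp: pcc_measurable borel_measurable_continuous_onI)
  have "compact (q ` {-R..R})"
    by (intro compact_continuous_image continuous_on_subset[OF q]) auto
  then obtain B where B: "\<And>x. x \<in> {-R..R} \<Longrightarrow> cmod (q x) \<le> B"
    using compact_imp_bounded[of "q ` {-R..R}"] unfolding bounded_iff by blast
  have B0: "0 \<le> B" using B[of 0] * norm_ge_zero[of "q 0"] by (auto simp del: norm_ge_zero)
  have "cmod (q x * h x) \<le> B * M" for x
  proof (cases "x \<in> {-R..R}")
    case True then show ?thesis using B *(4) B0 by (auto simp: norm_mult intro!: mult_mono)
  next
    case False then have "h x = 0" by (intro *(5)) auto
    then show ?thesis using B0 * by simp
  qed
  moreover have "isCont (\<lambda>x. q x * h x) x" if "x \<notin> D" for x
    using *(6)[OF that] q by (intro isCont_mult) (auto simp: continuous_on_eq_continuous_at)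
  moreover have "\<forall>x. q x * h x \<noteq> 0 \<longrightarrow> \<bar>x\<bar> \<le> R" using *(5) by (metis mult_zero_right not_le)
  ultimately show ?thesis using *(3) unfolding pcc_def by (intro conjI) (measurable, blast+)
qed

section \<open>Closure properties of \<open>pcc\<close>\<close>

lemma pcc_cmult: "pcc h \<Longrightarrow> pcc (\<lambda>x. c * h x)"
  by (rule pcc_mult_cont) auto

lemma pcc_zero: "pcc (\<lambda>x. 0)"
  unfolding pcc_def by (auto intro!: exI[of _ "{}"] exI[of _ 0])

lemma pcc_add:
  assumes "pcc h" "pcc g"
  shows "pcc (\<lambda>x. h x + g x)"
proof -
  obtain M R D where *: "0 < M" "0 < R" "finite D" "\<And>x. cmod (h x) \<le> M"
    "\<And>x. R < \<bar>x\<bar> \<Longrightarrow> h x = 0" "\<And>x. x \<notin> D \<Longrightarrow> isCont h x" using assms(1) by (rule pccE) blast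
  obtain M' R' D' where **: "0 < M'" "0 < R'" "finite D'" "\<And>x. cmod (g x) \<le> M'"
    "\<And>x. R' < \<bar>x\<bar> \<Longrightarrow> g x = 0" "\<And>x. x \<notin> D' \<Longrightarrow> isCont g x" using assms(2) by (rule pccE) blast
  have [measurable]: "h \<in> borel_measurable borel" "g \<in> borel_measurable borel"
    using assms by (auto simp: pcc_measurable)
  have "cmod (h x + g x) \<le> M + M'" for x
    using *(4)[of x] **(4)[of x] norm_triangle_ineq[of "h x" "g x"] by linarith
  moreover have "\<bar>x\<bar> \<le> max R R'" if "h x + g x \<noteq> 0" for x
    using *(5)[of x] **(5)[of x] that by fastforce
  moreover have "isCont (\<lambda>x. h x + g x) x" if "x \<notin> D \<union> D'" for x
    using that * ** by (intro isCont_add) auto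
  ultimately show ?thesis using *(3) **(3) unfolding pcc_def by (intro conjI) (measurable, blast+)
qed

lemma pcc_sum: "(\<And>i. i \<in> I \<Longrightarrow> pcc (h i)) \<Longrightarrow> pcc (\<lambda>x. \<Sum>i\<in>I. h i x)"
  by (induction I rule: infinite_finite_induct) (auto intro: pcc_zero pcc_add)

lemma pcc_diff: "pcc h \<Longrightarrow> pcc g \<Longrightarrow> pcc (\<lambda>x. h x - g x)"
  using pcc_add[of h "\<lambda>x. -1 * g x"] pcc_cmult[of g "-1"] by simp

lemma pcc_mult:
  assumes "pcc h" "pcc g"
  shows "pcc (\<lambda>x. h x * g x)"
proof -
  obtain M R D where *: "0 < M" "0 < R" "finite D" "\<And>x. cmod (h x) \<le> M"
    "\<And>x. R < \<bar>x\<bar> \<Longrightarrow> h x = 0" "\<And>x. x \<notin> D \<Longrightarrow> isCont h x" using assms(1) by (rule pccE) blast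
  obtain M' R' D' where **: "0 < M'" "0 < R'" "finite D'" "\<And>x. cmod (g x) \<le> M'"
    "\<And>x. R' < \<bar>x\<bar> \<Longrightarrow> g x = 0" "\<And>x. x \<notin> D' \<Longrightarrow> isCont g x" using assms(2) by (rule pccE) blast
  have [measurable]: "h \<in> borel_measurable borel" "g \<in> borel_measurable borel"
    using assms by (auto simp: pcc_measurable)
  have "cmod (h x * g x) \<le> M * M'" for x
    using *(4)[of x] **(4)[of x] *(1) **(1) by (auto simp: norm_mult intro!: mult_mono)
  moreover have "\<bar>x\<bar> \<le> R" if "h x * g x \<noteq> 0" for x
    using *(5)[of x] that by fastforce
  moreover have "isCont (\<lambda>x. h x * g x) x" if "x \<notin> D \<union> D'" for x
    using that * ** by (intro isCont_mult) auto
  ultimately show ?thesis using *(3) **(3) unfolding pcc_def by (intro conjI) (measurable, blast+)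
qed

lemma pcc_cnj:
  assumes "pcc h" shows "pcc (\<lambda>x. cnj (h x))"
proof -
  obtain M R D where *: "0 < M" "0 < R" "finite D" "\<And>x. cmod (h x) \<le> M"
    "\<And>x. R < \<bar>x\<bar> \<Longrightarrow> h x = 0" "\<And>x. x \<notin> D \<Longrightarrow> isCont h x" using assms(1) by (rule pccE) blast
  have [measurable]: "h \<in> borel_measurable borel" using assms by (rule pcc_measurable)
  have "(\<lambda>x. cnj (h x)) \<in> borel_measurable borel"
    by (rule borel_measurable_continuous_on[of cnj]) (auto intro: continuous_intros)
  moreover have "\<bar>x\<bar> \<le> R" if "cnj (h x) \<noteq> 0" for x using *(5)[of x] that by fastforce
  moreover have "isCont (\<lambda>x. cnj (h x)) x" if "x \<notin> D" for x
    using * that by (auto intro: continuous_intros)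
  moreover have "cmod (cnj (h x)) \<le> M" for x using * by simp
  ultimately show ?thesis using *(3) unfolding pcc_def by (intro conjI) blast+
qed

lemma pcc_affine:
  assumes "pcc h" "c \<noteq> 0"
  shows "pcc (\<lambda>x. h (c * x + d))"
proof -
  obtain M R D where *: "0 < M" "0 < R" "finite D" "\<And>x. cmod (h x) \<le> M"
    "\<And>x. R < \<bar>x\<bar> \<Longrightarrow> h x = 0" "\<And>x. x \<notin> D \<Longrightarrow> isCont h x" using assms(1) by (rule pccE) blast
  have [measurable]: "h \<in> borel_measurable borel" using assms by (simp add: pcc_measurable)
  have "\<bar>x\<bar> \<le> (R + \<bar>d\<bar>) / \<bar>c\<bar>" if "h (c * x + d) \<noteq> 0" for x
  proof -
    have "\<bar>c * x + d\<bar> \<le> R" using *(5)[of "c*x+d"] that by fastforce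
    then have "\<bar>c * x\<bar> \<le> R + \<bar>d\<bar>" by linarith
    then show ?thesis using assms(2) by (simp add: field_simps abs_mult)
  qed
  moreover have "isCont (\<lambda>x. h (c * x + d)) x" if "x \<notin> (\<lambda>y. (y - d) / c) ` D" for x
  proof -
    have "c * x + d \<notin> D"
    proof
      assume "c * x + d \<in> D"
      moreover have "x = ((c * x + d) - d) / c" using assms by simp
      ultimately show False using that by blast
    qed
    then have "isCont h (c * x + d)" using * by auto
    then show ?thesis by (intro isCont_o2[where g=h and f="\<lambda>x. c * x + d"]) (auto intro!: continuous_intros)
  qed
  moreover have "(\<lambda>x. h (c * x + d)) \<in> borel_measurable borel" by measurable
  ultimately show ?thesis using *(3,4) unfolding pcc_def by (intro conjI) blast+
qed

lemma pcc_shift: "pcc h \<Longrightarrow> pcc (\<lambda>x. h (x - d))"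
  using pcc_affine[of h 1 "-d"] by simp

lemma pcc_scale: "pcc h \<Longrightarrow> c \<noteq> 0 \<Longrightarrow> pcc (\<lambda>x. h (c * x))"
  using pcc_affine[of h c 0] by simp

lemma isCont_eventually_eq:
  assumes "isCont f x" "\<forall>\<^sub>F y in nhds x. g y = f y"
  shows "isCont g x"
  using assms isCont_cong by blast

lemma pcc_restrict_interval:
  assumes "pcc h" shows "pcc (\<lambda>x. if x \<in> {s<..<t} then h x else 0)"
proof -
  obtain M R D where *: "0 < M" "0 < R" "finite D" "\<And>x. cmod (h x) \<le> M"
    "\<And>x. R < \<bar>x\<bar> \<Longrightarrow> h x = 0" "\<And>x. x \<notin> D \<Longrightarrow> isCont h x" using assms(1) by (rule pccE) blast
  have [measurable]: "h \<in> borel_measurable borel" using assms by (simp add: pcc_measurable)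
  let ?g = "\<lambda>x. if x \<in> {s<..<t} then h x else 0"
  have "isCont ?g x" if x: "x \<notin> D \<union> {s,t}" for x
  proof (cases "x \<in> {s<..<t}")
    case True
    then have "\<forall>\<^sub>F y in nhds x. y \<in> {s<..<t}" by (intro eventually_nhds_in_open) auto
    then have "\<forall>\<^sub>F y in nhds x. (if y \<in> {s<..<t} then h y else 0) = h y" by (rule eventually_mono) auto
    then show ?thesis by (rule isCont_eventually_eq[where f=h and x=x, rotated]) (use * x in auto)
  next
    case False
    then have "x \<in> {..<s} \<union> {t<..}" using x by auto
    then have "\<forall>\<^sub>F y in nhds x. y \<in> {..<s} \<union> {t<..}" by (intro eventually_nhds_in_open) auto
    then have "\<forall>\<^sub>F y in nhds x. ?g y = 0" by (rule eventually_mono) auto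
    then show ?thesis by (rule isCont_eventually_eq[where f="\<lambda>_. 0" and x=x, rotated]) auto
  qed
  moreover have "?g \<in> borel_measurable borel" by measurable
  moreover have "cmod (?g x) \<le> M" for x using * by auto
  moreover have "\<bar>x\<bar> \<le> R" if "?g x \<noteq> 0" for x using *(5)[of x] that by (fastforce split: if_splits)
  moreover have "finite (D \<union> {s,t})" using * by auto
  ultimately show ?thesis unfolding pcc_def by (intro conjI) (blast+)
qed

lemma pcc_const_interval: "pcc (\<lambda>x. if x \<in> {s<..<t} then c else 0)"
proof -
  let ?g = "\<lambda>x::real. if x \<in> {s<..<t} then c else (0::complex)"
  have "isCont ?g x" if x: "x \<notin> {s,t}" for x
  proof (cases "x \<in> {s<..<t}")
    case True
    then have "\<forall>\<^sub>F y in nhds x. y \<in> {s<..<t}" by (intro eventually_nhds_in_open) auto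
    then have "\<forall>\<^sub>F y in nhds x. (if y \<in> {s<..<t} then c else 0) = c" by (rule eventually_mono) auto
    then show ?thesis by (rule isCont_eventually_eq[where f="\<lambda>_. c" and x=x, rotated]) auto
  next
    case False
    then have "x \<in> {..<s} \<union> {t<..}" using x by auto
    then have "\<forall>\<^sub>F y in nhds x. y \<in> {..<s} \<union> {t<..}" by (intro eventually_nhds_in_open) auto
    then have "\<forall>\<^sub>F y in nhds x. ?g y = 0" by (rule eventually_mono) auto
    then show ?thesis by (rule isCont_eventually_eq[where f="\<lambda>_. 0" and x=x, rotated]) auto
  qed
  moreover have "?g \<in> borel_measurable borel" by measurable
  moreover have "cmod (?g x) \<le> cmod c" for x by auto
  moreover have "\<bar>x\<bar> \<le> max \<bar>s\<bar> \<bar>t\<bar>" if "?g x \<noteq> 0" for x using that by (auto split: if_splits)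
  moreover have "finite {s,t}" by auto
  ultimately show ?thesis unfolding pcc_def by (intro conjI) (blast+)
qed

section \<open>Integrability and the Fourier integral\<close>

lemma pcc_integrable:
  assumes "pcc h" shows "integrable lborel h"
proof -
  obtain M R D where *: "0 < M" "0 < R" "finite D" "\<And>x. cmod (h x) \<le> M"
    "\<And>x. R < \<bar>x\<bar> \<Longrightarrow> h x = 0" "\<And>x. x \<notin> D \<Longrightarrow> isCont h x" using assms(1) by (rule pccE) blast
  have [measurable]: "h \<in> borel_measurable borel" using assms by (simp add: pcc_measurable)
  show ?thesis
  proof (rule Bochner_Integration.integrable_bound)
    show "integrable lborel (\<lambda>x. M * indicat_real {-R..R} x)"
      by (intro integrable_mult_right integrable_real_indicator) (auto simp: emeasure_lborel_Icc_eq)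
    have "norm (h x) \<le> norm (M * indicat_real {-R..R} x)" for x
      using *(1) *(4)[of x] *(5)[of x] by (cases "R < \<bar>x\<bar>") (auto simp: indicator_def)
    then show "AE x in lborel. norm (h x) \<le> norm (M * indicat_real {-R..R} x)" by auto
  qed auto
qed

lemma sq_norm_complex: "complex_of_real ((cmod z)\<^sup>2) = z * cnj z"
  by (metis complex_norm_square)

lemma pcc_sqint:
  assumes "pcc h" shows "sqint h"
proof -
  have "integrable lborel (\<lambda>x. h x * cnj (h x))" by (intro pcc_integrable pcc_mult pcc_cnj assms)
  then have "integrable lborel (\<lambda>x. complex_of_real ((cmod (h x))\<^sup>2))" by (simp only: sq_norm_complex)
  then have "integrable lborel (\<lambda>x. (cmod (h x))\<^sup>2)" by (simp only: complex_of_real_integrable_eq)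
  then show ?thesis using assms by (auto simp: sqint_def pcc_measurable)
qed

text \<open>\<open>inv_fourier\<close> without the factor 1 / (2 \<pi>). Its value at -x is the
  Fourier transform at x, so one operator serves for both directions.\<close>

definition fint :: "(real \<Rightarrow> complex) \<Rightarrow> real \<Rightarrow> complex" where
  "fint h x = (LINT \<xi>|lborel. h \<xi> * cis (\<xi> * x))"

lemma inv_fourier_fint: "inv_fourier h x = fint h x / complex_of_real (2 * pi)"
  by (simp add: inv_fourier_def fint_def)

lemma pcc_times_cis: "pcc h \<Longrightarrow> pcc (\<lambda>\<xi>. h \<xi> * cis (\<xi> * x))"
  using pcc_mult_cont[of h "\<lambda>\<xi>. cis (\<xi> * x)"]
  by (simp add: mult.commute[of "h _"] continuous_on_cis continuous_on_mult_right continuous_on_id)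

lemma cis_measurable[measurable (raw)]:
  "f \<in> borel_measurable M \<Longrightarrow> (\<lambda>x. cis (f x)) \<in> borel_measurable M"
  by (rule borel_measurable_continuous_on[of cis f]) (auto intro!: continuous_intros)

lemma fint_measurable[measurable]:
  assumes [measurable]: "h \<in> borel_measurable borel" shows "fint h \<in> borel_measurable borel"
  unfolding fint_def by measurable

lemma continuous_fint:
  assumes "pcc h" shows "continuous_on UNIV (fint h)"
proof -
  have [measurable]: "h \<in> borel_measurable borel" using assms by (simp add: pcc_measurable)
  have "isCont (fint h) x" for x
  proof -
    have "continuous (at x within UNIV) (\<lambda>x. LINT \<xi>|lborel. h \<xi> * cis (\<xi> * x))"
    proof (unfold continuous_within_sequentially, intro allI impI, unfold o_def)
      fix u :: "nat \<Rightarrow> real" assume u: "(\<forall>n. u n \<in> UNIV) \<and> u \<longlonglongrightarrow> x"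
      show "(\<lambda>n. LINT \<xi>|lborel. h \<xi> * cis (\<xi> * u n)) \<longlonglongrightarrow> (LINT \<xi>|lborel. h \<xi> * cis (\<xi> * x))"
      proof (rule integral_dominated_convergence[where w="\<lambda>\<xi>. norm (h \<xi>)"])
        show "integrable lborel (\<lambda>\<xi>. norm (h \<xi>))" using pcc_integrable[OF assms] by auto
        show "AE \<xi> in lborel. (\<lambda>n. h \<xi> * cis (\<xi> * u n)) \<longlonglongrightarrow> h \<xi> * cis (\<xi> * x)"
          using u by (auto intro!: tendsto_intros)
        show "AE \<xi> in lborel. norm (h \<xi> * cis (\<xi> * u n)) \<le> norm (h \<xi>)" for n
          by (auto simp: norm_mult)
      qed auto
    qed
    then show ?thesis by (simp add: fint_def[abs_def])
  qed
  then show ?thesis by (auto simp: continuous_on_eq_continuous_at)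
qed

lemma fint_bound:
  assumes "pcc h" shows "cmod (fint h x) \<le> (LINT \<xi>|lborel. cmod (h \<xi>))"
proof -
  have "cmod (fint h x) \<le> (LINT \<xi>|lborel. cmod (h \<xi> * cis (\<xi> * x)))"
    unfolding fint_def by (rule integral_norm_bound)
  then show ?thesis by (simp add: norm_mult)
qed

text \<open>A dominating product separates the variables and reduces the integrability required by
  Fubini to two integrals in one variable. \<open>N\<close> is later both the normal distribution
  and Lebesgue measure.\<close>

lemma Fubini_dominated:
  fixes f :: "real \<Rightarrow> 'a \<Rightarrow> complex"
  assumes N: "sigma_finite_measure N" and g: "integrable lborel g" and k: "integrable N k"
    and m: "case_prod f \<in> borel_measurable (lborel \<Otimes>\<^sub>M N)"
    and b: "\<And>\<xi> x. norm (f \<xi> x) \<le> g \<xi> * k x"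
  shows "(LINT x|N. LINT \<xi>|lborel. f \<xi> x) = (LINT \<xi>|lborel. LINT x|N. f \<xi> x)"
proof -
  interpret N: sigma_finite_measure N by fact
  interpret P: pair_sigma_finite lborel N
    by (simp add: pair_sigma_finite_def lborel.sigma_finite_measure_axioms N)
  note [measurable] = m
  have nn: "0 \<le> g \<xi> * k x" for \<xi> x using norm_ge_zero b by (rule order_trans)
  have i: "integrable N (\<lambda>x. f \<xi> x)" for \<xi>
  proof (rule Bochner_Integration.integrable_bound)
    show "integrable N (\<lambda>x. g \<xi> * k x)" using k by auto
  qed (use b nn in auto)
  show ?thesis
  proof (rule P.Fubini_integral, rule P.Fubini_integrable)
    show "integrable lborel (\<lambda>x. LINT y|N. norm (case (x, y) of (x, xa) \<Rightarrow> f x xa))"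
    proof (rule Bochner_Integration.integrable_bound)
      show "integrable lborel (\<lambda>\<xi>. g \<xi> * (LINT x|N. k x))" using g by auto
      show "AE x in lborel. norm (LINT y|N. norm (case (x, y) of (x, xa) \<Rightarrow> f x xa)) \<le> norm (g x * (LINT x|N. k x))"
      proof (rule AE_I2)
        fix x :: real
        have "(LINT y|N. norm (f x y)) \<le> (LINT y|N. g x * k y)"
          using i b k by (intro integral_mono) auto
        then have "(LINT y|N. norm (f x y)) \<le> g x * (LINT y|N. k y)" by simp
        then show "norm (LINT y|N. norm (case (x, y) of (x, xa) \<Rightarrow> f x xa)) \<le> norm (g x * (LINT x|N. k x))"
          by (auto simp: integral_nonneg_AE)
      qed
    qed auto
  qed (use i m in auto)
qed

lemma Fubini_bounded:
  fixes f :: "real \<Rightarrow> 'a \<Rightarrow> complex"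
  assumes N: "finite_measure N" and g: "integrable lborel g"
    and m: "case_prod f \<in> borel_measurable (lborel \<Otimes>\<^sub>M N)"
    and b: "\<And>\<xi> x. norm (f \<xi> x) \<le> g \<xi>"
  shows "(LINT x|N. LINT \<xi>|lborel. f \<xi> x) = (LINT \<xi>|lborel. LINT x|N. f \<xi> x)"
proof -
  interpret N: finite_measure N by fact
  show ?thesis
    by (rule Fubini_dominated[OF _ g, where k="\<lambda>_. 1"]) (use m b in \<open>auto simp: N.sigma_finite_measure_axioms\<close>)
qed

section \<open>Gaussian regularisation and its limit\<close>

lemma normal_char: "(LINT x|std_normal_distribution. cis (t * x)) = complex_of_real (exp (- t\<^sup>2 / 2))"
  using fun_cong[OF char_std_normal_distribution, of t] by (simp add: char_def cis_conv_exp mult.commute)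

text \<open>The product of two transforms is bounded but not yet known to be integrable, so it is
  averaged against a Gaussian. Under this finite measure Fubini applies twice, and the inner average
  of cis is the characteristic function of the normal law: again a Gaussian, now in the frequency
  difference.\<close>

lemma gauss_regularised:
  assumes h: "pcc h" and g: "pcc g" and \<delta>: "\<delta> > 0"
  shows "(LINT x|std_normal_distribution. fint h (x / \<delta>) * cnj (fint g (x / \<delta>)))
    = (LINT \<eta>|lborel. cnj (g \<eta>) * (LINT \<xi>|lborel. h \<xi> * complex_of_real (exp (- ((\<xi> - \<eta>) / \<delta>)\<^sup>2 / 2))))"
proof -
  let ?N = "std_normal_distribution"
  interpret N: real_distribution ?N by (rule real_dist_normal_dist)
  have [measurable]: "h \<in> borel_measurable borel" "g \<in> borel_measurable borel" using assms by (auto simp: pcc_measurable)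
  have [measurable]: "(\<lambda>x. cnj (g x)) \<in> borel_measurable borel" using pcc_cnj[OF g] by (simp add: pcc_measurable)
  have fm: "finite_measure ?N" by unfold_locales
  have "(LINT x|?N. fint h (x / \<delta>) * cnj (fint g (x / \<delta>)))
     = (LINT x|?N. LINT \<eta>|lborel. fint h (x / \<delta>) * (cnj (g \<eta>) * cis (- \<eta> * x / \<delta>)))"
  proof (intro Bochner_Integration.integral_cong refl)
    fix x
    have "cnj (fint g (x / \<delta>)) = (LINT \<eta>|lborel. cnj (g \<eta>) * cis (- \<eta> * x / \<delta>))"
      unfolding fint_def by (subst Bochner_Integration.integral_cnj[symmetric]) (auto simp: cis_cnj)
    then show "fint h (x / \<delta>) * cnj (fint g (x / \<delta>)) = (LINT \<eta>|lborel. fint h (x / \<delta>) * (cnj (g \<eta>) * cis (- \<eta> * x / \<delta>)))"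
      by simp
  qed
  also have "\<dots> = (LINT \<eta>|lborel. LINT x|?N. fint h (x / \<delta>) * (cnj (g \<eta>) * cis (- \<eta> * x / \<delta>)))"
  proof (rule Fubini_bounded[OF fm])
    let ?B = "LINT \<xi>|lborel. cmod (h \<xi>)"
    show "integrable lborel (\<lambda>\<eta>. ?B * cmod (g \<eta>))" using pcc_integrable[OF g] by auto
    show "norm (fint h (x / \<delta>) * (cnj (g \<eta>) * cis (- \<eta> * x / \<delta>))) \<le> ?B * cmod (g \<eta>)" for \<eta> x
      using fint_bound[OF h, of "x/\<delta>"] by (auto simp: norm_mult intro!: mult_right_mono)
  qed measurable
  also have "\<dots> = (LINT \<eta>|lborel. cnj (g \<eta>) * (LINT x|?N. LINT \<xi>|lborel. h \<xi> * cis ((\<xi> - \<eta>) / \<delta> * x)))"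
  proof (intro Bochner_Integration.integral_cong refl)
    fix \<eta>
    have "fint h (x / \<delta>) * cis (- \<eta> * x / \<delta>) = (LINT \<xi>|lborel. h \<xi> * cis ((\<xi> - \<eta>) / \<delta> * x))" for x
    proof -
      have "fint h (x / \<delta>) * cis (- \<eta> * x / \<delta>) = (LINT \<xi>|lborel. h \<xi> * cis (\<xi> * (x / \<delta>)) * cis (- \<eta> * x / \<delta>))"
        unfolding fint_def by simp
      also have "\<dots> = (LINT \<xi>|lborel. h \<xi> * cis ((\<xi> - \<eta>) / \<delta> * x))"
        by (intro Bochner_Integration.integral_cong refl) (simp add: cis_mult mult.assoc algebra_simps diff_divide_distrib)
      finally show ?thesis .
    qed
    then have "(LINT x|?N. fint h (x / \<delta>) * (cnj (g \<eta>) * cis (- \<eta> * x / \<delta>)))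
       = (LINT x|?N. cnj (g \<eta>) * (LINT \<xi>|lborel. h \<xi> * cis ((\<xi> - \<eta>) / \<delta> * x)))"
      by (intro Bochner_Integration.integral_cong refl) (simp add: mult_ac)
    then show "(LINT x|?N. fint h (x / \<delta>) * (cnj (g \<eta>) * cis (- \<eta> * x / \<delta>)))
       = cnj (g \<eta>) * (LINT x|?N. LINT \<xi>|lborel. h \<xi> * cis ((\<xi> - \<eta>) / \<delta> * x))" by simp
  qed
  also have "\<dots> = (LINT \<eta>|lborel. cnj (g \<eta>) * (LINT \<xi>|lborel. h \<xi> * complex_of_real (exp (- ((\<xi> - \<eta>) / \<delta>)\<^sup>2 / 2))))"
  proof (rule Bochner_Integration.integral_cong[OF refl], rule arg_cong2[where f="(*)", OF refl])
    fix \<eta>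
    have "(LINT x|?N. LINT \<xi>|lborel. h \<xi> * cis ((\<xi> - \<eta>) / \<delta> * x)) = (LINT \<xi>|lborel. LINT x|?N. h \<xi> * cis ((\<xi> - \<eta>) / \<delta> * x))"
    proof (rule Fubini_bounded[OF fm])
      show "integrable lborel (\<lambda>\<xi>. cmod (h \<xi>))" using pcc_integrable[OF h] by auto
    qed (auto simp: norm_mult)
    then show "(LINT x|?N. LINT \<xi>|lborel. h \<xi> * cis ((\<xi> - \<eta>) / \<delta> * x)) = (LINT \<xi>|lborel. h \<xi> * complex_of_real (exp (- ((\<xi> - \<eta>) / \<delta>)\<^sup>2 / 2)))"
      by (simp only: integral_mult_right_zero normal_char)
  qed
  finally show ?thesis .
qed

lemma normal_lint:
  assumes [measurable]: "f \<in> borel_measurable borel"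
  shows "(LINT x|std_normal_distribution. (f x :: complex)) = (LINT x|lborel. complex_of_real (exp (- x\<^sup>2 / 2)) * f x) / complex_of_real (sqrt (2 * pi))"
proof -
  have "(LINT x|std_normal_distribution. f x) = (LINT x|lborel. std_normal_density x *\<^sub>R f x)"
    by (rule integral_density) auto
  also have "\<dots> = (LINT x|lborel. (complex_of_real (exp (- x\<^sup>2 / 2)) * f x) / complex_of_real (sqrt (2 * pi)))"
    by (intro Bochner_Integration.integral_cong refl) (simp add: std_normal_density_def scaleR_conv_of_real)
  finally show ?thesis by simp
qed

text \<open>Both sides of \<open>gauss_regularised\<close> are rescaled by \<delta>; on the right
  this means \<xi> = \<eta> + \<delta> s. Each passage between the normal law and Lebesgue measure
  costs a factor sqrt (2 \<pi>), whence the constant 2 \<pi>.\<close>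

lemma gauss_regularised_lborel:
  assumes h: "pcc h" and g: "pcc g" and \<delta>: "\<delta> > 0"
  shows "(LINT x|lborel. complex_of_real (exp (- (\<delta> * x)\<^sup>2 / 2)) * (fint h x * cnj (fint g x)))
    = complex_of_real (2 * pi) * (LINT \<eta>|lborel. cnj (g \<eta>) * (LINT s|std_normal_distribution. h (\<eta> + \<delta> * s)))"
proof -
  have [measurable]: "h \<in> borel_measurable borel" "g \<in> borel_measurable borel" using assms by (auto simp: pcc_measurable)
  have [measurable]: "(\<lambda>x. cnj (fint g x)) \<in> borel_measurable borel"
    by (rule borel_measurable_continuous_on[of cnj]) (auto intro: continuous_intros)
  let ?S = "complex_of_real (sqrt (2 * pi))"
  let ?I = "LINT x|lborel. complex_of_real (exp (- (\<delta> * x)\<^sup>2 / 2)) * (fint h x * cnj (fint g x))"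
  let ?J = "LINT \<eta>|lborel. cnj (g \<eta>) * (LINT s|std_normal_distribution. h (\<eta> + \<delta> * s))"
  have S: "?S * ?S = complex_of_real (2 * pi)" by (simp flip: of_real_mult)
  have S0: "?S \<noteq> 0" by simp
  have "(LINT x|std_normal_distribution. fint h (x / \<delta>) * cnj (fint g (x / \<delta>)))
      = (LINT x|lborel. complex_of_real (exp (- x\<^sup>2 / 2)) * (fint h (x / \<delta>) * cnj (fint g (x / \<delta>)))) / ?S"
    by (rule normal_lint) measurable
  also have "(LINT x|lborel. complex_of_real (exp (- x\<^sup>2 / 2)) * (fint h (x / \<delta>) * cnj (fint g (x / \<delta>)))) = \<delta> *\<^sub>R ?I"
    using \<delta> by (subst lborel_integral_real_affine[where c=\<delta> and t=0]) auto
  finally have L: "(LINT x|std_normal_distribution. fint h (x / \<delta>) * cnj (fint g (x / \<delta>))) = \<delta> *\<^sub>R ?I / ?S" .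
  have "(LINT \<xi>|lborel. h \<xi> * complex_of_real (exp (- ((\<xi> - \<eta>) / \<delta>)\<^sup>2 / 2))) = \<delta> *\<^sub>R (?S * (LINT s|std_normal_distribution. h (\<eta> + \<delta> * s)))" for \<eta>
  proof -
    have "(LINT \<xi>|lborel. h \<xi> * complex_of_real (exp (- ((\<xi> - \<eta>) / \<delta>)\<^sup>2 / 2)))
       = \<delta> *\<^sub>R (LINT s|lborel. complex_of_real (exp (- s\<^sup>2 / 2)) * h (\<eta> + \<delta> * s))"
      using \<delta> by (subst lborel_integral_real_affine[where c=\<delta> and t=\<eta>]) (auto simp: mult.commute)
    moreover have "(LINT s|std_normal_distribution. h (\<eta> + \<delta> * s)) = (LINT s|lborel. complex_of_real (exp (- s\<^sup>2 / 2)) * h (\<eta> + \<delta> * s)) / ?S"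
      by (rule normal_lint) measurable
    ultimately show ?thesis using S0 by simp
  qed
  then have "(LINT \<eta>|lborel. cnj (g \<eta>) * (LINT \<xi>|lborel. h \<xi> * complex_of_real (exp (- ((\<xi> - \<eta>) / \<delta>)\<^sup>2 / 2))))
     = (LINT \<eta>|lborel. (of_real \<delta> * ?S) * (cnj (g \<eta>) * (LINT s|std_normal_distribution. h (\<eta> + \<delta> * s))))"
    by (intro Bochner_Integration.integral_cong refl) (simp add: scaleR_conv_of_real mult_ac)
  also have "\<dots> = (of_real \<delta> * ?S) * ?J" by (rule integral_mult_right_zero)
  finally have "of_real \<delta> * ?I / ?S = (of_real \<delta> * ?S) * ?J"
    using gauss_regularised[OF assms] L by (simp add: scaleR_conv_of_real)
  then have "complex_of_real \<delta> * (?I / ?S) = of_real \<delta> * (?S * ?J)" by (simp only: times_divide_eq_right mult.assoc)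
  then have "?I / ?S = ?S * ?J" using \<delta> by (simp only: mult_cancel_left of_real_eq_0_iff) auto
  then have "?I = ?S * ?S * ?J" using S0 by (simp add: field_simps)
  then show ?thesis using S by simp
qed

text \<open>The Gaussian average of \<open>h\<close> around \<eta> concentrates at \<eta> and tends
  to \<open>h \<eta>\<close> wherever \<open>h\<close> is continuous; the finitely many jumps form a
  null set for the outer integral.\<close>

lemma gauss_smoothing_limit:
  assumes h: "pcc h" and g: "pcc g" and \<delta>: "\<delta> \<longlonglongrightarrow> 0"
  shows "(\<lambda>n. LINT \<eta>|lborel. cnj (g \<eta>) * (LINT s|std_normal_distribution. h (\<eta> + \<delta> n * s)))
     \<longlonglongrightarrow> (LINT \<eta>|lborel. cnj (g \<eta>) * h \<eta>)"
proof -
  interpret N: real_distribution std_normal_distribution by (rule real_dist_normal_dist)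
  have [measurable]: "h \<in> borel_measurable borel" "g \<in> borel_measurable borel" using assms by (auto simp: pcc_measurable)
  have [measurable]: "(\<lambda>x. cnj (g x)) \<in> borel_measurable borel" using pcc_cnj[OF g] by (simp add: pcc_measurable)
  obtain M R D where *: "0 < M" "0 < R" "finite D" "\<And>x. cmod (h x) \<le> M"
    "\<And>x. R < \<bar>x\<bar> \<Longrightarrow> h x = 0" "\<And>x. x \<notin> D \<Longrightarrow> isCont h x" using h by (rule pccE) blast
  have inner: "(\<lambda>n. LINT s|std_normal_distribution. h (\<eta> + \<delta> n * s)) \<longlonglongrightarrow> h \<eta>" if "\<eta> \<notin> D" for \<eta>
  proof -
    have "(\<lambda>n. LINT s|std_normal_distribution. h (\<eta> + \<delta> n * s)) \<longlonglongrightarrow> (LINT s|std_normal_distribution. h \<eta>)"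
    proof (rule integral_dominated_convergence[where w="\<lambda>_. M"])
      show "AE s in std_normal_distribution. (\<lambda>n. h (\<eta> + \<delta> n * s)) \<longlonglongrightarrow> h \<eta>"
      proof (rule AE_I2)
        fix s
        have "(\<lambda>n. \<eta> + \<delta> n * s) \<longlonglongrightarrow> \<eta> + 0 * s" by (intro tendsto_intros \<delta>)
        then show "(\<lambda>n. h (\<eta> + \<delta> n * s)) \<longlonglongrightarrow> h \<eta>"
          using *(6)[OF that] isCont_tendsto_compose by fastforce
      qed
    qed (use * in auto)
    moreover have "measure std_normal_distribution UNIV = 1" using N.prob_space by simp
    ultimately show ?thesis by simp
  qed
  have bd: "cmod (LINT s|std_normal_distribution. h (\<eta> + \<delta> n * s)) \<le> M" for \<eta> n
  proof -
    have "cmod (LINT s|std_normal_distribution. h (\<eta> + \<delta> n * s)) \<le> (LINT s|std_normal_distribution. cmod (h (\<eta> + \<delta> n * s)))"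
      by (rule integral_norm_bound)
    also have "\<dots> \<le> (LINT s|std_normal_distribution. M)"
      using * by (intro integral_mono N.integrable_const_bound[where B=M]) auto
    also have "\<dots> = M" using N.prob_space by simp
    finally show ?thesis .
  qed
  have aeD: "AE \<eta> in lborel. \<eta> \<notin> D"
    using *(3) by (intro AE_not_in finite_imp_null_set_lborel) auto
  show ?thesis
  proof (rule integral_dominated_convergence[where w="\<lambda>\<eta>. cmod (g \<eta>) * M"])
    show "integrable lborel (\<lambda>\<eta>. cmod (g \<eta>) * M)" using pcc_integrable[OF g] by auto
    show "AE x in lborel. (\<lambda>i. cnj (g x) * (LINT s|std_normal_distribution. h (x + \<delta> i * s))) \<longlonglongrightarrow> cnj (g x) * h x"
      using aeD by eventually_elim (intro tendsto_intros inner)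
    show "AE x in lborel. norm (cnj (g x) * (LINT s|std_normal_distribution. h (x + \<delta> i * s))) \<le> cmod (g x) * M" for i
      using bd by (auto simp: norm_mult intro!: mult_left_mono)
  qed measurable
qed

text \<open>Square integrability is a conclusion here, so there is no dominating function to work
  with. On the diagonal the regularised integrand is nonnegative and increases as \<delta>
  decreases, and monotone convergence yields integrability and the value together.\<close>

lemma Plancherel_diag:
  assumes h: "pcc h"
  shows "integrable lborel (\<lambda>x. (cmod (fint h x))\<^sup>2)"
    and "(LINT x|lborel. (cmod (fint h x))\<^sup>2) = 2 * pi * (LINT x|lborel. (cmod (h x))\<^sup>2)"
proof -
  have [measurable]: "h \<in> borel_measurable borel" using assms by (auto simp: pcc_measurable)
  define \<delta> where "\<delta> n = inverse (real (Suc n))" for n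
  have \<delta>0: "\<delta> \<longlonglongrightarrow> 0" unfolding \<delta>_def by (rule LIMSEQ_inverse_real_of_nat)
  have \<delta>p: "\<delta> n > 0" for n by (simp add: \<delta>_def)
  define B where "B = (LINT \<xi>|lborel. cmod (h \<xi>))"
  have B: "cmod (fint h x) \<le> B" for x using fint_bound[OF h] by (simp add: B_def)
  define G where "G n x = exp (- (\<delta> n * x)\<^sup>2 / 2) * (cmod (fint h x))\<^sup>2" for n x
  have Gi: "integrable lborel (G n)" for n
  proof (rule Bochner_Integration.integrable_bound)
    have "integrable lborel (\<lambda>x. std_normal_density (0 + \<delta> n * x))"
      using \<delta>p[of n] by (intro lborel_integrable_real_affine[OF integrable_normal_density]) auto
    then have "integrable lborel (\<lambda>x. (sqrt (2 * pi) * B\<^sup>2) * std_normal_density (\<delta> n * x))" by simp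
    then show "integrable lborel (\<lambda>x. B\<^sup>2 * exp (- (\<delta> n * x)\<^sup>2 / 2))"
      by (simp add: std_normal_density_def mult_ac)
    show "AE x in lborel. norm (G n x) \<le> norm (B\<^sup>2 * exp (- (\<delta> n * x)\<^sup>2 / 2))"
      using B by (auto simp: G_def mult.commute[of _ "exp _"] intro!: mult_left_mono power_mono)
  qed (unfold G_def, measurable)
  have "complex_of_real (LINT x|lborel. G n x) = complex_of_real (2 * pi) * (LINT \<eta>|lborel. cnj (h \<eta>) * (LINT s|std_normal_distribution. h (\<eta> + \<delta> n * s)))" for n
    using gauss_regularised_lborel[OF h h \<delta>p, of n]
    by (simp add: G_def sq_norm_complex integral_complex_of_real[symmetric] del: of_real_power)
  moreover have "(\<lambda>n. complex_of_real (2 * pi) * (LINT \<eta>|lborel. cnj (h \<eta>) * (LINT s|std_normal_distribution. h (\<eta> + \<delta> n * s))))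
       \<longlonglongrightarrow> complex_of_real (2 * pi) * (LINT \<eta>|lborel. cnj (h \<eta>) * h \<eta>)"
    by (intro tendsto_intros gauss_smoothing_limit h \<delta>0)
  moreover have "(LINT \<eta>|lborel. cnj (h \<eta>) * h \<eta>) = complex_of_real (LINT x|lborel. (cmod (h x))\<^sup>2)"
    by (simp add: sq_norm_complex integral_complex_of_real[symmetric] mult.commute del: of_real_power)
  ultimately have "(\<lambda>n. complex_of_real (LINT x|lborel. G n x)) \<longlonglongrightarrow> complex_of_real (2 * pi * (LINT x|lborel. (cmod (h x))\<^sup>2))"
    by simp
  then have lim: "(\<lambda>n. LINT x|lborel. G n x) \<longlonglongrightarrow> 2 * pi * (LINT x|lborel. (cmod (h x))\<^sup>2)"
    by (simp only: tendsto_of_real_iff)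
  have mono: "mono (\<lambda>n. G n x)" for x
  proof (rule monoI)
    fix m n :: nat assume "m \<le> n"
    then have "\<delta> n \<le> \<delta> m" unfolding \<delta>_def by (intro le_imp_inverse_le) auto
    then have "(\<delta> n)\<^sup>2 * x\<^sup>2 \<le> (\<delta> m)\<^sup>2 * x\<^sup>2" using \<delta>p[of n] by (intro mult_right_mono power_mono) auto
    then show "G m x \<le> G n x" unfolding G_def by (intro mult_right_mono) (auto simp: power_mult_distrib)
  qed
  have ptw: "(\<lambda>n. G n x) \<longlonglongrightarrow> (cmod (fint h x))\<^sup>2" for x
  proof -
    have "(\<lambda>n. G n x) \<longlonglongrightarrow> exp (- (0 * x)\<^sup>2 / 2) * (cmod (fint h x))\<^sup>2"
      unfolding G_def by (intro tendsto_intros \<delta>0) auto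
    then show ?thesis by simp
  qed
  have G0: "0 \<le> G n x" for n x by (simp add: G_def)
  have m: "(\<lambda>x. (cmod (fint h x))\<^sup>2) \<in> borel_measurable lborel" by measurable
  note conv = integral_monotone_convergence_nonneg[OF Gi AE_I2[OF mono] AE_I2[OF G0] AE_I2[OF ptw] lim m]
  show "integrable lborel (\<lambda>x. (cmod (fint h x))\<^sup>2)" by (rule conv(1))
  show "(LINT x|lborel. (cmod (fint h x))\<^sup>2) = 2 * pi * (LINT x|lborel. (cmod (h x))\<^sup>2)" by (rule conv(2))
qed

lemma sqint_inner_integrable:
  assumes "sqint f" "sqint g" shows "integrable lborel (\<lambda>x. f x * cnj (g x))"
proof (rule Bochner_Integration.integrable_bound)
  have [measurable]: "f \<in> borel_measurable borel" "g \<in> borel_measurable borel" using assms by (auto simp: sqint_def)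
  show "integrable lborel (\<lambda>x. (cmod (f x))\<^sup>2 + (cmod (g x))\<^sup>2)" using assms by (auto simp: sqint_def)
  have "cmod (f x) * cmod (g x) \<le> (cmod (f x))\<^sup>2 + (cmod (g x))\<^sup>2" for x
    using sum_squares_bound[of "cmod (f x)" "cmod (g x)"] mult_nonneg_nonneg[of "cmod (f x)" "cmod (g x)", OF norm_ge_zero norm_ge_zero]
    by linarith
  then show "AE x in lborel. norm (f x * cnj (g x)) \<le> norm ((cmod (f x))\<^sup>2 + (cmod (g x))\<^sup>2)"
    by (auto simp: norm_mult)
  have "(\<lambda>x. cnj (g x)) \<in> borel_measurable borel"
    by (rule borel_measurable_continuous_on[of cnj]) (auto intro: continuous_intros)
  then show "(\<lambda>x. f x * cnj (g x)) \<in> borel_measurable lborel" by measurable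
qed

lemma sqint_fint: "pcc h \<Longrightarrow> sqint (fint h)"
  using Plancherel_diag(1)[of h] by (simp add: sqint_def pcc_measurable)

text \<open>The diagonal case makes the product of the two transforms integrable, and this product
  dominates its own Gaussian regularisations.\<close>

theorem Plancherel_fint:
  assumes h: "pcc h" and g: "pcc g"
  shows "l2_inner (fint h) (fint g) = complex_of_real (2 * pi) * l2_inner h g"
proof -
  have [measurable]: "h \<in> borel_measurable borel" "g \<in> borel_measurable borel" using assms by (auto simp: pcc_measurable)
  have [measurable]: "(\<lambda>x. cnj (fint g x)) \<in> borel_measurable borel"
    by (rule borel_measurable_continuous_on[of cnj]) (auto intro: continuous_intros)
  define \<delta> where "\<delta> n = inverse (real (Suc n))" for n
  have \<delta>0: "\<delta> \<longlonglongrightarrow> 0" unfolding \<delta>_def by (rule LIMSEQ_inverse_real_of_nat)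
  have \<delta>p: "\<delta> n > 0" for n by (simp add: \<delta>_def)
  have "(\<lambda>n. LINT x|lborel. complex_of_real (exp (- (\<delta> n * x)\<^sup>2 / 2)) * (fint h x * cnj (fint g x)))
      \<longlonglongrightarrow> (LINT x|lborel. fint h x * cnj (fint g x))"
  proof (rule integral_dominated_convergence[where w="\<lambda>x. norm (fint h x * cnj (fint g x))"])
    show "integrable lborel (\<lambda>x. norm (fint h x * cnj (fint g x)))"
      by (intro integrable_norm sqint_inner_integrable sqint_fint assms)
    show "AE x in lborel. (\<lambda>n. complex_of_real (exp (- (\<delta> n * x)\<^sup>2 / 2)) * (fint h x * cnj (fint g x))) \<longlonglongrightarrow> fint h x * cnj (fint g x)"
    proof (rule AE_I2)
      fix x
      have "(\<lambda>n. complex_of_real (exp (- (\<delta> n * x)\<^sup>2 / 2)) * (fint h x * cnj (fint g x))) \<longlonglongrightarrow> complex_of_real (exp (- (0 * x)\<^sup>2 / 2)) * (fint h x * cnj (fint g x))"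
        by (intro tendsto_intros \<delta>0) auto
      then show "(\<lambda>n. complex_of_real (exp (- (\<delta> n * x)\<^sup>2 / 2)) * (fint h x * cnj (fint g x))) \<longlonglongrightarrow> fint h x * cnj (fint g x)" by simp
    qed
    show "AE x in lborel. norm (complex_of_real (exp (- (\<delta> n * x)\<^sup>2 / 2)) * (fint h x * cnj (fint g x))) \<le> norm (fint h x * cnj (fint g x))" for n
      by (auto simp: norm_mult intro!: mult_left_le_one_le)
  qed measurable
  moreover have "(\<lambda>n. LINT x|lborel. complex_of_real (exp (- (\<delta> n * x)\<^sup>2 / 2)) * (fint h x * cnj (fint g x)))
      \<longlonglongrightarrow> complex_of_real (2 * pi) * (LINT \<eta>|lborel. cnj (g \<eta>) * h \<eta>)"
    unfolding gauss_regularised_lborel[OF h g \<delta>p] by (intro tendsto_intros gauss_smoothing_limit h g \<delta>0)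
  ultimately show ?thesis unfolding l2_inner_def using LIMSEQ_unique by (simp add: mult.commute)
qed

section \<open>Closed spans of square integrable functions\<close>

text \<open>The squared norm is additive on orthogonal sums and keeps square roots out of the
  estimates.\<close>

definition nsq :: "(real \<Rightarrow> complex) \<Rightarrow> real" where
  "nsq f = (LINT x|lborel. (cmod (f x))\<^sup>2)"

lemma nsq_nonneg: "0 \<le> nsq f"
  by (simp add: nsq_def)

lemma l2_norm_less_iff: "0 < \<epsilon> \<Longrightarrow> l2_norm f < \<epsilon> \<longleftrightarrow> nsq f < \<epsilon>\<^sup>2"
  unfolding l2_norm_def nsq_def[symmetric]
  using real_sqrt_less_iff[of "nsq f" "\<epsilon>\<^sup>2"] by simp

lemma cnj_measurable[measurable (raw)]:
  "f \<in> borel_measurable M \<Longrightarrow> (\<lambda>x. cnj (f x)) \<in> borel_measurable M"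
  by (rule borel_measurable_continuous_on[of cnj f]) (auto intro!: continuous_intros)

text \<open>This replaces the triangle inequality for the norm; its factor 2 is the origin of the
  bounds \<epsilon> / 4 below.\<close>

lemma sq_norm_add_le: "(cmod (z + w))\<^sup>2 \<le> 2 * (cmod z)\<^sup>2 + 2 * (cmod w)\<^sup>2"
proof -
  have "(cmod (z + w))\<^sup>2 \<le> (cmod z + cmod w)\<^sup>2"
    by (intro power_mono norm_triangle_ineq) auto
  also have "\<dots> \<le> 2 * (cmod z)\<^sup>2 + 2 * (cmod w)\<^sup>2"
    using zero_le_power2[of "cmod z - cmod w"] by (simp add: power2_eq_square algebra_simps)
  finally show ?thesis .
qed

lemma sqint_add:
  assumes "sqint f" "sqint g" shows "sqint (\<lambda>x. f x + g x)"
proof -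
  have [measurable]: "f \<in> borel_measurable borel" "g \<in> borel_measurable borel" using assms by (auto simp: sqint_def)
  have "integrable lborel (\<lambda>x. (cmod (f x + g x))\<^sup>2)"
  proof (rule Bochner_Integration.integrable_bound)
    show "integrable lborel (\<lambda>x. 2 * (cmod (f x))\<^sup>2 + 2 * (cmod (g x))\<^sup>2)" using assms by (auto simp: sqint_def)
  qed (use sq_norm_add_le in auto)
  then show ?thesis by (simp add: sqint_def)
qed

lemma nsq_add_le:
  assumes "sqint f" "sqint g" shows "nsq (\<lambda>x. f x + g x) \<le> 2 * nsq f + 2 * nsq g"
proof -
  have "nsq (\<lambda>x. f x + g x) \<le> (LINT x|lborel. 2 * (cmod (f x))\<^sup>2 + 2 * (cmod (g x))\<^sup>2)"
    unfolding nsq_def using assms sqint_add[OF assms] sq_norm_add_le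
    by (intro integral_mono) (auto simp: sqint_def)
  also have "\<dots> = 2 * nsq f + 2 * nsq g" using assms by (simp add: nsq_def sqint_def)
  finally show ?thesis .
qed

lemma sqint_cmult:
  assumes "sqint f" shows "sqint (\<lambda>x. c * f x)"
proof -
  have "integrable lborel (\<lambda>x. (cmod c)\<^sup>2 * (cmod (f x))\<^sup>2)" using assms by (auto simp: sqint_def)
  moreover have "(\<lambda>x. c * f x) \<in> borel_measurable borel" using assms by (auto simp: sqint_def)
  ultimately show ?thesis by (auto simp: sqint_def norm_mult power_mult_distrib)
qed

lemma nsq_cmult: "nsq (\<lambda>x. c * f x) = (cmod c)\<^sup>2 * nsq f"
  by (simp add: nsq_def norm_mult power_mult_distrib)

lemma sqint_zero: "sqint (\<lambda>x. 0)" by (simp add: sqint_def)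

lemma sqint_diff: "sqint f \<Longrightarrow> sqint g \<Longrightarrow> sqint (\<lambda>x. f x - g x)"
  using sqint_add[of f "\<lambda>x. -1 * g x"] sqint_cmult[of g "-1"] by simp

lemma sqint_sum: "(\<And>i. i \<in> I \<Longrightarrow> sqint (f i)) \<Longrightarrow> sqint (\<lambda>x. \<Sum>i\<in>I. f i x)"
  by (induction I rule: infinite_finite_induct) (auto intro: sqint_zero sqint_add)

lemma sqint_affine:
  assumes "sqint f" "\<alpha> \<noteq> 0" shows "sqint (\<lambda>x. f (\<alpha> * x + \<beta>))"
proof -
  have [measurable]: "f \<in> borel_measurable borel" using assms by (auto simp: sqint_def)
  have "integrable lborel (\<lambda>x. (cmod (f (\<beta> + \<alpha> * x)))\<^sup>2)"
    using assms by (intro lborel_integrable_real_affine[of "\<lambda>x. (cmod (f x))\<^sup>2"]) (auto simp: sqint_def)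
  then show ?thesis by (auto simp: sqint_def add.commute)
qed

lemma nsq_affine:
  assumes "\<alpha> \<noteq> 0" shows "nsq f = \<bar>\<alpha>\<bar> * nsq (\<lambda>x. f (\<alpha> * x + \<beta>))"
  unfolding nsq_def using lborel_integral_real_affine[OF assms, of "\<lambda>x. (cmod (f x))\<^sup>2" \<beta>]
  by (simp add: add.commute)

lemma nsq_eq_inner: "complex_of_real (nsq f) = l2_inner f f"
  unfolding nsq_def l2_inner_def sq_norm_complex[symmetric] by (rule integral_complex_of_real[symmetric])

lemma l2_inner_add_left:
  "sqint f \<Longrightarrow> sqint g \<Longrightarrow> sqint k \<Longrightarrow> l2_inner (\<lambda>x. f x + g x) k = l2_inner f k + l2_inner g k"
  unfolding l2_inner_def by (simp add: distrib_right sqint_inner_integrable)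

lemma l2_inner_diff_left:
  "sqint f \<Longrightarrow> sqint g \<Longrightarrow> sqint k \<Longrightarrow> l2_inner (\<lambda>x. f x - g x) k = l2_inner f k - l2_inner g k"
  unfolding l2_inner_def by (simp add: left_diff_distrib sqint_inner_integrable)

lemma l2_inner_cmult_left: "l2_inner (\<lambda>x. c * f x) k = c * l2_inner f k"
  unfolding l2_inner_def by (simp add: mult.assoc)

lemma l2_inner_cmult_right: "l2_inner k (\<lambda>x. c * f x) = cnj c * l2_inner k f"
proof -
  have "(\<lambda>x. k x * cnj (c * f x)) = (\<lambda>x. cnj c * (k x * cnj (f x)))" by (auto simp: mult_ac)
  then show ?thesis unfolding l2_inner_def by simp
qed

lemma l2_inner_commute: "l2_inner f g = cnj (l2_inner g f)"
  unfolding l2_inner_def by (subst Bochner_Integration.integral_cnj[symmetric]) (simp add: mult.commute)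

lemma l2_inner_sum_left:
  "(\<And>i. i \<in> I \<Longrightarrow> sqint (f i)) \<Longrightarrow> sqint k \<Longrightarrow> l2_inner (\<lambda>x. \<Sum>i\<in>I. f i x) k = (\<Sum>i\<in>I. l2_inner (f i) k)"
proof (induction I rule: infinite_finite_induct)
  case (insert i I)
  then show ?case by (simp add: l2_inner_add_left sqint_sum)
qed (auto simp: l2_inner_def)

lemma nsq_diff:
  assumes "sqint f" "sqint g"
  shows "nsq (\<lambda>x. f x - g x) = nsq f + nsq g - 2 * Re (l2_inner f g)"
proof -
  have e: "complex_of_real (nsq (\<lambda>x. f x - g x)) = l2_inner f f - l2_inner f g - cnj (l2_inner f g) + l2_inner g g"
    unfolding nsq_eq_inner using assms sqint_diff[OF assms]
    apply (subst l2_inner_diff_left) apply auto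
    apply (subst (1 2) l2_inner_commute[of _ "\<lambda>x. f x - g x"])
    apply (simp add: l2_inner_diff_left)
    apply (subst (1 2) l2_inner_commute[symmetric])
    apply (subst l2_inner_commute[of g f], simp)
    done
  have "nsq (\<lambda>x. f x - g x) = Re (complex_of_real (nsq (\<lambda>x. f x - g x)))" by simp
  also have "\<dots> = Re (complex_of_real (nsq f)) + Re (complex_of_real (nsq g)) - 2 * Re (l2_inner f g)"
    unfolding e nsq_eq_inner by simp
  finally show ?thesis by simp
qed

section \<open>Closed spans: algebra, affine substitution, orthogonality\<close>

lemma in_closed_span_iff:
  "in_closed_span S f \<longleftrightarrow> sqint f \<and>
    (\<forall>\<epsilon>>0. \<exists>F c. finite F \<and> F \<subseteq> S \<and> nsq (\<lambda>x. f x - (\<Sum>g\<in>F. c g * g x)) < \<epsilon>)"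
proof -
  have "(\<forall>\<epsilon>>0. \<exists>F c. finite F \<and> F \<subseteq> S \<and> l2_norm (\<lambda>x. f x - (\<Sum>g\<in>F. c g * g x)) < \<epsilon>)
    \<longleftrightarrow> (\<forall>\<epsilon>>0. \<exists>F c. finite F \<and> F \<subseteq> S \<and> nsq (\<lambda>x. f x - (\<Sum>g\<in>F. c g * g x)) < \<epsilon>)" (is "?L = ?R")
  proof
    assume L: ?L
    show ?R
    proof (intro allI impI)
      fix \<epsilon> :: real assume "\<epsilon> > 0"
      then show "\<exists>F c. finite F \<and> F \<subseteq> S \<and> nsq (\<lambda>x. f x - (\<Sum>g\<in>F. c g * g x)) < \<epsilon>"
        using L[rule_format, of "sqrt \<epsilon>"] by (simp add: l2_norm_less_iff)
    qed
  qed (auto simp: l2_norm_less_iff)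
  then show ?thesis by (simp add: in_closed_span_def)
qed

lemma in_closed_span_sqint: "in_closed_span S f \<Longrightarrow> sqint f"
  by (simp add: in_closed_span_def)

lemma in_closed_spanE:
  assumes "in_closed_span S f" "\<epsilon> > 0"
  obtains F c where "finite F" "F \<subseteq> S" "nsq (\<lambda>x. f x - (\<Sum>g\<in>F. c g * g x)) < \<epsilon>"
  using assms by (auto simp: in_closed_span_iff)

lemma in_closed_span_base:
  assumes "f \<in> S" "sqint f" shows "in_closed_span S f"
  unfolding in_closed_span_iff
proof (intro conjI allI impI)
  fix \<epsilon> :: real assume "\<epsilon> > 0"
  then show "\<exists>F c. finite F \<and> F \<subseteq> S \<and> nsq (\<lambda>x. f x - (\<Sum>g\<in>F. c g * g x)) < \<epsilon>"
    using assms by (intro exI[of _ "{f}"] exI[of _ "\<lambda>_. 1"]) (auto simp: nsq_def)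
qed fact

lemma sqint_lin_comb: "F \<subseteq> Collect sqint \<Longrightarrow> sqint (\<lambda>x. \<Sum>g\<in>F. c g * g x)"
  by (intro sqint_sum sqint_cmult) auto

lemma in_closed_span_add:
  assumes S: "S \<subseteq> Collect sqint" and "in_closed_span S f" "in_closed_span S g"
  shows "in_closed_span S (\<lambda>x. f x + g x)"
  unfolding in_closed_span_iff
proof (intro conjI allI impI)
  show "sqint (\<lambda>x. f x + g x)" using assms by (intro sqint_add) (auto intro: in_closed_span_sqint)
  fix \<epsilon> :: real assume \<epsilon>: "\<epsilon> > 0"
  obtain F c where F: "finite F" "F \<subseteq> S" "nsq (\<lambda>x. f x - (\<Sum>h\<in>F. c h * h x)) < \<epsilon> / 4"
    using in_closed_spanE[OF assms(2), of "\<epsilon> / 4"] \<epsilon> by auto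
  obtain F' c' where F': "finite F'" "F' \<subseteq> S" "nsq (\<lambda>x. g x - (\<Sum>h\<in>F'. c' h * h x)) < \<epsilon> / 4"
    using in_closed_spanE[OF assms(3), of "\<epsilon> / 4"] \<epsilon> by auto
  \<comment> \<open>The two finite sets may overlap, so both families of coefficients are extended
    by zero and added on the union.\<close>
  define C where "C h = (if h \<in> F then c h else 0) + (if h \<in> F' then c' h else 0)" for h
  have sum: "(\<Sum>h\<in>F \<union> F'. C h * h x) = (\<Sum>h\<in>F. c h * h x) + (\<Sum>h\<in>F'. c' h * h x)" for x
  proof -
    have "(\<Sum>h\<in>F \<union> F'. C h * h x) = (\<Sum>h\<in>F \<union> F'. (if h \<in> F then c h * h x else 0)) + (\<Sum>h\<in>F \<union> F'. (if h \<in> F' then c' h * h x else 0))"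
      unfolding sum.distrib[symmetric] by (intro sum.cong) (auto simp: C_def algebra_simps)
    also have "\<dots> = (\<Sum>h\<in>F. c h * h x) + (\<Sum>h\<in>F'. c' h * h x)"
      using F F' by (intro arg_cong2[where f="(+)"] sum.mono_neutral_cong_right) auto
    finally show ?thesis .
  qed
  have "nsq (\<lambda>x. (f x - (\<Sum>h\<in>F. c h * h x)) + (g x - (\<Sum>h\<in>F'. c' h * h x))) < \<epsilon>"
  proof -
    have "sqint (\<lambda>x. f x - (\<Sum>h\<in>F. c h * h x))" "sqint (\<lambda>x. g x - (\<Sum>h\<in>F'. c' h * h x))"
      using F F' S assms by (auto intro!: sqint_diff sqint_lin_comb intro: in_closed_span_sqint)
    from nsq_add_le[OF this] show ?thesis using F F' by linarith
  qed
  moreover have "(\<lambda>x. f x + g x - (\<Sum>h\<in>F \<union> F'. C h * h x)) = (\<lambda>x. (f x - (\<Sum>h\<in>F. c h * h x)) + (g x - (\<Sum>h\<in>F'. c' h * h x)))"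
    by (simp only: sum add_diff_add)
  ultimately show "\<exists>F c. finite F \<and> F \<subseteq> S \<and> nsq (\<lambda>x. f x + g x - (\<Sum>g\<in>F. c g * g x)) < \<epsilon>"
    using F F' by (intro exI[of _ "F \<union> F'"] exI[of _ C]) simp
qed

lemma in_closed_span_cmult:
  assumes "in_closed_span S f" shows "in_closed_span S (\<lambda>x. a * f x)"
  unfolding in_closed_span_iff
proof (intro conjI allI impI)
  show "sqint (\<lambda>x. a * f x)" using assms by (intro sqint_cmult) (auto intro: in_closed_span_sqint)
  fix \<epsilon> :: real assume \<epsilon>: "\<epsilon> > 0"
  \<comment> \<open>The summand 1 keeps the denominator positive when the scalar is 0.\<close>
  have A: "(cmod a)\<^sup>2 + 1 > 0" by (simp add: add_nonneg_pos)
  obtain F c where F: "finite F" "F \<subseteq> S" "nsq (\<lambda>x. f x - (\<Sum>h\<in>F. c h * h x)) < \<epsilon> / ((cmod a)\<^sup>2 + 1)"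
    by (rule in_closed_spanE[OF assms divide_pos_pos[OF \<epsilon> A]]) blast
  let ?N = "nsq (\<lambda>x. f x - (\<Sum>h\<in>F. c h * h x))"
  have "nsq (\<lambda>x. a * f x - (\<Sum>h\<in>F. a * c h * h x)) = nsq (\<lambda>x. a * (f x - (\<Sum>h\<in>F. c h * h x)))"
    by (simp add: right_diff_distrib sum_distrib_left mult.assoc)
  also have "\<dots> = (cmod a)\<^sup>2 * ?N" by (rule nsq_cmult)
  also have "\<dots> \<le> ((cmod a)\<^sup>2 + 1) * ?N" using nsq_nonneg by (intro mult_right_mono) auto
  also have "\<dots> < \<epsilon>" using F(3) A by (simp add: field_simps)
  finally show "\<exists>F c. finite F \<and> F \<subseteq> S \<and> nsq (\<lambda>x. a * f x - (\<Sum>g\<in>F. c g * g x)) < \<epsilon>"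
    using F by (intro exI[of _ F] exI[of _ "\<lambda>h. a * c h"]) simp
qed

lemma in_closed_span_zero: "in_closed_span S (\<lambda>x. 0)"
  unfolding in_closed_span_iff
  by (auto intro!: exI[of _ "{}"] simp: sqint_zero nsq_def)

lemma in_closed_span_sum:
  "S \<subseteq> Collect sqint \<Longrightarrow> (\<And>i. i \<in> I \<Longrightarrow> in_closed_span S (f i)) \<Longrightarrow> in_closed_span S (\<lambda>x. \<Sum>i\<in>I. f i x)"
proof (induction I rule: infinite_finite_induct)
  case (insert i I)
  then have "in_closed_span S (\<lambda>x. f i x + (\<Sum>i\<in>I. f i x))" by (intro in_closed_span_add) auto
  then show ?case using insert by simp
qed (simp_all add: in_closed_span_zero)

lemma in_closed_span_closure:
  assumes S: "S \<subseteq> Collect sqint" and f: "sqint f"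
    and "\<And>\<epsilon>. \<epsilon> > 0 \<Longrightarrow> \<exists>g. in_closed_span S g \<and> nsq (\<lambda>x. f x - g x) < \<epsilon>"
  shows "in_closed_span S f"
  unfolding in_closed_span_iff
proof (intro conjI allI impI)
  fix \<epsilon> :: real assume \<epsilon>: "\<epsilon> > 0"
  obtain g where g: "in_closed_span S g" "nsq (\<lambda>x. f x - g x) < \<epsilon> / 4" using assms(3)[of "\<epsilon>/4"] \<epsilon> by auto
  obtain F c where F: "finite F" "F \<subseteq> S" "nsq (\<lambda>x. g x - (\<Sum>h\<in>F. c h * h x)) < \<epsilon> / 4"
    using in_closed_spanE[OF g(1), of "\<epsilon> / 4"] \<epsilon> by auto
  have "nsq (\<lambda>x. (f x - g x) + (g x - (\<Sum>h\<in>F. c h * h x))) \<le> 2 * nsq (\<lambda>x. f x - g x) + 2 * nsq (\<lambda>x. g x - (\<Sum>h\<in>F. c h * h x))"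
    using F S g f by (intro nsq_add_le sqint_diff sqint_lin_comb) (auto intro: in_closed_span_sqint)
  then have "nsq (\<lambda>x. f x - (\<Sum>h\<in>F. c h * h x)) < \<epsilon>" using F(3) g(2) by simp
  then show "\<exists>F c. finite F \<and> F \<subseteq> S \<and> nsq (\<lambda>x. f x - (\<Sum>g\<in>F. c g * g x)) < \<epsilon>" using F by blast
qed fact

text \<open>An affine substitution multiplies \<open>nsq\<close> by a fixed factor and so preserves
  approximation; only the images of the generators have to be examined. It serves for translations
  as well as for dilations.\<close>

lemma in_closed_span_affine:
  assumes S: "S \<subseteq> Collect sqint" and S': "S' \<subseteq> Collect sqint" and f: "in_closed_span S f"
    and \<alpha>: "\<alpha> \<noteq> 0" and g: "\<And>g. g \<in> S \<Longrightarrow> in_closed_span S' (\<lambda>x. g (\<alpha> * x + \<beta>))"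
  shows "in_closed_span S' (\<lambda>x. f (\<alpha> * x + \<beta>))"
proof (rule in_closed_span_closure[OF S'])
  show "sqint (\<lambda>x. f (\<alpha> * x + \<beta>))" using f \<alpha> by (intro sqint_affine in_closed_span_sqint)
  fix \<epsilon> :: real assume \<epsilon>: "\<epsilon> > 0"
  obtain F c where F: "finite F" "F \<subseteq> S" "nsq (\<lambda>x. f x - (\<Sum>h\<in>F. c h * h x)) < \<epsilon> * \<bar>\<alpha>\<bar>"
    using in_closed_spanE[OF f, of "\<epsilon> * \<bar>\<alpha>\<bar>"] \<epsilon> \<alpha> by auto
  have "\<bar>\<alpha>\<bar> * nsq (\<lambda>x. f (\<alpha> * x + \<beta>) - (\<Sum>h\<in>F. c h * h (\<alpha> * x + \<beta>))) < \<epsilon> * \<bar>\<alpha>\<bar>"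
    using F(3) nsq_affine[OF \<alpha>, of "\<lambda>x. f x - (\<Sum>h\<in>F. c h * h x)" \<beta>] by simp
  then have "nsq (\<lambda>x. f (\<alpha> * x + \<beta>) - (\<Sum>h\<in>F. c h * h (\<alpha> * x + \<beta>))) < \<epsilon>" using \<alpha> by simp
  moreover have "in_closed_span S' (\<lambda>x. \<Sum>h\<in>F. c h * h (\<alpha> * x + \<beta>))"
    using F g by (intro in_closed_span_sum[OF S'] in_closed_span_cmult) auto
  ultimately show "\<exists>g. in_closed_span S' g \<and> nsq (\<lambda>x. f (\<alpha> * x + \<beta>) - g x) < \<epsilon>" by blast
qed

text \<open>Cauchy-Schwarz in weighted form: the arithmetic-geometric mean inequality under the
  integral, with a weight \<open>t\<close> left free for the application.\<close>

lemma cmod_l2_inner_le: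
  assumes "sqint f" "sqint g" "t > 0"
  shows "cmod (l2_inner f g) \<le> (t * nsq f + nsq g / t) / 2"
proof -
  have "cmod (l2_inner f g) \<le> (LINT x|lborel. cmod (f x * cnj (g x)))"
    unfolding l2_inner_def by (rule integral_norm_bound)
  also have "\<dots> \<le> (LINT x|lborel. (t * (cmod (f x))\<^sup>2 + (cmod (g x))\<^sup>2 / t) / 2)"
  proof (rule integral_mono)
    show "integrable lborel (\<lambda>x. cmod (f x * cnj (g x)))" using assms by (intro integrable_norm sqint_inner_integrable)
    show "integrable lborel (\<lambda>x. (t * (cmod (f x))\<^sup>2 + (cmod (g x))\<^sup>2 / t) / 2)" using assms by (auto simp: sqint_def)
    fix x
    have "0 \<le> (t * cmod (f x) - cmod (g x))\<^sup>2 / t" using assms by simp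
    then show "cmod (f x * cnj (g x)) \<le> (t * (cmod (f x))\<^sup>2 + (cmod (g x))\<^sup>2 / t) / 2"
      using assms by (simp add: norm_mult power2_eq_square field_simps)
  qed
  also have "\<dots> = (t * nsq f + nsq g / t) / 2" using assms by (simp add: sqint_def nsq_def)
  finally show ?thesis .
qed

lemma in_closed_span_orthogonal:
  assumes S: "S \<subseteq> Collect sqint" and f: "in_closed_span S f" and g: "sqint g"
    and o: "\<And>s. s \<in> S \<Longrightarrow> l2_inner s g = 0"
  shows "l2_inner f g = 0"
proof (rule ccontr)
  assume n: "l2_inner f g \<noteq> 0"
  define d where "d = cmod (l2_inner f g)"
  have d: "d > 0" using n by (simp add: d_def)
  \<comment> \<open>With this weight \<open>nsq g / t < d\<close>, and an approximation error below
    \<open>d / t\<close> makes the other term of \<open>cmod_l2_inner_le\<close> smaller than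
    \<open>d\<close> too. Then \<open>d\<close> would be at most the mean of two smaller
    numbers.\<close>
  define t where "t = (nsq g + 1) / d"
  have t: "t > 0" using nsq_nonneg[of g] d by (simp add: t_def add_nonneg_pos)
  obtain F c where F: "finite F" "F \<subseteq> S" "nsq (\<lambda>x. f x - (\<Sum>h\<in>F. c h * h x)) < d / t"
    using in_closed_spanE[OF f, of "d / t"] t d by auto
  let ?L = "\<lambda>x. \<Sum>h\<in>F. c h * h x"
  have sL: "sqint (\<lambda>x. f x - ?L x)"
    using F S f by (intro sqint_diff sqint_lin_comb) (auto intro: in_closed_span_sqint)
  have "l2_inner ?L g = (\<Sum>h\<in>F. c h * l2_inner h g)"
    using F S g by (subst l2_inner_sum_left) (auto simp: l2_inner_cmult_left intro: sqint_cmult)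
  also have "\<dots> = 0" using F o by (intro sum.neutral) auto
  finally have "l2_inner (\<lambda>x. f x - ?L x) g = l2_inner f g"
    using F S g f by (subst l2_inner_diff_left) (auto intro!: sqint_lin_comb intro: in_closed_span_sqint)
  then have "d \<le> (t * nsq (\<lambda>x. f x - ?L x) + nsq g / t) / 2"
    unfolding d_def using cmod_l2_inner_le[of "\<lambda>x. f x - ?L x" g t, OF _ g t] sL by simp
  moreover have "t * nsq (\<lambda>x. f x - ?L x) < d" using F(3) t by (simp add: field_simps)
  moreover have "nsq g / t < d" using d nsq_nonneg[of g] by (simp add: t_def field_simps add_pos_nonneg)
  ultimately show False by simp
qed

text \<open>Pythagoras: dropping from an approximating combination the part orthogonal to the
  remainder can only improve the approximation.\<close>

lemma in_closed_span_orthogonal_part: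
  assumes S: "S \<union> T \<subseteq> Collect sqint" and f: "in_closed_span (S \<union> T) f"
    and oT: "\<And>t. t \<in> T \<Longrightarrow> l2_inner f t = 0"
    and oST: "\<And>s t. s \<in> S \<Longrightarrow> t \<in> T \<Longrightarrow> l2_inner s t = 0"
  shows "in_closed_span S f"
  unfolding in_closed_span_iff
proof (intro conjI allI impI)
  show sf: "sqint f" using f by (rule in_closed_span_sqint)
  fix \<epsilon> :: real assume \<epsilon>: "\<epsilon> > 0"
  obtain F c where F: "finite F" "F \<subseteq> S \<union> T" "nsq (\<lambda>x. f x - (\<Sum>h\<in>F. c h * h x)) < \<epsilon>"
    using in_closed_spanE[OF f \<epsilon>] by blast
  define A where "A x = f x - (\<Sum>h\<in>F \<inter> S. c h * h x)" for x
  define B where "B x = (\<Sum>h\<in>F - S. c h * h x)" for x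
  have sA: "sqint A" unfolding A_def using F S sf by (intro sqint_diff sqint_lin_comb) auto
  have sB: "sqint B" unfolding B_def using F S by (intro sqint_lin_comb) auto
  have At: "l2_inner A t = 0" if t: "t \<in> T" for t
  proof -
    have st: "sqint t" using t S by auto
    have "l2_inner (\<lambda>x. \<Sum>h\<in>F \<inter> S. c h * h x) t = (\<Sum>h\<in>F \<inter> S. c h * l2_inner h t)"
      using F S st by (subst l2_inner_sum_left) (auto simp: l2_inner_cmult_left intro: sqint_cmult)
    also have "\<dots> = 0" using oST t by (intro sum.neutral) auto
    finally show ?thesis unfolding A_def using F S sf st oT[OF t]
      by (subst l2_inner_diff_left) (auto intro!: sqint_lin_comb)
  qed
  have "l2_inner B A = (\<Sum>h\<in>F - S. c h * l2_inner h A)"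
    unfolding B_def using F S sA by (subst l2_inner_sum_left) (auto simp: l2_inner_cmult_left intro: sqint_cmult)
  also have "\<dots> = 0" using F At by (intro sum.neutral) (auto simp: l2_inner_commute[of _ A])
  finally have "l2_inner A B = 0" by (subst l2_inner_commute) simp
  then have "nsq (\<lambda>x. A x - B x) = nsq A + nsq B" using nsq_diff[OF sA sB] by simp
  moreover have "(\<lambda>x. A x - B x) = (\<lambda>x. f x - (\<Sum>h\<in>F. c h * h x))"
    using sum.Int_Diff[OF F(1), of "\<lambda>h. c h * h _" S] by (auto simp: A_def B_def fun_eq_iff)
  ultimately have "nsq A < \<epsilon>" using F(3) nsq_nonneg[of B] by simp
  then show "\<exists>F c. finite F \<and> F \<subseteq> S \<and> nsq (\<lambda>x. f x - (\<Sum>g\<in>F. c g * g x)) < \<epsilon>"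
    using F(1) unfolding A_def[abs_def] by (intro exI[of _ "F \<inter> S"] exI[of _ c]) auto
qed

section \<open>Density of band-limited functions\<close>

lemma tendsto_nsq_zero:
  assumes f: "\<And>n. f n \<in> borel_measurable borel" and w: "integrable lborel w"
    and lim: "AE x in lborel. (\<lambda>n. f n x) \<longlonglongrightarrow> 0" and b: "\<And>n x. (cmod (f n x))\<^sup>2 \<le> w x"
  shows "(\<lambda>n. nsq (f n)) \<longlonglongrightarrow> 0"
proof -
  have "(\<lambda>n. LINT x|lborel. (cmod (f n x))\<^sup>2) \<longlonglongrightarrow> (LINT x|(lborel :: real measure). 0)"
  proof (rule integral_dominated_convergence[where w=w and s="\<lambda>n x. (cmod (f n x))\<^sup>2" and f="\<lambda>_. 0"])
    show "AE x in lborel. (\<lambda>i. (cmod (f i x))\<^sup>2) \<longlonglongrightarrow> 0"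
      using lim
    proof eventually_elim
      case (elim x)
      then have "(\<lambda>i. (cmod (f i x))\<^sup>2) \<longlonglongrightarrow> (cmod 0)\<^sup>2" by (intro tendsto_intros)
      then show ?case by simp
    qed
    show "(\<lambda>x. (cmod (f n x))\<^sup>2) \<in> borel_measurable lborel" for n
      using f[of n] by measurable
  qed (use b w in auto)
  then show ?thesis by (simp add: nsq_def)
qed

lemma tendsto_0_less:
  fixes X :: "nat \<Rightarrow> real"
  assumes "X \<longlonglongrightarrow> 0" "\<epsilon> > 0" obtains n where "X n < \<epsilon>"
proof -
  have "\<forall>\<^sub>F n in sequentially. X n < \<epsilon>" using assms by (rule order_tendstoD)
  then show ?thesis using that by (meson eventually_happens' sequentially_bot)
qed

lemma sqint_approx_bounded:
  assumes f: "sqint f" and \<epsilon>: "\<epsilon> > 0"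
  obtains R where "R > 0" "nsq (\<lambda>x. f x - (if \<bar>x\<bar> \<le> R \<and> cmod (f x) \<le> R then f x else 0)) < \<epsilon>"
proof -
  have [measurable]: "f \<in> borel_measurable borel" using f by (simp add: sqint_def)
  let ?g = "\<lambda>n x. f x - (if \<bar>x\<bar> \<le> real (Suc n) \<and> cmod (f x) \<le> real (Suc n) then f x else 0)"
  have "(\<lambda>n. nsq (?g n)) \<longlonglongrightarrow> 0"
  proof (rule tendsto_nsq_zero)
    show "integrable lborel (\<lambda>x. (cmod (f x))\<^sup>2)" using f by (simp add: sqint_def)
    have "(\<lambda>n. ?g n x) \<longlonglongrightarrow> 0" for x
    proof (rule tendsto_eventually)
      obtain m :: nat where m: "max \<bar>x\<bar> (cmod (f x)) \<le> real m" using real_arch_simple by blast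
      show "\<forall>\<^sub>F n in sequentially. ?g n x = 0"
        using eventually_ge_at_top[of m]
      proof eventually_elim
        case (elim n)
        then have "real m \<le> real (Suc n)" by simp
        with m show ?case by auto
      qed
    qed
    then show "AE x in lborel. (\<lambda>n. ?g n x) \<longlonglongrightarrow> 0" by auto
  qed auto
  from tendsto_0_less[OF this \<epsilon>] obtain n where "nsq (?g n) < \<epsilon>" .
  then show ?thesis by (intro that[of "real (Suc n)"]) auto
qed

text \<open>Lebesgue measurability supplies continuous functions converging almost everywhere. They
  are forced under a common bound and into a common interval, so that dominated convergence gives
  mean-square convergence.\<close>

lemma bounded_approx_pcc:
  assumes [measurable]: "f \<in> borel_measurable borel" and M: "M > 0" "\<And>x. cmod (f x) \<le> M"
    and R: "\<And>x. f x \<noteq> 0 \<Longrightarrow> \<bar>x\<bar> < R" and \<epsilon>: "\<epsilon> > 0"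
  obtains g where "pcc g" "nsq (\<lambda>x. f x - g x) < \<epsilon>"
proof -
  have "f \<in> borel_measurable lborel" by simp
  then have "f \<in> borel_measurable (lebesgue_on UNIV)" by (metis measurable_completion lebesgue_on_UNIV_eq)
  then have "f measurable_on UNIV" by (subst measurable_on_iff_borel_measurable) auto
  then obtain N G where N: "negligible N" and G: "\<And>n. continuous_on UNIV (G n)"
    and lim: "\<And>x. x \<notin> N \<Longrightarrow> (\<lambda>n. G n x) \<longlonglongrightarrow> f x"
    unfolding measurable_on_def by auto
  \<comment> \<open>Radial retraction onto the disc of radius \<open>M\<close>: continuous, and the
    identity on the values of \<open>f\<close>.\<close>
  define H where "H n x = G n x / complex_of_real (max 1 (cmod (G n x) / M))" for n x
  have contH: "continuous_on UNIV (H n)" for n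
    unfolding H_def using M(1) by (intro continuous_intros G) (auto simp: max_def)
  have Hb: "cmod (H n x) \<le> M" for n x
    using M(1) by (auto simp: H_def norm_divide max_def field_simps split: if_splits)
  define K where "K n x = H n x * (if x \<in> {-R<..<R} then 1 else 0)" for n x
  have K: "pcc (K n)" for n unfolding K_def by (intro pcc_mult_cont contH pcc_const_interval)
  have [measurable]: "K n \<in> borel_measurable borel" for n using K pcc_measurable by blast
  have Hlim: "(\<lambda>n. H n x) \<longlonglongrightarrow> f x" if "x \<notin> N" for x
  proof -
    have "(\<lambda>n. H n x) \<longlonglongrightarrow> f x / complex_of_real (max 1 (cmod (f x) / M))"
      unfolding H_def using M(1) by (intro tendsto_intros lim that) (auto simp: max_def)
    moreover have "max 1 (cmod (f x) / M) = 1" using M(1) M(2)[of x] by (intro max_absorb1) simp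
    ultimately show ?thesis by simp
  qed
  have Klim: "(\<lambda>n. f x - K n x) \<longlonglongrightarrow> 0" if "x \<notin> N" for x
  proof -
    have "(\<lambda>n. f x - K n x) \<longlonglongrightarrow> f x - f x * (if x \<in> {-R<..<R} then 1 else 0)"
      unfolding K_def by (intro tendsto_intros Hlim that)
    moreover have "f x * (if x \<in> {-R<..<R} then 1 else 0) = f x" using R[of x] by force
    ultimately show ?thesis by (simp only: diff_self)
  qed
  have "(\<lambda>n. nsq (\<lambda>x. f x - K n x)) \<longlonglongrightarrow> 0"
  proof (rule tendsto_nsq_zero)
    show "integrable lborel (\<lambda>x. (2 * M)\<^sup>2 * indicat_real {-R..R} x)"
      by (intro integrable_mult_right integrable_real_indicator) (auto simp: emeasure_lborel_Icc_eq)
    have "N \<in> null_sets lebesgue" using N by (simp add: negligible_iff_null_sets)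
    then have "AE x in lborel. x \<notin> N"
      using AE_not_in AE_completion_iff by (metis)
    then show "AE x in lborel. (\<lambda>n. f x - K n x) \<longlonglongrightarrow> 0" by eventually_elim (rule Klim)
    fix n x
    show "(cmod (f x - K n x))\<^sup>2 \<le> (2 * M)\<^sup>2 * indicat_real {-R..R} x"
    proof (cases "\<bar>x\<bar> \<le> R")
      case True
      have "cmod (K n x) \<le> M" using Hb M by (auto simp: K_def)
      then have "cmod (f x - K n x) \<le> 2 * M" using M(2)[of x] norm_triangle_ineq4[of "f x" "K n x"] by linarith
      then have "(cmod (f x - K n x))\<^sup>2 \<le> (2 * M)\<^sup>2" by (intro power_mono) auto
      then show ?thesis using True by (auto simp: indicator_def)
    next
      case False
      then have "f x = 0" "K n x = 0" using R[of x] by (force simp: K_def)+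
      then show ?thesis by simp
    qed
  qed auto
  from tendsto_0_less[OF this \<epsilon>] obtain n where "nsq (\<lambda>x. f x - K n x) < \<epsilon>" .
  then show ?thesis using K that by blast
qed

lemma pcc_dense:
  assumes f: "sqint f" and \<epsilon>: "\<epsilon> > 0"
  obtains g where "pcc g" "nsq (\<lambda>x. f x - g x) < \<epsilon>"
proof -
  have [measurable]: "f \<in> borel_measurable borel" using f by (simp add: sqint_def)
  obtain R where R: "R > 0" "nsq (\<lambda>x. f x - (if \<bar>x\<bar> \<le> R \<and> cmod (f x) \<le> R then f x else 0)) < \<epsilon> / 4"
    using sqint_approx_bounded[OF f, of "\<epsilon>/4"] \<epsilon> by auto
  define k where "k x = (if \<bar>x\<bar> \<le> R \<and> cmod (f x) \<le> R then f x else 0)" for x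
  have km[measurable]: "k \<in> borel_measurable borel" unfolding k_def by measurable
  have "sqint k"
  proof -
    have "integrable lborel (\<lambda>x. (cmod (k x))\<^sup>2)"
      by (rule Bochner_Integration.integrable_bound[of _ "\<lambda>x. (cmod (f x))\<^sup>2"]) (use f in \<open>auto simp: sqint_def k_def\<close>)
    then show ?thesis by (simp add: sqint_def)
  qed
  obtain g where g: "pcc g" "nsq (\<lambda>x. k x - g x) < \<epsilon> / 4"
  proof (rule bounded_approx_pcc[of k "R" "R + 1" "\<epsilon>/4"])
    show "\<bar>x\<bar> < R + 1" if "k x \<noteq> 0" for x using that R by (auto simp: k_def split: if_splits)
  qed (use R \<epsilon> in \<open>auto simp: k_def\<close>)
  have "nsq (\<lambda>x. (f x - k x) + (k x - g x)) \<le> 2 * nsq (\<lambda>x. f x - k x) + 2 * nsq (\<lambda>x. k x - g x)"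
    using f \<open>sqint k\<close> pcc_sqint[OF g(1)] by (intro nsq_add_le sqint_diff)
  moreover have "nsq (\<lambda>x. f x - k x) < \<epsilon> / 4" using R by (simp add: k_def)
  ultimately have "nsq (\<lambda>x. f x - g x) < \<epsilon>" using g by simp
  then show ?thesis using g that by blast
qed

section \<open>The range of \<open>inv_fourier\<close>: Plancherel, adjoint and density\<close>

lemma inv_fourier_eq: "inv_fourier h = (\<lambda>x. inverse (complex_of_real (2 * pi)) * fint h x)"
  by (auto simp: inv_fourier_fint field_simps)

lemma sqint_inv_fourier: "pcc h \<Longrightarrow> sqint (inv_fourier h)"
  unfolding inv_fourier_eq by (intro sqint_cmult sqint_fint)

theorem Plancherel:
  assumes "pcc h" "pcc g"
  shows "l2_inner (inv_fourier h) (inv_fourier g) = l2_inner h g / complex_of_real (2 * pi)"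
proof -
  have "l2_inner (inv_fourier h) (inv_fourier g) =
     inverse (complex_of_real (2 * pi)) * (inverse (complex_of_real (2 * pi)) * (complex_of_real (2 * pi) * l2_inner h g))"
    unfolding inv_fourier_eq l2_inner_cmult_left l2_inner_cmult_right Plancherel_fint[OF assms] by simp
  then show ?thesis by (simp add: field_simps)
qed

lemma nsq_inv_fourier: "pcc h \<Longrightarrow> nsq (inv_fourier h) = nsq h / (2 * pi)"
  using Plancherel[of h h] unfolding nsq_eq_inner[symmetric] of_real_divide[symmetric] of_real_eq_iff .

text \<open>Only one factor is a transform here. Fubini moves the transform to the other factor,
  \<open>fint g (- \<xi>)\<close> being the Fourier transform of \<open>g\<close> at \<xi>.\<close>

lemma inner_inv_fourier:
  assumes g: "pcc g" and h: "pcc h"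
  shows "l2_inner g (inv_fourier h) = (LINT \<xi>|lborel. fint g (- \<xi>) * cnj (h \<xi>)) / complex_of_real (2 * pi)"
proof -
  have [measurable]: "h \<in> borel_measurable borel" "g \<in> borel_measurable borel" using assms by (auto simp: pcc_measurable)
  have "l2_inner g (fint h) = (LINT x|lborel. LINT \<xi>|lborel. g x * cis (- \<xi> * x) * cnj (h \<xi>))"
    unfolding l2_inner_def
  proof (intro Bochner_Integration.integral_cong refl)
    fix x
    have "cnj (fint h x) = (LINT \<xi>|lborel. cis (- \<xi> * x) * cnj (h \<xi>))"
      unfolding fint_def by (subst Bochner_Integration.integral_cnj[symmetric]) (auto simp: cis_cnj mult.commute)
    then show "g x * cnj (fint h x) = (LINT \<xi>|lborel. g x * cis (- \<xi> * x) * cnj (h \<xi>))"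
      by (simp add: mult.assoc)
  qed
  also have "\<dots> = (LINT \<xi>|lborel. LINT x|lborel. g x * cis (- \<xi> * x) * cnj (h \<xi>))"
  proof (rule Fubini_dominated)
    show "integrable lborel (\<lambda>\<xi>. cmod (h \<xi>))" "integrable lborel (\<lambda>x. cmod (g x))"
      using assms pcc_integrable by auto
  qed (auto simp: norm_mult lborel.sigma_finite_measure_axioms)
  also have "\<dots> = (LINT \<xi>|lborel. fint g (- \<xi>) * cnj (h \<xi>))"
    unfolding fint_def by (simp add: mult.commute[of _ "- _"] mult.commute)
  finally show ?thesis unfolding inv_fourier_eq l2_inner_cmult_right by (simp add: field_simps)
qed

text \<open>The Fourier transform \<open>H\<close> of an approximant \<open>g\<close> is cut down to
  the annulus. Since \<open>h n\<close> is a restriction of \<open>H\<close>, its inner product with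
  \<open>H\<close> is its own squared norm, and the squared error is exactly the mass of
  \<open>H\<close> outside the annulus divided by 2 \<pi>. This mass tends to 0.\<close>

lemma inv_fourier_annulus_dense:
  assumes f: "sqint f" and \<epsilon>: "\<epsilon> > 0" and c: "c > 0"
  obtains n h where "pcc h" "\<And>\<xi>. h \<xi> \<noteq> 0 \<Longrightarrow> \<bar>\<xi>\<bar> \<in> {c / 2 ^ n<..<c * 2 ^ n}"
    "nsq (\<lambda>x. f x - inv_fourier h x) < \<epsilon>"
proof -
  obtain g where g: "pcc g" "nsq (\<lambda>x. f x - g x) < \<epsilon> / 4" using pcc_dense[OF f, of "\<epsilon>/4"] \<epsilon> by auto
  have gm[measurable]: "g \<in> borel_measurable borel" using g(1) by (rule pcc_measurable)
  define H where "H \<xi> = fint g (- \<xi>)" for \<xi>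
  have Hm[measurable]: "H \<in> borel_measurable borel" unfolding H_def by measurable
  have Hc: "continuous_on UNIV H"
    unfolding H_def by (rule continuous_on_compose2[OF continuous_fint[OF g(1)]]) (auto intro: continuous_intros)
  have Hs: "sqint H" using sqint_affine[OF sqint_fint[OF g(1)], of "-1" 0] by (simp add: H_def[abs_def])
  have nH: "nsq H = 2 * pi * nsq g"
    using nsq_affine[of "-1" "fint g" 0] Plancherel_diag(2)[OF g(1)] by (simp add: H_def nsq_def)
  define h where "h n \<xi> = (if \<bar>\<xi>\<bar> \<in> {c / 2 ^ n<..<c * 2 ^ n} then H \<xi> else 0)" for n and \<xi> :: real
  have h: "pcc (h n)" for n
  proof -
    let ?A = "{c / 2 ^ n<..<c * 2 ^ n}" and ?B = "{- (c * 2 ^ n)<..<- (c / 2 ^ n)}"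
    have "h n \<xi> = H \<xi> * ((if \<xi> \<in> ?A then 1 else 0) + (if \<xi> \<in> ?B then 1 else 0))" for \<xi>
    proof -
      have "0 < c / 2 ^ n" using c by simp
      then show ?thesis by (cases "\<xi> \<ge> 0") (auto simp: h_def)
    qed
    then have "h n = (\<lambda>\<xi>. H \<xi> * ((if \<xi> \<in> ?A then 1 else 0) + (if \<xi> \<in> ?B then 1 else 0)))" by auto
    then show ?thesis by (simp only:) (intro pcc_mult_cont Hc pcc_add pcc_const_interval)
  qed
  have nh: "nsq (\<lambda>x. g x - inv_fourier (h n) x) = (nsq H - nsq (h n)) / (2 * pi)" for n
  proof -
    have "fint g (- \<xi>) * cnj (h n \<xi>) = complex_of_real ((cmod (h n \<xi>))\<^sup>2)" for \<xi>
      unfolding sq_norm_complex by (simp add: h_def H_def)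
    then have "l2_inner g (inv_fourier (h n)) = complex_of_real (nsq (h n)) / complex_of_real (2 * pi)"
      unfolding inner_inv_fourier[OF g(1) h] nsq_def by (simp only: integral_complex_of_real)
    then have "l2_inner g (inv_fourier (h n)) = complex_of_real (nsq (h n) / (2 * pi))"
      by (simp only: of_real_divide)
    then have "Re (l2_inner g (inv_fourier (h n))) = nsq (h n) / (2 * pi)" by (simp only: Re_complex_of_real)
    then show ?thesis
      using nsq_diff[OF pcc_sqint[OF g(1)] sqint_inv_fourier[OF h], of n] nH
      by (simp add: nsq_inv_fourier[OF h] diff_divide_distrib)
  qed
  have pw: "(\<lambda>n. h n \<xi>) \<longlonglongrightarrow> H \<xi>" if "\<xi> \<noteq> 0" for \<xi>
  proof (rule tendsto_eventually)
    obtain m1 where m1: "\<bar>\<xi>\<bar> / c < 2 ^ m1" using real_arch_pow[of 2] by force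
    obtain m2 where m2: "c / \<bar>\<xi>\<bar> < 2 ^ m2" using real_arch_pow[of 2] by force
    show "\<forall>\<^sub>F n in sequentially. h n \<xi> = H \<xi>"
      using eventually_ge_at_top[of "max m1 m2"]
    proof eventually_elim
      case (elim n)
      have "(2::real) ^ m1 \<le> 2 ^ n" "(2::real) ^ m2 \<le> 2 ^ n" using elim by (auto intro!: power_increasing)
      then have "\<bar>\<xi>\<bar> / c < 2 ^ n" "c / \<bar>\<xi>\<bar> < 2 ^ n" using m1 m2 by linarith+
      then show ?case using c that by (simp add: h_def field_simps)
    qed
  qed
  have "(\<lambda>n. LINT \<xi>|lborel. (cmod (h n \<xi>))\<^sup>2) \<longlonglongrightarrow> (LINT \<xi>|lborel. (cmod (H \<xi>))\<^sup>2)"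
  proof (rule integral_dominated_convergence)
    show "integrable lborel (\<lambda>\<xi>. (cmod (H \<xi>))\<^sup>2)" using Hs by (simp add: sqint_def)
    show "(\<lambda>\<xi>. (cmod (h n \<xi>))\<^sup>2) \<in> borel_measurable lborel" for n
      using pcc_measurable[OF h[of n]] by measurable
    have "AE \<xi> in lborel. \<xi> \<noteq> (0::real)" by (rule AE_lborel_singleton)
    then show "AE \<xi> in lborel. (\<lambda>i. (cmod (h i \<xi>))\<^sup>2) \<longlonglongrightarrow> (cmod (H \<xi>))\<^sup>2"
      by eventually_elim (intro tendsto_intros pw)
  qed (auto simp: h_def)
  then have "(\<lambda>n. nsq H - nsq (h n)) \<longlonglongrightarrow> nsq H - nsq H"
    unfolding nsq_def by (intro tendsto_intros)
  then have "(\<lambda>n. (nsq H - nsq (h n)) / (2 * pi)) \<longlonglongrightarrow> 0 / (2 * pi)" by (intro tendsto_intros) auto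
  then have "(\<lambda>n. nsq (\<lambda>x. g x - inv_fourier (h n) x)) \<longlonglongrightarrow> 0" unfolding nh by simp
  from tendsto_0_less[OF this, of "\<epsilon>/4"] \<epsilon> obtain n where n: "nsq (\<lambda>x. g x - inv_fourier (h n) x) < \<epsilon> / 4" by auto
  have "nsq (\<lambda>x. (f x - g x) + (g x - inv_fourier (h n) x)) \<le> 2 * nsq (\<lambda>x. f x - g x) + 2 * nsq (\<lambda>x. g x - inv_fourier (h n) x)"
    using f h pcc_sqint[OF g(1)] by (intro nsq_add_le sqint_diff sqint_inv_fourier)
  then have "nsq (\<lambda>x. f x - inv_fourier (h n) x) < \<epsilon>" using n g(2) by simp
  moreover have "\<bar>\<xi>\<bar> \<in> {c / 2 ^ n<..<c * 2 ^ n}" if "h n \<xi> \<noteq> 0" for \<xi>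
    using that unfolding h_def by (auto split: if_splits)
  ultimately show ?thesis using h[of n] that by blast
qed

section \<open>Inner products of wavelets and Weber's classes\<close>

text \<open>The Fourier transform of a translate by \<tau> of \<open>wav \<psi> j k\<close>, when
  \<open>u\<close> is that of \<psi>. Carrying \<tau> along lets one computation serve
  orthonormality and translation invariance alike.\<close>

definition wavhat :: "(real \<Rightarrow> complex) \<Rightarrow> int \<Rightarrow> int \<Rightarrow> real \<Rightarrow> real \<Rightarrow> complex" where
  "wavhat u j k \<tau> \<xi> = complex_of_real (2 powr (- real_of_int j / 2)) *
     (u (2 powr (- real_of_int j) * \<xi>) * cis (- (real_of_int k * 2 powr (- real_of_int j) + \<tau>) * \<xi>))"

lemma pcc_times_cis': "pcc h \<Longrightarrow> pcc (\<lambda>\<xi>. h \<xi> * cis (x * \<xi>))"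
  using pcc_times_cis[of h x] by (simp add: mult.commute[of x])

lemma pcc_wavhat: "pcc u \<Longrightarrow> pcc (wavhat u j k \<tau>)"
  unfolding wavhat_def by (intro pcc_cmult pcc_times_cis' pcc_scale) auto

lemma powr_half_mult: "2 powr (x / 2) * 2 powr (x / 2) = 2 powr (x::real)"
  by (simp add: powr_add[symmetric])

lemma inv_fourier_wavhat: "inv_fourier (wavhat u j k \<tau>) x = wav (inv_fourier u) j k (x - \<tau>)"
proof -
  define s where "s = (2::real) powr real_of_int j"
  define t where "t = (2::real) powr (real_of_int j / 2)"
  have s: "s > 0" "2 powr (- real_of_int j) = inverse s" by (simp_all add: s_def powr_minus)
  have t: "t > 0" "2 powr (- real_of_int j / 2) = inverse t" "t * t = s"
    using powr_minus[of "2::real" "real_of_int j / 2"] by (simp_all add: t_def s_def powr_half_mult)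
  have "fint (wavhat u j k \<tau>) x = s *\<^sub>R (LINT \<eta>|lborel. wavhat u j k \<tau> (0 + s * \<eta>) * cis ((0 + s * \<eta>) * x))"
    unfolding fint_def using s(1) by (subst lborel_integral_real_affine[where c=s and t=0]) auto
  also have "(LINT \<eta>|lborel. wavhat u j k \<tau> (0 + s * \<eta>) * cis ((0 + s * \<eta>) * x))
      = (LINT \<eta>|lborel. complex_of_real (inverse t) * (u \<eta> * cis (\<eta> * (s * (x - \<tau>) - real_of_int k))))"
  proof (rule Bochner_Integration.integral_cong[OF refl])
    fix \<eta> :: real
    have c: "cis (- (real_of_int k * inverse s + \<tau>) * (s * \<eta>)) * cis (s * \<eta> * x) = cis (\<eta> * (s * (x - \<tau>) - real_of_int k))"
      unfolding cis_mult using s(1) by (intro arg_cong[where f=cis]) (simp add: divide_simps, simp add: algebra_simps)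
    have i: "inverse s * (s * \<eta>) = \<eta>" using s(1) by simp
    show "wavhat u j k \<tau> (0 + s * \<eta>) * cis ((0 + s * \<eta>) * x) =
       complex_of_real (inverse t) * (u \<eta> * cis (\<eta> * (s * (x - \<tau>) - real_of_int k)))"
      unfolding wavhat_def s(2) t(2) add_0 i c[symmetric] by (simp only: mult.assoc)
  qed
  also have "\<dots> = complex_of_real (inverse t) * fint u (s * (x - \<tau>) - real_of_int k)"
    unfolding fint_def by (rule integral_mult_right_zero)
  finally have "fint (wavhat u j k \<tau>) x = complex_of_real (s * inverse t) * fint u (s * (x - \<tau>) - real_of_int k)"
    by (simp add: scaleR_conv_of_real)
  moreover have "s * inverse t = t" using t by (simp add: field_simps)
  ultimately show ?thesis
    unfolding inv_fourier_fint wav_def s_def[symmetric] t_def[symmetric] by simp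
qed

lemma wav_translate_eq: "(\<lambda>x. wav (inv_fourier u) j k (x - \<tau>)) = inv_fourier (wavhat u j k \<tau>)"
  by (simp add: inv_fourier_wavhat[abs_def, symmetric] fun_eq_iff inv_fourier_wavhat)

lemma wav_eq: "wav (inv_fourier u) j k = inv_fourier (wavhat u j k 0)"
  using wav_translate_eq[of u j k 0] by simp

lemma sqint_wav: "pcc u \<Longrightarrow> sqint (wav (inv_fourier u) j k)"
  unfolding wav_eq by (intro sqint_inv_fourier pcc_wavhat)

definition scale_corr :: "(real \<Rightarrow> complex) \<Rightarrow> nat \<Rightarrow> real \<Rightarrow> complex" where
  "scale_corr u j s = (LINT \<eta>|lborel. u (2 ^ j * \<eta>) * cnj (u \<eta>) * cis (s * \<eta>))"

text \<open>Rescaling the frequency by 2^l', the finer level, leaves only the level difference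
  \<open>j\<close> and one frequency: the positions k and k' contribute an integer because j is
  nonnegative, and the translation contributes -\<tau> 2^l'.\<close>

lemma inner_translated_wav:
  assumes u: "pcc u" and l': "l' = l + int j"
  shows "l2_inner (\<lambda>x. wav (inv_fourier u) l k (x - \<tau>)) (wav (inv_fourier u) l' k')
    = complex_of_real (2 powr (real j / 2) / (2 * pi)) *
      scale_corr u j (real_of_int k' - real_of_int k * 2 ^ j - \<tau> * 2 powr real_of_int l')"
proof -
  define s where "s = (2::real) powr real_of_int l'"
  have s: "s > 0" "2 powr (- real_of_int l') = inverse s" by (simp_all add: s_def powr_minus)
  have sl: "2 powr (- real_of_int l) * s = 2 ^ j"
    unfolding s_def l' by (simp add: powr_add[symmetric] powr_realpow)
  have amp: "2 powr (- real_of_int l / 2) * 2 powr (- real_of_int l' / 2) * s = 2 powr (real j / 2)"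
    unfolding s_def l' by (simp add: powr_add[symmetric] add_divide_distrib diff_divide_distrib)
  let ?\<sigma> = "real_of_int k' - real_of_int k * 2 ^ j - \<tau> * s"
  have "l2_inner (wavhat u l k \<tau>) (wavhat u l' k' 0) = s *\<^sub>R (LINT \<eta>|lborel. wavhat u l k \<tau> (0 + s * \<eta>) * cnj (wavhat u l' k' 0 (0 + s * \<eta>)))"
    unfolding l2_inner_def using s(1) by (subst lborel_integral_real_affine[where c=s and t=0]) auto
  also have "(LINT \<eta>|lborel. wavhat u l k \<tau> (0 + s * \<eta>) * cnj (wavhat u l' k' 0 (0 + s * \<eta>)))
    = (LINT \<eta>|lborel. complex_of_real (2 powr (- real_of_int l / 2) * 2 powr (- real_of_int l' / 2)) *
        (u (2 ^ j * \<eta>) * cnj (u \<eta>) * cis (?\<sigma> * \<eta>)))"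
  proof (rule Bochner_Integration.integral_cong[OF refl])
    fix \<eta> :: real
    have 1: "2 powr (- real_of_int l) * (s * \<eta>) = 2 ^ j * \<eta>" using sl by (metis mult.assoc)
    have 2: "2 powr (- real_of_int l') * (s * \<eta>) = \<eta>" using s by simp
    have "- (real_of_int k * 2 powr (- real_of_int l) + \<tau>) * (s * \<eta>) = - (real_of_int k * (2 powr (- real_of_int l) * s) + \<tau> * s) * \<eta>"
      by (simp add: algebra_simps)
    then have 3: "- (real_of_int k * 2 powr (- real_of_int l) + \<tau>) * (s * \<eta>) = - (real_of_int k * 2 ^ j + \<tau> * s) * \<eta>"
      unfolding sl .
    have 4: "- (real_of_int k' * 2 powr (- real_of_int l') + 0) * (s * \<eta>) = - real_of_int k' * \<eta>" using s by simp
    have "cis (- (real_of_int k * 2 ^ j + \<tau> * s) * \<eta>) * cnj (cis (- real_of_int k' * \<eta>)) = cis (?\<sigma> * \<eta>)"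
      by (simp add: cis_cnj cis_mult algebra_simps)
    then show "wavhat u l k \<tau> (0 + s * \<eta>) * cnj (wavhat u l' k' 0 (0 + s * \<eta>)) =
       complex_of_real (2 powr (- real_of_int l / 2) * 2 powr (- real_of_int l' / 2)) * (u (2 ^ j * \<eta>) * cnj (u \<eta>) * cis (?\<sigma> * \<eta>))"
      unfolding wavhat_def add_0 1 2 3 4 complex_cnj_mult complex_cnj_complex_of_real of_real_mult
      by (metis (no_types, lifting) mult.assoc mult.left_commute)
  qed
  also have "\<dots> = complex_of_real (2 powr (- real_of_int l / 2) * 2 powr (- real_of_int l' / 2)) * scale_corr u j ?\<sigma>"
    unfolding scale_corr_def by (rule integral_mult_right_zero)
  also have "s *\<^sub>R \<dots> = complex_of_real (2 powr (- real_of_int l / 2) * 2 powr (- real_of_int l' / 2) * s) * scale_corr u j ?\<sigma>"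
    by (simp add: scaleR_conv_of_real)
  finally have "l2_inner (wavhat u l k \<tau>) (wavhat u l' k' 0) = complex_of_real (2 powr (real j / 2)) * scale_corr u j ?\<sigma>"
    unfolding amp .
  then show ?thesis
    unfolding wav_translate_eq wav_eq[of u l'] Plancherel[OF pcc_wavhat[OF u] pcc_wavhat[OF u]] s_def[symmetric]
    by simp
qed

lemma inner_wav:
  assumes "pcc u" "l' = l + int j"
  shows "l2_inner (wav (inv_fourier u) l k) (wav (inv_fourier u) l' k')
    = complex_of_real (2 powr (real j / 2) / (2 * pi)) * scale_corr u j (real_of_int (k' - k * 2 ^ j))"
  using inner_translated_wav[OF assms, of k 0 k'] by simp

lemma wav_orthonormal:
  assumes u: "pcc u"
    and c0: "\<And>k::int. scale_corr u 0 (real_of_int k) = (if k = 0 then complex_of_real (2 * pi) else 0)"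
    and cj: "\<And>j k. j \<ge> 1 \<Longrightarrow> scale_corr u j (real_of_int k) = 0"
  shows "l2_inner (wav (inv_fourier u) j k) (wav (inv_fourier u) j' k') = (if j = j' \<and> k = k' then 1 else 0)"
proof -
  have lt: "l2_inner (wav (inv_fourier u) j k) (wav (inv_fourier u) j' k') = 0" if "j < j'" for j k j' k'
  proof -
    have j': "j' = j + int (nat (j' - j))" using that by simp
    show ?thesis unfolding inner_wav[OF u j'] using that by (subst cj) auto
  qed
  consider "j < j'" | "j' < j" | "j = j'" by linarith
  then show ?thesis
  proof cases
    case 2 then show ?thesis by (subst l2_inner_commute) (simp add: lt)
  next
    case 3
    then have "j' = j + int 0" by simp
    then show ?thesis by (subst inner_wav[OF u, of j' j 0]) (use 3 in \<open>auto simp: c0 simp del: of_int_diff\<close>)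
  qed (simp add: lt)
qed

text \<open>By completeness a translated wavelet of negative level lies in the closed span of the
  whole system. The hypothesis makes it orthogonal to every level \<ge> 0, so
  \<open>in_closed_span_orthogonal_part\<close> leaves the negative levels only;
  \<open>in_closed_span_affine\<close> extends this from the generators to
  \<open>V0\<close>.\<close>

lemma wclass_L_I:
  assumes u: "pcc u" and w: "is_wavelet (inv_fourier u)"
    and c: "\<And>j p. j \<ge> 1 \<Longrightarrow> scale_corr u j (real_of_int p / 2 ^ r) = 0"
  shows "inv_fourier u \<in> wclass_L r"
proof -
  let ?\<psi> = "inv_fourier u"
  let ?S = "{wav ?\<psi> l k | l k. l < 0}" and ?T = "{wav ?\<psi> l k | l k. 0 \<le> l}"
  have ST: "?S \<union> ?T = range (\<lambda>(j, k). wav ?\<psi> j k)" by force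
  have sq: "?S \<union> ?T \<subseteq> Collect sqint" using sqint_wav[OF u] by auto
  have tr: "in_closed_span ?S (\<lambda>x. wav ?\<psi> l k (x - real_of_int m / 2 ^ r))" if l: "l < 0" for l k m
  proof (rule in_closed_span_orthogonal_part[OF sq])
    show "in_closed_span (?S \<union> ?T) (\<lambda>x. wav ?\<psi> l k (x - real_of_int m / 2 ^ r))"
      unfolding ST using w sqint_inv_fourier[OF pcc_wavhat[OF u]] by (simp add: is_wavelet_def wav_translate_eq)
    show "l2_inner s t = 0" if "s \<in> ?S" "t \<in> ?T" for s t
      using that w by (auto simp: is_wavelet_def)
    fix t assume "t \<in> ?T"
    then obtain l' k' where t: "t = wav ?\<psi> l' k'" "0 \<le> l'" by auto
    define j where "j = nat (l' - l)"
    have j: "l' = l + int j" "j \<ge> 1" using l t(2) by (auto simp: j_def)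
    \<comment> \<open>Here it matters that the tested level is nonnegative: 2^l' is an integer, so
      multiplying the translation by it keeps the frequency in 2^(-r) times the integers.\<close>
    have "2 powr real_of_int l' = (2::real) ^ nat l'" using t(2) by (simp flip: powr_realpow)
    then have e: "real_of_int k' - real_of_int k * 2 ^ j - real_of_int m / 2 ^ r * 2 powr real_of_int l'
       = real_of_int ((k' - k * 2 ^ j) * 2 ^ r - m * 2 ^ nat l') / 2 ^ r"
      by (simp add: field_simps)
    show "l2_inner (\<lambda>x. wav ?\<psi> l k (x - real_of_int m / 2 ^ r)) t = 0"
      unfolding t(1) inner_translated_wav[OF u j(1)] e c[OF j(2)] by simp
  qed
  have "(\<lambda>x. f (x - real_of_int m / 2 ^ r)) \<in> V0 ?\<psi>" if "f \<in> V0 ?\<psi>" for f m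
  proof -
    have f: "in_closed_span ?S f" using that by (simp add: V0_def)
    have "in_closed_span ?S (\<lambda>x. f (1 * x + - (real_of_int m / 2 ^ r)))"
    proof (rule in_closed_span_affine[OF _ _ f])
      fix g assume "g \<in> ?S"
      then show "in_closed_span ?S (\<lambda>x. g (1 * x + - (real_of_int m / 2 ^ r)))" using tr by auto
    qed (use sq in auto)
    then show ?thesis by (simp add: V0_def)
  qed
  then show ?thesis using w by (simp add: wclass_L_def)
qed

text \<open>Adjacent levels already detect the failure: translating the wavelet of level -1 at
  position 0 by 2^(-r) and testing against \<psi> itself produces exactly the frequency
  -2^(-r).\<close>

lemma not_wclass_L_I:
  assumes u: "pcc u" and c: "scale_corr u 1 (- (1 / 2 ^ r)) \<noteq> 0"
  shows "inv_fourier u \<notin> wclass_L r"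
proof
  let ?\<psi> = "inv_fourier u"
  let ?S = "{wav ?\<psi> l k | l k. l < 0}"
  assume L: "?\<psi> \<in> wclass_L r"
  then have w: "is_wavelet ?\<psi>" by (simp add: wclass_L_def)
  have "wav ?\<psi> (-1) 0 \<in> ?S" by (rule CollectI, rule exI[of _ "-1"], rule exI[of _ 0]) simp
  then have "wav ?\<psi> (-1) 0 \<in> V0 ?\<psi>"
    using sqint_wav[OF u] by (auto simp: V0_def intro!: in_closed_span_base)
  then have "(\<lambda>x. wav ?\<psi> (-1) 0 (x - real_of_int 1 / 2 ^ r)) \<in> V0 ?\<psi>"
    using L unfolding wclass_L_def by blast
  then have "in_closed_span ?S (\<lambda>x. wav ?\<psi> (-1) 0 (x - 1 / 2 ^ r))" by (simp add: V0_def)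
  then have "l2_inner (\<lambda>x. wav ?\<psi> (-1) 0 (x - 1 / 2 ^ r)) (wav ?\<psi> 0 0) = 0"
    by (rule in_closed_span_orthogonal[rotated]) (use sqint_wav[OF u] w in \<open>auto simp: is_wavelet_def\<close>)
  moreover have "(0::int) = -1 + int 1" by simp
  ultimately show False using inner_translated_wav[OF u, of 0 "-1" 1 0 "1 / 2 ^ r" 0] c by simp
qed

section \<open>Approximation by trigonometric polynomials\<close>

text \<open>A predicate generated by monomials and sums instead of a coefficient sequence: every
  property required later, including membership of the products with \<open>u\<close> in a closed
  span, passes through these two rules.\<close>

inductive trig_poly :: "(real \<Rightarrow> complex) \<Rightarrow> bool" where
  trig_poly_cis: "trig_poly (\<lambda>t. c * cis (real_of_int k * t))"
| trig_poly_add: "trig_poly p \<Longrightarrow> trig_poly q \<Longrightarrow> trig_poly (\<lambda>t. p t + q t)"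

lemma trig_poly_continuous: "trig_poly p \<Longrightarrow> continuous_on UNIV p"
  by (induction rule: trig_poly.induct) (intro continuous_intros | assumption)+

lemma trig_poly_periodic: "trig_poly p \<Longrightarrow> p (t + 2 * pi * real_of_int i) = p t"
proof (induction rule: trig_poly.induct)
  case (trig_poly_cis c k)
  have "cis (real_of_int k * (t + 2 * pi * real_of_int i)) = cis (real_of_int k * t) * cis (2 * pi * real_of_int (k * i))"
    by (simp add: cis_mult algebra_simps)
  also have "cis (2 * pi * real_of_int (k * i)) = 1" by (rule cis_multiple_2pi) auto
  finally show ?case by simp
qed auto

lemma trig_poly_const: "trig_poly (\<lambda>t. c)"
  using trig_poly_cis[of c 0] by simp

lemma trig_poly_cis_mult:
  assumes "trig_poly p" shows "trig_poly (\<lambda>t. c * cis (real_of_int k * t) * p t)"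
  using assms
proof (induction rule: trig_poly.induct)
  case (trig_poly_cis d l)
  have "cis (real_of_int (k + l) * t) = cis (real_of_int k * t) * cis (real_of_int l * t)" for t
    by (simp add: cis_mult distrib_right)
  then have "(\<lambda>t. c * cis (real_of_int k * t) * (d * cis (real_of_int l * t))) = (\<lambda>t. (c * d) * cis (real_of_int (k + l) * t))"
    by (simp only: mult_ac)
  then show ?case using trig_poly.trig_poly_cis[of "c * d" "k + l"] by (simp only:)
next
  case (trig_poly_add p q)
  then show ?case using trig_poly.trig_poly_add by (fastforce simp: distrib_left)
qed

lemma trig_poly_cmult: "trig_poly p \<Longrightarrow> trig_poly (\<lambda>t. c * p t)"
  using trig_poly_cis_mult[of p c 0] by simp

lemma trig_poly_mult:
  assumes "trig_poly p" "trig_poly q" shows "trig_poly (\<lambda>t. p t * q t)"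
  using assms(1)
proof (induction rule: trig_poly.induct)
  case (trig_poly_cis c k)
  then show ?case using trig_poly_cis_mult[OF assms(2)] by simp
next
  case (trig_poly_add p q)
  then show ?case using trig_poly.trig_poly_add by (fastforce simp: distrib_right)
qed

lemma trig_poly_shift: "trig_poly p \<Longrightarrow> trig_poly (\<lambda>t. p (t - \<alpha>))"
proof (induction rule: trig_poly.induct)
  case (trig_poly_cis c k)
  have "(\<lambda>t. c * cis (real_of_int k * (t - \<alpha>))) = (\<lambda>t. (c * cis (- real_of_int k * \<alpha>)) * cis (real_of_int k * t))"
    by (simp add: cis_mult mult.assoc algebra_simps)
  then show ?case using trig_poly.trig_poly_cis by simp
qed (auto intro: trig_poly.trig_poly_add)

text \<open>On the unit circle a real linear functional is a combination of cos t and sin t, hence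
  of cis t and cis (-t); products and sums then follow by induction.\<close>

lemma trig_poly_real_polynomial:
  fixes p :: "complex \<Rightarrow> real"
  assumes "real_polynomial_function p" shows "trig_poly (\<lambda>t. complex_of_real (p (cis t)))"
  using assms
proof (induction rule: real_polynomial_function.induct)
  case (linear f)
  have e: "complex_of_real (f (cis t)) = (of_real (f 1) / 2 + of_real (f \<i>) / (2 * \<i>)) * cis (real_of_int 1 * t)
      + (of_real (f 1) / 2 - of_real (f \<i>) / (2 * \<i>)) * cis (real_of_int (-1) * t)" for t
  proof -
    have "cis t = cos t *\<^sub>R 1 + sin t *\<^sub>R \<i>" by (simp add: complex_eq_iff)
    then have "f (cis t) = cos t * f 1 + sin t * f \<i>"
      using linear by (simp add: bounded_linear.linear linear_add linear_scale)
    then show ?thesis by (simp add: complex_eq_iff)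
  qed
  show ?case unfolding e by (intro trig_poly.intros)
next
  case (const c)
  then show ?case by (rule trig_poly_const)
qed (auto intro: trig_poly_add trig_poly_mult)

lemma trig_poly_polynomial_function:
  fixes g :: "complex \<Rightarrow> complex"
  assumes "polynomial_function g" shows "trig_poly (\<lambda>t. g (cis t))"
proof -
  have "real_polynomial_function (\<lambda>z. Re (g z))" "real_polynomial_function (\<lambda>z. Im (g z))"
    using assms bounded_linear_Re bounded_linear_Im unfolding polynomial_function_def by (auto simp: o_def)
  then have "trig_poly (\<lambda>t. complex_of_real (Re (g (cis t))) + \<i> * complex_of_real (Im (g (cis t))))"
    by (intro trig_poly_add trig_poly_cmult trig_poly_real_polynomial)
  then show ?thesis by (simp add: complex_eq[symmetric])
qed

section \<open>From the circle to approximation on one period\<close>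

lemma Arg2pi_cis: "0 \<le> t \<Longrightarrow> t < 2 * pi \<Longrightarrow> Arg2pi (cis t) = t"
  by (rule Arg2pi_unique[of 1]) (auto simp: cis_conv_exp)

lemma cos_le_cos_near_end:
  assumes "0 \<le> \<delta>" "\<delta> \<le> \<theta>" "\<theta> \<le> 2 * pi - \<delta>" shows "cos \<theta> \<le> cos \<delta>"
proof (cases "\<theta> \<le> pi")
  case True
  then show ?thesis using assms by (intro cos_monotone_0_pi_le) auto
next
  case False
  then have "cos (2 * pi - \<theta>) \<le> cos \<delta>" using assms by (intro cos_monotone_0_pi_le) auto
  then show ?thesis by (simp add: cos_diff)
qed

text \<open>\<open>Arg2pi\<close> jumps across the positive reals, but \<open>g\<close> vanishes at
  angles near 0 and 2 \<pi>, so on the circle the composite is locally zero at the only critical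
  point, 1.\<close>

lemma continuous_on_circle_of_interval:
  fixes g :: "real \<Rightarrow> complex"
  assumes g: "continuous_on UNIV g" and \<delta>: "0 < \<delta>" "\<delta> \<le> pi"
    and z: "\<And>t. g t \<noteq> 0 \<Longrightarrow> \<delta> \<le> t \<and> t \<le> 2 * pi - \<delta>"
  shows "continuous_on (sphere 0 1) (\<lambda>z. g (Arg2pi z))"
proof (rule continuous_at_imp_continuous_on, rule ballI)
  fix z :: complex assume z1: "z \<in> sphere 0 1"
  show "isCont (\<lambda>z. g (Arg2pi z)) z"
  proof (cases "z \<in> \<real>\<^sub>\<ge>\<^sub>0")
    case False
    have "isCont g (Arg2pi z)" using g by (simp add: continuous_on_eq_continuous_at)
    with continuous_at_Arg2pi[OF False] show ?thesis by (rule isCont_o2)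
  next
    case True
    then obtain r where r: "z = of_real r" "r \<ge> 0" by (auto simp: nonneg_Reals_def)
    then have z: "z = 1" using z1 by simp
    have co: "cos \<delta> < 1" using cos_monotone_0_pi[of 0 \<delta>] \<delta> by simp
    have "open {w::complex. Re w * 1 > cos \<delta> * 1}" by (intro open_Collect_less continuous_intros)
    then have "\<forall>\<^sub>F w in nhds z. w \<in> {w. Re w > cos \<delta>}"
      using co z by (intro eventually_nhds_in_open) auto
    moreover have "\<forall>\<^sub>F w in nhds z. w \<in> ball 1 1" using z by (intro eventually_nhds_in_open) auto
    \<comment> \<open>For w near 1 this describes a sector: the cosine of the argument exceeds cos
      \<delta>, and at such angles \<open>g\<close> is zero.\<close>
    moreover have "\<forall>\<^sub>F w in nhds z. cmod w * cos \<delta> < Re w"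
    proof -
      have "open {w::complex. cmod w * cos \<delta> < Re w}" by (intro open_Collect_less continuous_intros)
      then show ?thesis using eventually_nhds_in_open[of "{w::complex. cmod w * cos \<delta> < Re w}" z] co z by simp
    qed
    ultimately have "\<forall>\<^sub>F w in nhds z. g (Arg2pi w) = 0"
    proof eventually_elim
      case (elim w)
      show "g (Arg2pi w) = 0"
      proof (rule ccontr)
        assume "g (Arg2pi w) \<noteq> 0"
        then have "cos (Arg2pi w) \<le> cos \<delta>" using assms(4) \<delta> by (intro cos_le_cos_near_end) auto
        then have "cmod w * cos (Arg2pi w) \<le> cmod w * cos \<delta>" by (intro mult_left_mono) auto
        then show False using elim cos_Arg2pi[of w] by simp
      qed
    qed
    then show ?thesis by (rule isCont_eventually_eq[rotated]) auto
  qed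
qed

text \<open>Stone-Weierstrass on the circle. \<open>g\<close> is not periodic, so closeness is
  asserted on a single period, where \<open>Arg2pi\<close> inverts \<open>cis\<close>.\<close>

lemma trig_poly_uniform_approx:
  fixes g :: "real \<Rightarrow> complex"
  assumes g: "continuous_on UNIV g" and \<delta>: "0 < \<delta>" "\<delta> \<le> pi"
    and z: "\<And>t. g t \<noteq> 0 \<Longrightarrow> \<delta> \<le> t \<and> t \<le> 2 * pi - \<delta>" and \<epsilon>: "\<epsilon> > 0"
  obtains p where "trig_poly p" "\<And>t. t \<in> {0..<2*pi} \<Longrightarrow> cmod (g t - p t) < \<epsilon>"
proof -
  obtain q :: "complex \<Rightarrow> complex" where q: "polynomial_function q" "\<And>x. x \<in> sphere 0 1 \<Longrightarrow> norm (g (Arg2pi x) - q x) < \<epsilon>"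
    using Stone_Weierstrass_polynomial_function[OF _ continuous_on_circle_of_interval[OF assms(1-4)] \<epsilon>] by auto
  show ?thesis
  proof (rule that[of "\<lambda>t. q (cis t)"])
    show "trig_poly (\<lambda>t. q (cis t))" using q(1) by (rule trig_poly_polynomial_function)
    show "cmod (g t - q (cis t)) < \<epsilon>" if "t \<in> {0..<2*pi}" for t
      using q(2)[of "cis t"] that by (auto simp: Arg2pi_cis)
  qed
qed

text \<open>A factor depending on the distance to the jumps removes them. The endpoints 0 and 2
  \<pi> are counted among the jumps, so that the result also vanishes near them, as the passage to
  the circle requires.\<close>

lemma pcc_continuous_cutoff:
  assumes h: "pcc h" and hs: "\<And>x. h x \<noteq> 0 \<Longrightarrow> x \<in> {0<..<2*pi}" and \<epsilon>: "\<epsilon> > 0"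
  obtains g \<delta> where "continuous_on UNIV g" "0 < \<delta>" "\<delta> \<le> pi"
    "\<And>t. g t \<noteq> 0 \<Longrightarrow> \<delta> \<le> t \<and> t \<le> 2 * pi - \<delta>" "nsq (\<lambda>x. h x - g x) < \<epsilon>"
proof -
  obtain M R D where *: "0 < M" "0 < R" "finite D" "\<And>x. cmod (h x) \<le> M"
    "\<And>x. R < \<bar>x\<bar> \<Longrightarrow> h x = 0" "\<And>x. x \<notin> D \<Longrightarrow> isCont h x" using h by (rule pccE) blast
  define E where "E = D \<union> {0, 2 * pi}"
  have E: "finite E" "E \<noteq> {}" "closed E" using *(3) by (auto simp: E_def intro: finite_imp_closed)
  \<comment> \<open>The cutoff is 0 within distance 1 / (n + 1) of \<open>E\<close> and 1 from
    distance 2 / (n + 1) on.\<close>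
  define cut where "cut n x = max 0 (min 1 (real (Suc n) * infdist x E - 1))" for n and x :: real
  define G where "G n x = complex_of_real (cut n x) * h x" for n x
  have cut01: "0 \<le> cut n x" "cut n x \<le> 1" for n x by (auto simp: cut_def)
  have cutc: "continuous_on UNIV (cut n)" for n unfolding cut_def by (intro continuous_intros)
  have cut0: "cut n x = 0" if "infdist x E < inverse (real (Suc n))" for n x
  proof -
    have "real (Suc n) * infdist x E < real (Suc n) * inverse (real (Suc n))"
      using that by (intro mult_strict_left_mono) auto
    then have "real (Suc n) * infdist x E < 1" by simp
    then show ?thesis unfolding cut_def by linarith
  qed
  have pG: "pcc (G n)" for n unfolding G_def by (intro pcc_mult_cont h continuous_intros cutc)
  have cG: "continuous_on UNIV (G n)" for n
  proof -
    have "isCont (G n) x" for x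
    proof (cases "x \<in> E")
      case False
      then have "isCont h x" using *(6) by (auto simp: E_def)
      moreover have "isCont (cut n) x" using cutc by (simp add: continuous_on_eq_continuous_at)
      ultimately show ?thesis unfolding G_def by (intro continuous_intros)
    next
      case True
      have "\<forall>\<^sub>F y in nhds x. y \<in> ball x (inverse (real (Suc n)))" by (intro eventually_nhds_in_open) auto
      then have "\<forall>\<^sub>F y in nhds x. G n y = 0"
      proof eventually_elim
        case (elim y)
        have "infdist y E \<le> dist y x" using True by (rule infdist_le)
        then have "infdist y E < inverse (real (Suc n))" using elim by (simp add: dist_commute)
        then show ?case by (simp add: G_def cut0)
      qed
      then show ?thesis by (rule isCont_eventually_eq[rotated]) auto
    qed
    then show ?thesis by (auto simp: continuous_on_eq_continuous_at)
  qed
  have Gs: "inverse (real (Suc n)) \<le> t \<and> t \<le> 2 * pi - inverse (real (Suc n))" if "G n t \<noteq> 0" for n t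
  proof -
    have t: "t \<in> {0<..<2*pi}" using that hs[of t] by (auto simp: G_def)
    have "\<not> infdist t E < inverse (real (Suc n))" using that cut0 by (auto simp: G_def)
    moreover have "infdist t E \<le> dist t 0" "infdist t E \<le> dist t (2 * pi)" by (intro infdist_le, simp add: E_def)+
    ultimately show ?thesis using t by (auto simp: dist_real_def)
  qed
  have lim: "(\<lambda>n. h x - G n x) \<longlonglongrightarrow> 0" if "x \<notin> E" for x
  proof (rule tendsto_eventually)
    have "infdist x E > 0" using that E by (simp add: infdist_pos_not_in_closed)
    then obtain m :: nat where m: "2 < real m * infdist x E" using ex_less_of_nat_mult by blast
    show "\<forall>\<^sub>F n in sequentially. h x - G n x = 0"
      using eventually_ge_at_top[of m]
    proof eventually_elim
      case (elim n)
      then have "real m * infdist x E \<le> real (Suc n) * infdist x E" by (intro mult_right_mono) (auto simp: infdist_nonneg)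
      then have "cut n x = 1" using m unfolding cut_def by linarith
      then show ?case by (simp add: G_def)
    qed
  qed
  have "(\<lambda>n. nsq (\<lambda>x. h x - G n x)) \<longlonglongrightarrow> 0"
  proof (rule tendsto_nsq_zero)
    show "(\<lambda>x. h x - G n x) \<in> borel_measurable borel" for n
      by (intro pcc_measurable pcc_diff h pG)
    show "integrable lborel (\<lambda>x. (cmod (h x))\<^sup>2)" using pcc_sqint[OF h] by (simp add: sqint_def)
    have "AE x in lborel. x \<notin> E" using E(1) by (intro AE_not_in finite_imp_null_set_lborel)
    then show "AE x in lborel. (\<lambda>n. h x - G n x) \<longlonglongrightarrow> 0" by eventually_elim (rule lim)
    fix n x
    have "h x - G n x = complex_of_real (1 - cut n x) * h x" by (simp add: G_def algebra_simps)
    then have "cmod (h x - G n x) = (1 - cut n x) * cmod (h x)" using cut01 by (simp only: norm_mult norm_of_real) simp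
    also have "\<dots> \<le> cmod (h x)" using cut01 by (intro mult_left_le_one_le) auto
    finally show "(cmod (h x - G n x))\<^sup>2 \<le> (cmod (h x))\<^sup>2" by (intro power_mono) auto
  qed
  from tendsto_0_less[OF this \<epsilon>] obtain n where n: "nsq (\<lambda>x. h x - G n x) < \<epsilon>" .
  have "inverse (real (Suc n)) \<le> 1" by (simp add: field_simps)
  then have "inverse (real (Suc n)) \<le> pi" using pi_gt3 by linarith
  then show ?thesis using n cG Gs by (intro that[of "G n" "inverse (real (Suc n))"]) auto
qed

lemma trig_poly_dense:
  assumes h: "pcc h" and hs: "\<And>x. h x \<noteq> 0 \<Longrightarrow> x \<in> {\<alpha><..<\<alpha> + 2 * pi}" and \<epsilon>: "\<epsilon> > 0"
  obtains p where "trig_poly p" "nsq (\<lambda>x. if x \<in> {\<alpha>..<\<alpha> + 2 * pi} then h x - p x else 0) < \<epsilon>"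
proof -
  define k where "k x = h (x + \<alpha>)" for x
  have k: "pcc k" unfolding k_def using pcc_shift[OF h, of "-\<alpha>"] by simp
  have ks: "x \<in> {0<..<2*pi}" if "k x \<noteq> 0" for x using hs[of "x + \<alpha>"] that by (simp add: k_def)
  obtain g \<delta> where g: "continuous_on UNIV g" "0 < \<delta>" "\<delta> \<le> pi"
    "\<And>t. g t \<noteq> 0 \<Longrightarrow> \<delta> \<le> t \<and> t \<le> 2 * pi - \<delta>" "nsq (\<lambda>x. k x - g x) < \<epsilon> / 4"
    using pcc_continuous_cutoff[OF k ks, of "\<epsilon> / 4"] \<epsilon> by auto
  \<comment> \<open>A uniform error \<eta> over a period of length 2 \<pi> has squared norm at most
    2 \<pi> \<eta>^2 = \<epsilon> / 8.\<close>
  define \<eta> where "\<eta> = sqrt (\<epsilon> / (16 * pi))"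
  have \<eta>: "\<eta> > 0" "\<eta>\<^sup>2 = \<epsilon> / (16 * pi)" using \<epsilon> by (simp_all add: \<eta>_def)
  obtain p where p: "trig_poly p" "\<And>t. t \<in> {0..<2*pi} \<Longrightarrow> cmod (g t - p t) < \<eta>"
    using trig_poly_uniform_approx[OF g(1-4) \<eta>(1)] by blast
  have [measurable]: "p \<in> borel_measurable borel" "g \<in> borel_measurable borel" "k \<in> borel_measurable borel"
    using trig_poly_continuous[OF p(1)] g(1) k by (auto intro: borel_measurable_continuous_onI pcc_measurable)
  let ?W = "{0..<2*pi}"
  define d where "d x = (if x \<in> ?W then g x - p x else 0)" for x
  have db: "(cmod (d x))\<^sup>2 \<le> \<eta>\<^sup>2 * indicat_real ?W x" for x
  proof (cases "x \<in> ?W")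
    case True
    then have "(cmod (g x - p x))\<^sup>2 \<le> \<eta>\<^sup>2" using p(2)[OF True] by (intro power_mono) auto
    then show ?thesis using True by (simp add: d_def)
  qed (auto simp: d_def)
  have [measurable]: "d \<in> borel_measurable borel" unfolding d_def by measurable
  have iW: "integrable lborel (\<lambda>x. \<eta>\<^sup>2 * indicat_real ?W x)"
    by (intro integrable_mult_right integrable_real_indicator) auto
  have sd: "sqint d"
  proof -
    have "integrable lborel (\<lambda>x. (cmod (d x))\<^sup>2)"
      by (rule Bochner_Integration.integrable_bound[OF iW]) (use db in \<open>auto simp: abs_mult\<close>)
    then show ?thesis by (simp add: sqint_def)
  qed
  have "nsq d \<le> (LINT x|lborel. \<eta>\<^sup>2 * indicat_real ?W x)"
    unfolding nsq_def using sd db iW by (intro integral_mono) (auto simp: sqint_def)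
  also have "\<dots> = \<eta>\<^sup>2 * (2 * pi)" by (simp add: measure_def)
  also have "\<dots> = \<epsilon> / 8" using \<eta> by simp
  finally have nd: "nsq d \<le> \<epsilon> / 8" .
  have g0: "g x = 0" if "x \<notin> ?W" for x using g(2) g(4)[of x] that by force
  have skg: "sqint (\<lambda>x. k x - g x)"
  proof -
    define g' where "g' x = g x * (if x \<in> {0<..<2*pi} then 1 else 0)" for x
    have "pcc g'" unfolding g'_def by (intro pcc_mult_cont g(1) pcc_const_interval)
    moreover have "g' = g"
    proof
      fix x show "g' x = g x" using g(2) g(4)[of x] by (force simp: g'_def)
    qed
    ultimately show ?thesis using k by (intro pcc_sqint pcc_diff) auto
  qed
  have "(\<lambda>x. if x \<in> ?W then k x - p x else 0) = (\<lambda>x. (k x - g x) + d x)"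
  proof
    fix x show "(if x \<in> ?W then k x - p x else 0) = (k x - g x) + d x"
      using g0[of x] ks[of x] by (force simp: d_def)
  qed
  then have "nsq (\<lambda>x. if x \<in> ?W then k x - p x else 0) \<le> 2 * nsq (\<lambda>x. k x - g x) + 2 * nsq d"
    using nsq_add_le[OF skg sd] by simp
  also have "\<dots> < \<epsilon>" using g(5) nd \<epsilon> by linarith
  finally have *: "nsq (\<lambda>x. if x \<in> ?W then k x - p x else 0) < \<epsilon>" .
  have "nsq (\<lambda>x. if x \<in> {\<alpha>..<\<alpha> + 2 * pi} then h x - p (x - \<alpha>) else 0) =
     nsq (\<lambda>x. if x \<in> ?W then k x - p x else 0)"
    using nsq_affine[of 1 "\<lambda>x. if x \<in> {\<alpha>..<\<alpha> + 2 * pi} then h x - p (x - \<alpha>) else 0" \<alpha>]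
    by (simp add: k_def add.commute cong: if_cong)
  then show ?thesis using * trig_poly_shift[OF p(1)] that[of "\<lambda>t. p (t - \<alpha>)"] by simp
qed

section \<open>Frequency bands spanned by a wavelet system\<close>

lemma inv_fourier_add:
  assumes "pcc h" "pcc g" shows "inv_fourier (\<lambda>\<xi>. h \<xi> + g \<xi>) = (\<lambda>x. inv_fourier h x + inv_fourier g x)"
proof
  fix x
  have "integrable lborel (\<lambda>\<xi>. h \<xi> * cis (\<xi> * x))" "integrable lborel (\<lambda>\<xi>. g \<xi> * cis (\<xi> * x))"
    using assms by (auto intro: pcc_integrable pcc_times_cis)
  then show "inv_fourier (\<lambda>\<xi>. h \<xi> + g \<xi>) x = inv_fourier h x + inv_fourier g x"
    by (simp add: inv_fourier_def distrib_right add_divide_distrib)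
qed

lemma inv_fourier_cmult: "inv_fourier (\<lambda>\<xi>. c * h \<xi>) = (\<lambda>x. c * inv_fourier h x)"
  by (simp add: inv_fourier_def mult.assoc fun_eq_iff)

lemma inv_fourier_diff:
  assumes "pcc h" "pcc g" shows "inv_fourier (\<lambda>\<xi>. h \<xi> - g \<xi>) = (\<lambda>x. inv_fourier h x - inv_fourier g x)"
  using inv_fourier_add[OF assms(1) pcc_cmult[OF assms(2), of "-1"]] inv_fourier_cmult[of "-1" g] by simp

lemma inv_fourier_cong_AE:
  assumes "pcc h" "pcc g" "AE \<xi> in lborel. h \<xi> = g \<xi>" shows "inv_fourier h = inv_fourier g"
proof
  fix x
  have "(LINT \<xi>|lborel. h \<xi> * cis (\<xi> * x)) = (LINT \<xi>|lborel. g \<xi> * cis (\<xi> * x))"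
    using assms by (intro integral_cong_AE borel_measurable_integrable pcc_integrable pcc_times_cis) auto
  then show "inv_fourier h x = inv_fourier g x" by (simp add: inv_fourier_def)
qed

abbreviation wavelets :: "(real \<Rightarrow> complex) \<Rightarrow> (real \<Rightarrow> complex) set" where
  "wavelets \<psi> \<equiv> range (\<lambda>(j, k). wav \<psi> j k)"

lemma wavelets_sqint: "pcc u \<Longrightarrow> wavelets (inv_fourier u) \<subseteq> Collect sqint"
  by (auto simp: sqint_wav)

text \<open>Multiplying \<open>u\<close> by cis (k \<xi>) translates the wavelet by -k, so a product
  of \<open>u\<close> with a trigonometric polynomial is a combination of wavelets of level
  0.\<close>

lemma in_closed_span_trig_multiple:
  assumes u: "pcc u" and p: "trig_poly p"
  shows "in_closed_span (wavelets (inv_fourier u)) (inv_fourier (\<lambda>\<xi>. u \<xi> * p \<xi>))"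
  using p
proof (induction rule: trig_poly.induct)
  case (trig_poly_cis c k)
  have "(\<lambda>\<xi>. u \<xi> * (c * cis (real_of_int k * \<xi>))) = (\<lambda>\<xi>. c * wavhat u 0 (- k) 0 \<xi>)"
    by (auto simp: wavhat_def)
  then have "inv_fourier (\<lambda>\<xi>. u \<xi> * (c * cis (real_of_int k * \<xi>))) = (\<lambda>x. c * wav (inv_fourier u) 0 (-k) x)"
    by (simp only: inv_fourier_cmult wav_eq)
  moreover have "wav (inv_fourier u) 0 (-k) \<in> wavelets (inv_fourier u)" by (rule range_eqI[of _ _ "(0, -k)"]) simp
  ultimately show ?case
    by (simp only:) (intro in_closed_span_cmult in_closed_span_base sqint_wav u)
next
  case (trig_poly_add p q)
  have "pcc (\<lambda>\<xi>. u \<xi> * p \<xi>)" "pcc (\<lambda>\<xi>. u \<xi> * q \<xi>)"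
    using pcc_mult_cont[OF u trig_poly_continuous[OF trig_poly_add.hyps(1)]]
      pcc_mult_cont[OF u trig_poly_continuous[OF trig_poly_add.hyps(2)]] by (simp_all add: mult.commute)
  then have "inv_fourier (\<lambda>\<xi>. u \<xi> * (p \<xi> + q \<xi>)) = (\<lambda>x. inv_fourier (\<lambda>\<xi>. u \<xi> * p \<xi>) x + inv_fourier (\<lambda>\<xi>. u \<xi> * q \<xi>) x)"
    using inv_fourier_add by (simp add: distrib_left)
  then show ?case
    using trig_poly_add.IH by (simp only:) (intro in_closed_span_add wavelets_sqint u)
qed

text \<open>The function \<open>v\<close> below is \<open>u\<close> times the periodic extension of \<open>h\<close>; stating this through
  its values on the translates of one period avoids introducing that extension.\<close>

lemma in_closed_span_periodic_multiple:
  assumes u: "pcc u" and h: "pcc h" and hs: "\<And>x. h x \<noteq> 0 \<Longrightarrow> x \<in> {\<alpha><..<\<alpha> + 2 * pi}"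
    and v: "pcc v" and vu: "\<And>y i. y \<in> {\<alpha>..<\<alpha> + 2 * pi} \<Longrightarrow>
      v (y + 2 * pi * real_of_int i) = u (y + 2 * pi * real_of_int i) * h y"
  shows "in_closed_span (wavelets (inv_fourier u)) (inv_fourier v)"
proof (rule in_closed_span_closure[OF wavelets_sqint[OF u] sqint_inv_fourier[OF v]])
  fix \<epsilon> :: real assume \<epsilon>: "\<epsilon> > 0"
  obtain M R D where *: "0 < M" "0 < R" "finite D" "\<And>x. cmod (u x) \<le> M"
    "\<And>x. R < \<bar>x\<bar> \<Longrightarrow> u x = 0" "\<And>x. x \<notin> D \<Longrightarrow> isCont u x" using u by (rule pccE) blast
  \<comment> \<open>\<open>I\<close> below collects the indices of all translated periods that meet
    the support of \<open>u\<close>. On each of them the error is at most \<open>M\<close> times the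
    error on one period, and this fixes the size of \<epsilon>'.\<close>
  define K where "K = \<lceil>(R + \<bar>\<alpha>\<bar>) / (2 * pi)\<rceil> + 1"
  have K: "(R + \<bar>\<alpha>\<bar>) / (2 * pi) \<le> real_of_int K - 1" unfolding K_def by simp
  define I where "I = {- K..K}"
  define \<epsilon>' where "\<epsilon>' = \<epsilon> / (M\<^sup>2 * real (card I) + 1)"
  have den: "M\<^sup>2 * real (card I) + 1 > 0" by (intro add_nonneg_pos mult_nonneg_nonneg) auto
  have \<epsilon>': "\<epsilon>' > 0" using \<epsilon> den by (simp add: \<epsilon>'_def)
  obtain p where p: "trig_poly p" "nsq (\<lambda>x. if x \<in> {\<alpha>..<\<alpha> + 2 * pi} then h x - p x else 0) < \<epsilon>'"
    using trig_poly_dense[OF h hs \<epsilon>'] by blast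
  define d where "d x = (if x \<in> {\<alpha>..<\<alpha> + 2 * pi} then h x - p x else 0)" for x
  have [measurable]: "p \<in> borel_measurable borel" "h \<in> borel_measurable borel"
    using trig_poly_continuous[OF p(1)] h by (auto intro: borel_measurable_continuous_onI pcc_measurable)
  have up: "pcc (\<lambda>\<xi>. u \<xi> * p \<xi>)"
    using pcc_mult_cont[OF u trig_poly_continuous[OF p(1)]] by (simp add: mult.commute)
  have pd: "sqint d"
  proof -
    \<comment> \<open>\<open>A\<close> agrees with \<open>d\<close> except possibly at \<alpha>; its
      open cut, unlike the half-open one of \<open>d\<close>, is within reach of the closure rules
      for \<open>pcc\<close>.\<close>
    define A where "A x = h x - p x * (if x \<in> {\<alpha><..<\<alpha> + 2 * pi} then 1 else 0)" for x
    have A: "sqint A" unfolding A_def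
      by (intro pcc_sqint pcc_diff h pcc_mult_cont trig_poly_continuous p pcc_const_interval)
    have [measurable]: "A \<in> borel_measurable borel" "d \<in> borel_measurable borel"
      unfolding A_def d_def by measurable
    have "AE x in lborel. x \<noteq> \<alpha>" by (rule AE_lborel_singleton)
    then have "AE x in lborel. (cmod (A x))\<^sup>2 = (cmod (d x))\<^sup>2"
    proof eventually_elim
      case (elim x)
      have "h x = 0" if "x \<notin> {\<alpha>..<\<alpha> + 2 * pi}" using hs[of x] that by fastforce
      with elim show ?case by (auto simp: A_def d_def)
    qed
    then have "integrable lborel (\<lambda>x. (cmod (A x))\<^sup>2) \<longleftrightarrow> integrable lborel (\<lambda>x. (cmod (d x))\<^sup>2)"
      by (rule integrable_cong_AE[rotated 2]) measurable
    then show ?thesis using A by (simp add: sqint_def)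
  qed
  have dI: "integrable lborel (\<lambda>\<xi>. (cmod (d (\<xi> - 2 * pi * real_of_int i)))\<^sup>2)" for i
    using sqint_affine[OF pd, of 1 "- (2 * pi * real_of_int i)"] by (simp add: sqint_def)
  have ptw: "(cmod (v \<xi> - u \<xi> * p \<xi>))\<^sup>2 \<le> (\<Sum>i\<in>I. M\<^sup>2 * (cmod (d (\<xi> - 2 * pi * real_of_int i)))\<^sup>2)" for \<xi>
  proof -
    define i where "i = \<lfloor>(\<xi> - \<alpha>) / (2 * pi)\<rfloor>"
    define y where "y = \<xi> - 2 * pi * real_of_int i"
    have i1: "real_of_int i \<le> (\<xi> - \<alpha>) / (2 * pi)" "(\<xi> - \<alpha>) / (2 * pi) < real_of_int i + 1"
      unfolding i_def by linarith+
    then have y: "y \<in> {\<alpha>..<\<alpha> + 2 * pi}" unfolding y_def by (auto simp: field_simps)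
    have \<xi>: "\<xi> = y + 2 * pi * real_of_int i" by (simp add: y_def)
    have e: "v \<xi> - u \<xi> * p \<xi> = u \<xi> * d y"
      unfolding \<xi> vu[OF y] trig_poly_periodic[OF p(1)] using y by (simp add: d_def algebra_simps)
    show ?thesis
    proof (cases "\<bar>\<xi>\<bar> \<le> R")
      case True
      have "\<bar>\<xi> - \<alpha>\<bar> \<le> R + \<bar>\<alpha>\<bar>" using True by linarith
      then have "\<bar>(\<xi> - \<alpha>) / (2 * pi)\<bar> \<le> (R + \<bar>\<alpha>\<bar>) / (2 * pi)" by (simp add: abs_divide divide_right_mono)
      then have "real_of_int i \<le> real_of_int K" "- real_of_int K \<le> real_of_int i" using i1 K by linarith+
      then have iI: "i \<in> I" unfolding I_def by (simp flip: of_int_minus)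
      have "(cmod (u \<xi> * d y))\<^sup>2 \<le> M\<^sup>2 * (cmod (d y))\<^sup>2"
        using *(4)[of \<xi>] by (auto simp: norm_mult power_mult_distrib intro!: mult_right_mono power_mono)
      also have "\<dots> \<le> (\<Sum>i\<in>I. M\<^sup>2 * (cmod (d (\<xi> - 2 * pi * real_of_int i)))\<^sup>2)"
        unfolding y_def using iI by (intro member_le_sum[where f="\<lambda>i. M\<^sup>2 * (cmod (d (\<xi> - 2 * pi * real_of_int i)))\<^sup>2"]) (auto simp: I_def)
      finally show ?thesis using e by simp
    next
      case False
      then have "u \<xi> = 0" using * by auto
      then show ?thesis unfolding e by (auto intro!: sum_nonneg)
    qed
  qed
  have pvu: "pcc (\<lambda>\<xi>. v \<xi> - u \<xi> * p \<xi>)" by (intro pcc_diff v up)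
  have "nsq (\<lambda>\<xi>. v \<xi> - u \<xi> * p \<xi>) \<le> (LINT \<xi>|lborel. (\<Sum>i\<in>I. M\<^sup>2 * (cmod (d (\<xi> - 2 * pi * real_of_int i)))\<^sup>2))"
    unfolding nsq_def using pcc_sqint[OF pvu] dI ptw
    by (intro integral_mono Bochner_Integration.integrable_sum integrable_mult_right) (auto simp: sqint_def)
  also have "\<dots> = (\<Sum>i\<in>I. M\<^sup>2 * nsq (\<lambda>\<xi>. d (\<xi> - 2 * pi * real_of_int i)))"
    unfolding nsq_def using dI by (subst Bochner_Integration.integral_sum) auto
  also have "\<dots> = (\<Sum>i\<in>I. M\<^sup>2 * nsq d)"
  proof (intro sum.cong refl)
    fix i
    show "M\<^sup>2 * nsq (\<lambda>\<xi>. d (\<xi> - 2 * pi * real_of_int i)) = M\<^sup>2 * nsq d"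
      using nsq_affine[of 1 d "- (2 * pi * real_of_int i)"] by simp
  qed
  also have "\<dots> = M\<^sup>2 * real (card I) * nsq d" by simp
  also have "\<dots> \<le> (M\<^sup>2 * real (card I) + 1) * nsq d" using nsq_nonneg[of d] by (intro mult_right_mono) auto
  also have "\<dots> < \<epsilon>" using p(2) den by (simp add: d_def[abs_def] \<epsilon>'_def field_simps)
  finally have "nsq (\<lambda>\<xi>. v \<xi> - u \<xi> * p \<xi>) < \<epsilon>" .
  moreover have "nsq (inv_fourier (\<lambda>\<xi>. v \<xi> - u \<xi> * p \<xi>)) \<le> nsq (\<lambda>\<xi>. v \<xi> - u \<xi> * p \<xi>)"
    unfolding nsq_inv_fourier[OF pvu] using nsq_nonneg[of "\<lambda>\<xi>. v \<xi> - u \<xi> * p \<xi>"] pi_gt3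
      divide_left_mono[of 1 "2 * pi" "nsq (\<lambda>\<xi>. v \<xi> - u \<xi> * p \<xi>)"] by simp
  ultimately have "nsq (\<lambda>x. inv_fourier v x - inv_fourier (\<lambda>\<xi>. u \<xi> * p \<xi>) x) < \<epsilon>"
    unfolding inv_fourier_diff[OF v up] by simp
  then show "\<exists>g. in_closed_span (wavelets (inv_fourier u)) g \<and> nsq (\<lambda>x. inv_fourier v x - g x) < \<epsilon>"
    using in_closed_span_trig_multiple[OF u p(1)] by blast
qed

section \<open>Dyadic dilation and spanned bands\<close>

lemma inv_fourier_dilate:
  assumes "c > 0" shows "inv_fourier (\<lambda>\<xi>. h (c * \<xi>)) x = inv_fourier h (x / c) / complex_of_real c"
proof -
  have "fint h (x / c) = c *\<^sub>R (LINT \<xi>|lborel. h (c * \<xi>) * cis (c * \<xi> * (x / c)))"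
    unfolding fint_def using assms by (subst lborel_integral_real_affine[where c=c and t=0]) auto
  also have "(LINT \<xi>|lborel. h (c * \<xi>) * cis (c * \<xi> * (x / c))) = fint (\<lambda>\<xi>. h (c * \<xi>)) x"
    using assms by (simp add: fint_def)
  finally show ?thesis using assms by (simp add: inv_fourier_fint scaleR_conv_of_real field_simps)
qed

lemma wav_dilate: "wav \<psi> j k (2 powr real_of_int l * x) = complex_of_real (2 powr (- real_of_int l / 2)) * wav \<psi> (j + l) k x"
proof -
  have "2 powr (real_of_int j / 2) = 2 powr (- real_of_int l / 2) * 2 powr (real_of_int (j + l) / 2)"
    by (simp add: powr_add[symmetric] add_divide_distrib)
  moreover have "2 powr real_of_int j * (2 powr real_of_int l * x) = 2 powr real_of_int (j + l) * x"
    by (simp add: powr_add)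
  ultimately show ?thesis unfolding wav_def by (simp only: of_real_mult mult.assoc)
qed

lemma in_closed_span_dilate:
  assumes u: "pcc u" and f: "in_closed_span (wavelets (inv_fourier u)) f"
  shows "in_closed_span (wavelets (inv_fourier u)) (\<lambda>x. f (2 powr real_of_int l * x))"
proof -
  let ?W = "wavelets (inv_fourier u)"
  have "in_closed_span ?W (\<lambda>x. f (2 powr real_of_int l * x + 0))"
  proof (rule in_closed_span_affine[OF wavelets_sqint[OF u] wavelets_sqint[OF u] f])
    fix g assume "g \<in> ?W"
    then obtain j k where g: "g = wav (inv_fourier u) j k" by auto
    have "wav (inv_fourier u) (j + l) k \<in> ?W" by (rule range_eqI[of _ _ "(j + l, k)"]) simp
    then show "in_closed_span ?W (\<lambda>x. g (2 powr real_of_int l * x + 0))"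
      unfolding g add_0_right wav_dilate by (intro in_closed_span_cmult in_closed_span_base sqint_wav u)
  qed auto
  then show ?thesis by simp
qed

lemma in_closed_span_dilate_hat:
  assumes u: "pcc u" and f: "in_closed_span (wavelets (inv_fourier u)) (inv_fourier h)"
  shows "in_closed_span (wavelets (inv_fourier u)) (inv_fourier (\<lambda>\<xi>. h (2 powr real_of_int l * \<xi>)))"
proof -
  have "inv_fourier (\<lambda>\<xi>. h (2 powr real_of_int l * \<xi>)) =
     (\<lambda>x. inverse (complex_of_real (2 powr real_of_int l)) * inv_fourier h (2 powr real_of_int (-l) * x))"
    by (rule ext, subst inv_fourier_dilate) (simp_all add: powr_minus field_simps)
  then show ?thesis
    by (simp only:) (intro in_closed_span_cmult in_closed_span_dilate[OF u f])
qed

text \<open>Only \<open>pcc\<close> spectra are tested; their inverse transforms are dense by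
  \<open>inv_fourier_annulus_dense\<close>, which is enough for completeness.\<close>

definition spanned :: "(real \<Rightarrow> complex) \<Rightarrow> real set \<Rightarrow> bool" where
  "spanned u A \<longleftrightarrow> (\<forall>h. pcc h \<longrightarrow> (\<forall>\<xi>. h \<xi> \<noteq> 0 \<longrightarrow> \<xi> \<in> A) \<longrightarrow>
     in_closed_span (wavelets (inv_fourier u)) (inv_fourier h))"

lemma spannedI:
  "(\<And>h. pcc h \<Longrightarrow> (\<And>\<xi>. h \<xi> \<noteq> 0 \<Longrightarrow> \<xi> \<in> A) \<Longrightarrow> in_closed_span (wavelets (inv_fourier u)) (inv_fourier h)) \<Longrightarrow> spanned u A"
  unfolding spanned_def by blast

lemma spannedD:
  "spanned u A \<Longrightarrow> pcc h \<Longrightarrow> (\<And>\<xi>. h \<xi> \<noteq> 0 \<Longrightarrow> \<xi> \<in> A) \<Longrightarrow> in_closed_span (wavelets (inv_fourier u)) (inv_fourier h)"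
  unfolding spanned_def by blast

text \<open>Dilation by a power of 2 permutes the wavelets up to scalars, so a band can be rescaled,
  its test functions scaled back, and the result dilated again.\<close>

lemma spanned_dilate:
  assumes u: "pcc u" and A: "spanned u {s<..<t}"
  shows "spanned u {2 powr real_of_int l * s<..<2 powr real_of_int l * t}"
proof (rule spannedI)
  fix h assume h: "pcc h" and hs: "\<And>\<xi>. h \<xi> \<noteq> 0 \<Longrightarrow> \<xi> \<in> {2 powr real_of_int l * s<..<2 powr real_of_int l * t}"
  have "in_closed_span (wavelets (inv_fourier u)) (inv_fourier (\<lambda>\<xi>. h (2 powr real_of_int l * \<xi>)))"
  proof (rule spannedD[OF A])
    show "pcc (\<lambda>\<xi>. h (2 powr real_of_int l * \<xi>))" using h by (intro pcc_scale) auto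
    show "\<xi> \<in> {s<..<t}" if "h (2 powr real_of_int l * \<xi>) \<noteq> 0" for \<xi>
      using hs[OF that] by auto
  qed
  from in_closed_span_dilate_hat[OF u this, of "- l"]
  have "in_closed_span (wavelets (inv_fourier u)) (inv_fourier (\<lambda>\<xi>. h (2 powr real_of_int l * (2 powr real_of_int (-l) * \<xi>))))" .
  moreover have e: "2 powr real_of_int l * (2 powr real_of_int (-l) * \<xi>) = \<xi>" for \<xi> :: real
    by (simp add: powr_minus)
  ultimately show "in_closed_span (wavelets (inv_fourier u)) (inv_fourier h)" by (simp only: e)
qed

text \<open>The common endpoint belongs to neither open band, but a single frequency does not affect
  \<open>inv_fourier\<close>.\<close>

lemma spanned_join:
  assumes u: "pcc u" and A: "spanned u {s<..<t}" and B: "spanned u {t<..<r}"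
  shows "spanned u {s<..<r}"
proof (rule spannedI)
  fix h assume h: "pcc h" and hs: "\<And>\<xi>. h \<xi> \<noteq> 0 \<Longrightarrow> \<xi> \<in> {s<..<r}"
  let ?h1 = "\<lambda>\<xi>. if \<xi> \<in> {s<..<t} then h \<xi> else 0" and ?h2 = "\<lambda>\<xi>. if \<xi> \<in> {t<..<r} then h \<xi> else 0"
  have p: "pcc ?h1" "pcc ?h2" by (rule pcc_restrict_interval[OF h])+
  have "AE \<xi> in lborel. \<xi> \<noteq> t" by (rule AE_lborel_singleton)
  then have "AE \<xi> in lborel. h \<xi> = ?h1 \<xi> + ?h2 \<xi>"
  proof eventually_elim
    case (elim \<xi>)
    then show ?case using hs[of \<xi>] by (cases "h \<xi> = 0") auto
  qed
  then have "inv_fourier h = (\<lambda>x. inv_fourier ?h1 x + inv_fourier ?h2 x)"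
    using inv_fourier_cong_AE[OF h pcc_add[OF p]] inv_fourier_add[OF p] by simp
  moreover have "in_closed_span (wavelets (inv_fourier u)) (inv_fourier ?h1)"
    by (rule spannedD[OF A p(1)]) (auto split: if_splits)
  moreover have "in_closed_span (wavelets (inv_fourier u)) (inv_fourier ?h2)"
    by (rule spannedD[OF B p(2)]) (auto split: if_splits)
  ultimately show "in_closed_span (wavelets (inv_fourier u)) (inv_fourier h)"
    by (simp only:) (intro in_closed_span_add wavelets_sqint u)
qed

lemma spanned_empty: "spanned u {}"
proof (rule spannedI)
  fix h :: "real \<Rightarrow> complex" assume "\<And>\<xi>. h \<xi> \<noteq> 0 \<Longrightarrow> \<xi> \<in> {}"
  then have "h = (\<lambda>_. 0)" by auto
  then have "inv_fourier h = (\<lambda>x. 0)" by (simp add: inv_fourier_def fun_eq_iff)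
  then show "in_closed_span (wavelets (inv_fourier u)) (inv_fourier h)" by (simp add: in_closed_span_zero)
qed

lemma powr_neg_nat: "2 powr real_of_int (- int m) = 1 / (2::real) ^ m"
  by (simp add: powr_minus powr_realpow inverse_eq_divide)

text \<open>An octave is a fundamental domain for dyadic dilation. The induction starts from an
  empty band and adds one octave at each end.\<close>

lemma spanned_octave_pos:
  assumes u: "pcc u" and A: "spanned u {c<..<2 * c}"
  shows "spanned u {c / 2 ^ n<..<c * 2 ^ n}"
proof (induction n)
  case (Suc n)
  have "spanned u {c / 2 ^ Suc n<..<c / 2 ^ n}"
    using spanned_dilate[OF u A, of "- int (Suc n)"] unfolding powr_neg_nat by (simp add: field_simps)
  moreover have "spanned u {c * 2 ^ n<..<c * 2 ^ Suc n}"
    using spanned_dilate[OF u A, of "int n"] by (simp add: powr_realpow field_simps)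
  ultimately show ?case using Suc by (blast intro: spanned_join[OF u])
qed (simp add: spanned_empty)

lemma spanned_octave_neg:
  assumes u: "pcc u" and A: "spanned u {- (2 * c)<..<- c}"
  shows "spanned u {- (c * 2 ^ n)<..<- (c / 2 ^ n)}"
proof (induction n)
  case (Suc n)
  have "spanned u {- (c / 2 ^ n)<..<- (c / 2 ^ Suc n)}"
    using spanned_dilate[OF u A, of "- int (Suc n)"] unfolding powr_neg_nat by (simp add: field_simps)
  moreover have "spanned u {- (c * 2 ^ Suc n)<..<- (c * 2 ^ n)}"
    using spanned_dilate[OF u A, of "int n"] by (simp add: powr_realpow field_simps)
  ultimately show ?case using Suc by (blast intro: spanned_join[OF u])
qed (simp add: spanned_empty)

theorem wavelets_complete:
  assumes u: "pcc u" and c: "c > 0" and A: "spanned u {c<..<2 * c}" and B: "spanned u {- (2 * c)<..<- c}"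
    and f: "sqint f"
  shows "in_closed_span (wavelets (inv_fourier u)) f"
proof (rule in_closed_span_closure[OF wavelets_sqint[OF u] f])
  fix \<epsilon> :: real assume "\<epsilon> > 0"
  then obtain n h where h: "pcc h" "\<And>\<xi>. h \<xi> \<noteq> 0 \<Longrightarrow> \<bar>\<xi>\<bar> \<in> {c / 2 ^ n<..<c * 2 ^ n}"
    "nsq (\<lambda>x. f x - inv_fourier h x) < \<epsilon>" using inv_fourier_annulus_dense[OF f _ c] by blast
  let ?P = "{c / 2 ^ n<..<c * 2 ^ n}" and ?N = "{- (c * 2 ^ n)<..<- (c / 2 ^ n)}"
  let ?h1 = "\<lambda>\<xi>. if \<xi> \<in> ?P then h \<xi> else 0" and ?h2 = "\<lambda>\<xi>. if \<xi> \<in> ?N then h \<xi> else 0"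
  have p: "pcc ?h1" "pcc ?h2" by (rule pcc_restrict_interval[OF h(1)])+
  have "h = (\<lambda>\<xi>. ?h1 \<xi> + ?h2 \<xi>)"
  proof
    fix \<xi>
    have "0 < c / 2 ^ n" using c by simp
    then show "h \<xi> = ?h1 \<xi> + ?h2 \<xi>" using h(2)[of \<xi>] by (cases "h \<xi> = 0"; cases "\<xi> \<ge> 0") auto
  qed
  then have e: "inv_fourier h = (\<lambda>x. inv_fourier ?h1 x + inv_fourier ?h2 x)"
    using inv_fourier_add[OF p] by simp
  have "in_closed_span (wavelets (inv_fourier u)) (inv_fourier ?h1)"
    by (rule spannedD[OF spanned_octave_pos[OF u A, of n] p(1)]) (auto split: if_splits)
  moreover have "in_closed_span (wavelets (inv_fourier u)) (inv_fourier ?h2)"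
    by (rule spannedD[OF spanned_octave_neg[OF u B, of n] p(2)]) (auto split: if_splits)
  ultimately have "in_closed_span (wavelets (inv_fourier u)) (inv_fourier h)"
    unfolding e by (intro in_closed_span_add wavelets_sqint u)
  then show "\<exists>g. in_closed_span (wavelets (inv_fourier u)) g \<and> nsq (\<lambda>x. f x - g x) < \<epsilon>" using h(3) by blast
qed

text \<open>The piece (s, t) lies inside one period, and on each of its translates by multiples of 2
  \<pi> the function \<open>u\<close> is constant. Multiplying \<open>u\<close> by the periodic
  extension of \<open>h\<close> therefore yields copies of \<open>h\<close> weighted by these
  constants.\<close>

lemma in_closed_span_translated_pieces:
  assumes u: "pcc u" and h: "pcc h" and hs: "\<And>x. h x \<noteq> 0 \<Longrightarrow> x \<in> {s<..<t}"
    and st: "\<alpha> \<le> s" "t \<le> \<alpha> + 2 * pi" and I: "finite I"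
    and uI: "\<And>y k. y \<in> {s<..<t} \<Longrightarrow> u (y + 2 * pi * real_of_int k) = (if k \<in> I then c k else 0)"
  shows "in_closed_span (wavelets (inv_fourier u)) (inv_fourier (\<lambda>\<xi>. \<Sum>i\<in>I. c i * h (\<xi> - 2 * pi * real_of_int i)))"
proof (rule in_closed_span_periodic_multiple[OF u h])
  show "x \<in> {\<alpha><..<\<alpha> + 2 * pi}" if "h x \<noteq> 0" for x using hs[OF that] st by auto
  show "pcc (\<lambda>\<xi>. \<Sum>i\<in>I. c i * h (\<xi> - 2 * pi * real_of_int i))"
    by (intro pcc_sum pcc_cmult pcc_shift h)
  fix y k assume y: "y \<in> {\<alpha>..<\<alpha> + 2 * pi}"
  \<comment> \<open>The support of \<open>h\<close> lies inside a single period, so its distinct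
    translates are disjoint.\<close>
  have z: "h (y + 2 * pi * real_of_int k - 2 * pi * real_of_int i) = (if i = k then h y else 0)" for i
  proof (cases "i = k")
    case False
    have "h (y + 2 * pi * real_of_int k - 2 * pi * real_of_int i) = 0"
    proof (rule ccontr)
      assume "h (y + 2 * pi * real_of_int k - 2 * pi * real_of_int i) \<noteq> 0"
      then have "y + 2 * pi * real_of_int (k - i) \<in> {\<alpha><..<\<alpha> + 2 * pi}"
        using hs[of "y + 2 * pi * real_of_int k - 2 * pi * real_of_int i"] st by (auto simp: algebra_simps)
      then have "\<bar>2 * pi * real_of_int (k - i)\<bar> < 2 * pi" using y by auto
      then have "\<bar>real_of_int (k - i)\<bar> < 1" by (simp add: abs_mult)
      then show False using False by linarith
    qed
    then show ?thesis using False by simp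
  qed simp
  have "(\<Sum>i\<in>I. c i * h (y + 2 * pi * real_of_int k - 2 * pi * real_of_int i)) = (\<Sum>i\<in>I. if k = i then c i * h y else 0)"
    unfolding z by (intro sum.cong) auto
  also have "\<dots> = (if k \<in> I then c k * h y else 0)" using I by simp
  also have "\<dots> = u (y + 2 * pi * real_of_int k) * h y"
    using uI[of y k] hs[of y] by (cases "h y = 0") auto
  finally show "(\<Sum>i\<in>I. c i * h (y + 2 * pi * real_of_int k - 2 * pi * real_of_int i)) = u (y + 2 * pi * real_of_int k) * h y" .
qed

section \<open>Step functions and integrals of \<open>cis\<close> over intervals\<close>

lemma pcc_if_Icc:
  assumes g: "pcc g" shows "pcc (\<lambda>x. if x \<in> {s..t} then c else g x)"
proof -
  obtain M R D where *: "0 < M" "0 < R" "finite D" "\<And>x. cmod (g x) \<le> M"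
    "\<And>x. R < \<bar>x\<bar> \<Longrightarrow> g x = 0" "\<And>x. x \<notin> D \<Longrightarrow> isCont g x" using g by (rule pccE) blast
  have [measurable]: "g \<in> borel_measurable borel" using g by (rule pcc_measurable)
  let ?f = "\<lambda>x. if x \<in> {s..t} then c else g x"
  have "isCont ?f x" if x: "x \<notin> D \<union> {s, t}" for x
  proof (cases "x \<in> {s..t}")
    case True
    then have "\<forall>\<^sub>F y in nhds x. y \<in> {s<..<t}" using x by (intro eventually_nhds_in_open) auto
    then have "\<forall>\<^sub>F y in nhds x. ?f y = c" by (rule eventually_mono) auto
    then show ?thesis by (rule isCont_eventually_eq[rotated]) auto
  next
    case False
    then have "\<forall>\<^sub>F y in nhds x. y \<in> - {s..t}" by (intro eventually_nhds_in_open) auto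
    then have "\<forall>\<^sub>F y in nhds x. ?f y = g y" by (rule eventually_mono) auto
    then show ?thesis by (rule isCont_eventually_eq[rotated]) (use * x in auto)
  qed
  moreover have "?f \<in> borel_measurable borel" by measurable
  moreover have "cmod (?f x) \<le> max M (cmod c)" for x using *(4)[of x] by auto
  moreover have "\<bar>x\<bar> \<le> max R (max \<bar>s\<bar> \<bar>t\<bar>)" if "?f x \<noteq> 0" for x
  proof (cases "x \<in> {s..t}")
    case False
    then have "\<not> R < \<bar>x\<bar>" using that *(5)[of x] by auto
    then show ?thesis by simp
  qed auto
  moreover have "finite (D \<union> {s, t})" using * by auto
  ultimately show ?thesis unfolding pcc_def by (intro conjI) blast+
qed

text \<open>A primitive of cis (s t) in the variable t. The two branches use unrelated constants of
  integration, which is harmless because only differences at the same \<open>s\<close>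
  occur.\<close>

definition cis_prim :: "real \<Rightarrow> real \<Rightarrow> complex" where
  "cis_prim s t = (if s = 0 then of_real t else cis (s * t) / (\<i> * of_real s))"

lemma cis_prim_deriv: "(cis_prim s has_vector_derivative cis (s * t)) (at t within A)"
proof (cases "s = 0")
  case True
  then show ?thesis by (auto simp: cis_prim_def[abs_def] intro!: derivative_eq_intros)
next
  case False
  have "((\<lambda>z. exp (\<i> * (of_real s * z)) / (\<i> * of_real s)) has_field_derivative exp (\<i> * (of_real s * of_real t))) (at (of_real t))"
    using False by (auto intro!: derivative_eq_intros simp: field_simps)
  from has_vector_derivative_real_field[OF this, of A]
  show ?thesis using False by (simp add: cis_prim_def[abs_def] cis_conv_exp)
qed

lemma integral_cis_interval:
  assumes "x \<le> y"
  shows "(LINT \<eta>|lborel. (if \<eta> \<in> {x<..<y} then c else 0) * cis (s * \<eta>)) = c * (cis_prim s y - cis_prim s x)"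
proof -
  have "has_bochner_integral lborel (\<lambda>\<eta>. indicat_real {x..y} \<eta> *\<^sub>R cis (s * \<eta>)) (cis_prim s y - cis_prim s x)"
    using assms by (intro has_bochner_integral_FTC_Icc cis_prim_deriv) (auto intro!: continuous_intros)
  then have "(LINT \<eta>|lborel. indicat_real {x..y} \<eta> *\<^sub>R cis (s * \<eta>)) = cis_prim s y - cis_prim s x"
    by (rule has_bochner_integral_integral_eq)
  moreover have "(LINT \<eta>|lborel. (if \<eta> \<in> {x<..<y} then c else 0) * cis (s * \<eta>)) = (LINT \<eta>|lborel. c * (indicat_real {x..y} \<eta> *\<^sub>R cis (s * \<eta>)))"
  proof (rule integral_cong_AE)
    have "AE \<eta> in lborel. \<eta> \<notin> {x, y}" by (intro AE_not_in finite_imp_null_set_lborel) auto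
    then show "AE \<eta> in lborel. (if \<eta> \<in> {x<..<y} then c else 0) * cis (s * \<eta>) = c * (indicat_real {x..y} \<eta> *\<^sub>R cis (s * \<eta>))"
      by eventually_elim (auto simp: indicator_def)
  qed measurable
  ultimately show ?thesis by (simp only: integral_mult_right_zero)
qed

lemma cis_prim_shift: "cis_prim s (y + \<tau>) - cis_prim s (x + \<tau>) = cis (s * \<tau>) * (cis_prim s y - cis_prim s x)"
  by (simp add: cis_prim_def distrib_left cis_mult[symmetric] diff_divide_distrib[symmetric] right_diff_distrib mult.commute)

lemma cis_prim_period:
  "cis_prim (real_of_int k) (x + 2 * pi) - cis_prim (real_of_int k) x = (if k = 0 then complex_of_real (2 * pi) else 0)"
proof -
  have "cis (real_of_int k * (x + 2 * pi)) = cis (real_of_int k * x)"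
    using cis_multiple_2pi[of "real_of_int k"] by (simp add: distrib_left cis_mult[symmetric] mult_ac)
  then show ?thesis by (simp add: cis_prim_def)
qed

section \<open>The wavelet \<open>\<psi>\<^sub>n\<close>\<close>

text \<open>Frequencies are measured in units of \<open>\<pi>\<close>: then \<open>a\<^sub>n = a\<close>, \<open>b\<^sub>n = 2a\<close>, \<open>e\<^sub>n = 2 - 2a\<close>, \<open>c\<^sub>n = P - a\<close> and
  \<open>d\<^sub>n = P + a\<close>, where \<open>P = 2^(n-1)\<close>.\<close>

locale psi_params =
  fixes n :: nat and a P :: real and Q :: int
  assumes n: "n \<ge> 3" and P: "P = 2 ^ (n - 1)" and Q: "P = 2 * real_of_int Q" and a: "a * (2 * P - 1) = P"
begin

lemma P_ge: "P \<ge> 4"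
proof -
  have "(2::real) ^ 2 \<le> 2 ^ (n - 1)" using n by (intro power_increasing) auto
  then show ?thesis by (simp add: P)
qed

lemma Q_ge: "2 \<le> Q" using P_ge Q by linarith

text \<open>Equivalently P (2 - 2a) = P - a. The matches between dilated low endpoints and endpoints
  near P rest on these two forms.\<close>

lemma aP: "2 * P * a = P + a" using a by (simp add: algebra_simps)

lemma a_bounds: "1 / 2 < a" "a < 2 / 3"
proof -
  have e: "a = P / (2 * P - 1)" using a P_ge by (simp add: field_simps)
  show "1 / 2 < a" "a < 2 / 3" unfolding e using P_ge by (auto simp: field_simps)
qed

text \<open>The cases keep the priority of \<open>psi_hat\<close>, with the value 1 tested first, so
  that the two agree at shared endpoints such as P + a/2 as well.\<close>

definition U :: "real \<Rightarrow> complex" where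
  "U y = (if y \<in> {-2*a..-a} then 1 else if y \<in> {P - a..P + a/2} then 1 else if y \<in> {P + 1 - a..P + a} then 1
     else if y \<in> {a/2..1 - a} then of_real (1 / sqrt 2) else if y \<in> {a..2 - 2*a} then of_real (1 / sqrt 2)
     else if y \<in> {P + a/2..P + 1 - a} then of_real (1 / sqrt 2)
     else if y \<in> {2*P + a..2*P + 2 - 2*a} then - of_real (1 / sqrt 2) else 0)"

lemma psi_hat_eq: "psi_hat n \<xi> = U (\<xi> / pi)"
proof -
  have N: "2 ^ n = 2 * P" using n by (simp add: P power_Suc[symmetric])
  have N2: "2 ^ (2 * n - 1) = 2 * P * P"
  proof -
    have "2 * n - 1 = Suc ((n - 1) + (n - 1))" using n by simp
    then show ?thesis by (simp only: power_Suc power_add P mult.assoc)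
  qed
  have den: "2 * P - 1 > 0" using P_ge by simp
  have A: "P / (2 * P - 1) = a" using a den by (simp add: field_simps)
  have B: "2 * P / (2 * P - 1) = 2 * a" using A by (metis times_divide_eq_right)
  have E: "(2 * P - 2) / (2 * P - 1) = 2 - 2 * a"
  proof -
    have "(2 * P - 2) / (2 * P - 1) = 2 - 2 * P / (2 * P - 1)" using den by (simp add: field_simps)
    then show ?thesis unfolding B .
  qed
  have C: "P * (2 * P - 2) / (2 * P - 1) = P - a"
  proof -
    have "P * (2 * P - 2) / (2 * P - 1) = P * ((2 * P - 2) / (2 * P - 1))" by simp
    also have "\<dots> = P - a" unfolding E using aP by (simp add: algebra_simps)
    finally show ?thesis .
  qed
  have D: "2 * P * P / (2 * P - 1) = P + a"
  proof -
    have "2 * P * P / (2 * P - 1) = 2 * P * (P / (2 * P - 1))" by simp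
    then show ?thesis unfolding A aP .
  qed
  have 1: "psi_hat n \<xi> =
    (if \<xi> \<in> {- (2 * a * pi)..- (a * pi)} \<union> {(P - a) * pi..a * pi / 2 + P * pi} \<union> {(2 - 2 * a) * pi / 2 + P * pi..(P + a) * pi} then 1
     else if \<xi> \<in> {a * pi / 2..(2 - 2 * a) * pi / 2} \<union> {a * pi..(2 - 2 * a) * pi} \<union> {a * pi / 2 + P * pi..(2 - 2 * a) * pi / 2 + P * pi} then complex_of_real (1 / sqrt 2)
     else if \<xi> \<in> {a * pi + 2 * P * pi..(2 - 2 * a) * pi + 2 * P * pi} then complex_of_real (- 1 / sqrt 2)
     else 0)"
    unfolding psi_hat_def Let_def N N2 P[symmetric] A B C D E ..
  define y where "y = \<xi> / pi"
  have \<xi>: "\<xi> = y * pi" by (simp add: y_def)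
  have le: "x * pi \<le> y * pi \<longleftrightarrow> x \<le> y" "y * pi \<le> x * pi \<longleftrightarrow> y \<le> x" for x by simp_all
  have r: "- (2 * a * pi) = (-2 * a) * pi" "- (a * pi) = (-a) * pi" "a * pi / 2 + P * pi = (P + a / 2) * pi"
    "(2 - 2 * a) * pi / 2 + P * pi = (P + 1 - a) * pi" "a * pi / 2 = (a / 2) * pi" "(2 - 2 * a) * pi / 2 = (1 - a) * pi"
    "a / 2 * pi + P * pi = (P + a / 2) * pi" "(1 - a) * pi + P * pi = (P + 1 - a) * pi"
    "a * pi + 2 * P * pi = (2 * P + a) * pi" "(2 - 2 * a) * pi + 2 * P * pi = (2 * P + 2 - 2 * a) * pi"
    by (simp_all add: algebra_simps add_divide_distrib diff_divide_distrib)
  have disj: "(if A \<or> B then u else v) = (if A then u else if B then u else v)" for A B and u v :: complex by simp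
  show ?thesis
    unfolding 1 y_def[symmetric] unfolding \<xi> r Un_iff atLeastAtMost_iff le U_def disj
    by (simp only: of_real_minus minus_divide_left[symmetric])
qed

lemma pcc_U: "pcc U"
  unfolding U_def by (intro pcc_if_Icc pcc_zero)

lemma pcc_psi_hat: "pcc (psi_hat n)"
proof -
  have "psi_hat n = (\<lambda>\<xi>. U (inverse pi * \<xi>))" by (auto simp: psi_hat_eq field_simps)
  then show ?thesis using pcc_scale[OF pcc_U, of "inverse pi"] by simp
qed

lemma psi_hat_scaled: "psi_hat n (pi * y) = U y"
  by (simp add: psi_hat_eq)

lemma U_gaps:
  "y < -2*a \<Longrightarrow> U y = 0"
  "-a < y \<Longrightarrow> y < a/2 \<Longrightarrow> U y = 0"
  "1 - a < y \<Longrightarrow> y < a \<Longrightarrow> U y = 0"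
  "2 - 2*a < y \<Longrightarrow> y < P - a \<Longrightarrow> U y = 0"
  "P + a < y \<Longrightarrow> y < 2*P + a \<Longrightarrow> U y = 0"
  "2*P + 2 - 2*a < y \<Longrightarrow> U y = 0"
  using P_ge a_bounds by (auto simp: U_def)

text \<open>The indices -1, 0, Q, 2Q belong to the periods that meet the support. All others are
  described by real inequalities, from which linear arithmetic can place the translated point in a
  gap.\<close>

lemma period_cases:
  obtains "real_of_int i \<le> -2" "i \<notin> {-1, 0, Q, 2 * Q}" | "i = -1" | "i = 0"
    | "1 \<le> real_of_int i" "2 * real_of_int i \<le> P - 2" "i \<notin> {-1, 0, Q, 2 * Q}" | "i = Q"
    | "P + 2 \<le> 2 * real_of_int i" "2 * real_of_int i \<le> 2 * P - 2" "i \<notin> {-1, 0, Q, 2 * Q}" | "i = 2 * Q"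
    | "2 * P + 2 \<le> 2 * real_of_int i" "i \<notin> {-1, 0, Q, 2 * Q}"
proof -
  consider "i \<le> -2" | "i = -1" | "i = 0" | "1 \<le> i" "i \<le> Q - 1" | "i = Q" | "Q + 1 \<le> i" "i \<le> 2 * Q - 1" | "i = 2 * Q" | "2 * Q + 1 \<le> i"
    by linarith
  then show ?thesis
    by cases (use that Q Q_ge in \<open>(linarith | auto)+\<close>)
qed

text \<open>The five intervals divide one period (-a, 2 - a) up to endpoints; the period is 2
  because of the units. In every row the squares of the values sum to 1. The last two rows meet two
  periods each: these are the bands that must be separated.\<close>

lemma U_period:
  "y \<in> {2 - 2*a<..<2 - a} \<Longrightarrow> U (y + 2 * real_of_int i) = (if i \<in> {-1} then 1 else 0)"
  "y \<in> {-a<..<a/2} \<Longrightarrow> U (y + 2 * real_of_int i) = (if i \<in> {Q} then 1 else 0)"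
  "y \<in> {1 - a<..<a} \<Longrightarrow> U (y + 2 * real_of_int i) = (if i \<in> {Q} then 1 else 0)"
  "y \<in> {a/2<..<1 - a} \<Longrightarrow> U (y + 2 * real_of_int i) = (if i \<in> {0, Q} then of_real (1 / sqrt 2) else 0)"
  "y \<in> {a<..<2 - 2*a} \<Longrightarrow> U (y + 2 * real_of_int i) = (if i \<in> {0, 2 * Q} then (if i = 0 then 1 else -1) * of_real (1 / sqrt 2) else 0)"
proof -
  have Qr: "real_of_int Q = P / 2" using Q by simp
  note facts = P_ge a_bounds Qr Q_ge
  show "U (y + 2 * real_of_int i) = (if i \<in> {-1} then 1 else 0)" if "y \<in> {2 - 2*a<..<2 - a}"
    by (rule period_cases[of i]) (use that facts in \<open>auto simp: U_def\<close>)
  show "U (y + 2 * real_of_int i) = (if i \<in> {Q} then 1 else 0)" if "y \<in> {-a<..<a/2}"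
    by (rule period_cases[of i]) (use that facts in \<open>auto simp: U_def\<close>)
  show "U (y + 2 * real_of_int i) = (if i \<in> {Q} then 1 else 0)" if "y \<in> {1 - a<..<a}"
    by (rule period_cases[of i]) (use that facts in \<open>auto simp: U_def\<close>)
  show "U (y + 2 * real_of_int i) = (if i \<in> {0, Q} then of_real (1 / sqrt 2) else 0)" if "y \<in> {a/2<..<1 - a}"
    by (rule period_cases[of i]) (use that facts in \<open>auto simp: U_def\<close>)
  show "U (y + 2 * real_of_int i) = (if i \<in> {0, 2 * Q} then (if i = 0 then 1 else -1) * of_real (1 / sqrt 2) else 0)" if "y \<in> {a<..<2 - 2*a}"
    by (rule period_cases[of i]) (use that facts in \<open>auto simp: U_def\<close>)
qed

section \<open>Spanned bands for \<open>psi_hat n\<close>\<close>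

lemma in_closed_span_period_pieces:
  assumes h: "pcc h" and hs: "\<And>\<xi>. h \<xi> \<noteq> 0 \<Longrightarrow> \<xi> \<in> {pi * s<..<pi * t}"
    and st: "-a \<le> s" "t \<le> 2 - a" and I: "finite I"
    and UI: "\<And>y k. y \<in> {s<..<t} \<Longrightarrow> U (y + 2 * real_of_int k) = (if k \<in> I then c k else 0)"
  shows "in_closed_span (wavelets (inv_fourier (psi_hat n))) (inv_fourier (\<lambda>\<xi>. \<Sum>i\<in>I. c i * h (\<xi> - 2 * pi * real_of_int i)))"
proof (rule in_closed_span_translated_pieces[OF pcc_psi_hat h hs _ _ I])
  show "pi * (-a) \<le> pi * s" using st by (intro mult_left_mono) auto
  have "pi * t \<le> pi * (2 - a)" using st by (intro mult_left_mono) auto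
  then show "pi * t \<le> pi * (-a) + 2 * pi" by (simp add: algebra_simps)
  fix y k assume "y \<in> {pi * s<..<pi * t}"
  then have "y / pi \<in> {s<..<t}" by (auto simp: field_simps)
  moreover have "psi_hat n (y + 2 * pi * real_of_int k) = U (y / pi + 2 * real_of_int k)"
    unfolding psi_hat_eq by (simp add: add_divide_distrib)
  ultimately show "psi_hat n (y + 2 * pi * real_of_int k) = (if k \<in> I then c k else 0)" using UI by simp
qed

text \<open>Where just one period contributes, with value 1, a periodic multiple of
  \<open>psi_hat n\<close> can be made equal to any prescribed function on that band.\<close>

lemma spanned_single_piece:
  assumes st: "-a \<le> s" "t \<le> 2 - a"
    and UI: "\<And>y k. y \<in> {s<..<t} \<Longrightarrow> U (y + 2 * real_of_int k) = (if k \<in> {i} then 1 else 0)"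
  shows "spanned (psi_hat n) {pi * (s + 2 * real_of_int i)<..<pi * (t + 2 * real_of_int i)}"
proof (rule spannedI)
  fix h assume h: "pcc h" and hs: "\<And>\<xi>. h \<xi> \<noteq> 0 \<Longrightarrow> \<xi> \<in> {pi * (s + 2 * real_of_int i)<..<pi * (t + 2 * real_of_int i)}"
  have "pcc (\<lambda>\<xi>. h (\<xi> + 2 * pi * real_of_int i))" using pcc_shift[OF h, of "- (2 * pi * real_of_int i)"] by simp
  from in_closed_span_period_pieces[OF this _ st _ UI]
  have "in_closed_span (wavelets (inv_fourier (psi_hat n)))
    (inv_fourier (\<lambda>\<xi>. \<Sum>j\<in>{i}. 1 * h (\<xi> - 2 * pi * real_of_int j + 2 * pi * real_of_int i)))"
    using hs by (force simp: algebra_simps)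
  then show "in_closed_span (wavelets (inv_fourier (psi_hat n))) (inv_fourier h)" by simp
qed

lemma spanned_pair:
  shows "spanned (psi_hat n) {pi * a<..<pi * (2 - 2 * a)}"
    and "spanned (psi_hat n) {pi * (2 * P + a)<..<pi * (2 * P + 2 - 2 * a)}"
proof -
  let ?W = "wavelets (inv_fourier (psi_hat n))"
  let ?r = "complex_of_real (1 / sqrt 2)"
  have sQ: "2 * pi * real_of_int Q = pi * P" "2 * pi * real_of_int (2 * Q) = 2 * pi * P" using Q by simp_all
  have Q0: "Q \<noteq> 0" "2 * Q \<noteq> 0" using Q_ge by auto
  have sqW: "?W \<subseteq> Collect sqint" by (rule wavelets_sqint[OF pcc_psi_hat])
  have both: "in_closed_span ?W (inv_fourier h) \<and> in_closed_span ?W (inv_fourier (\<lambda>\<xi>. h (\<xi> - 2 * pi * P)))"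
    if h: "pcc h" and hs: "\<And>\<xi>. h \<xi> \<noteq> 0 \<Longrightarrow> \<xi> \<in> {pi * a<..<pi * (2 - 2 * a)}" for h
  proof -
    \<comment> \<open>Up to the factor \<open>?r\<close>, the fourth row of \<open>U_period\<close>
      applied to \<open>h'\<close> and then dilated gives \<open>h\<close> plus \<open>k\<close>,
      while the fifth row applied to \<open>h\<close> gives \<open>h\<close> minus \<open>k\<close>.
      The halving in \<open>h'\<close> moves the band [a, 2 - 2a] to [a/2, 1 - a], and dilating back
      turns the shift P \<pi> into 2 P \<pi>.\<close>
    define h' where "h' \<xi> = h (2 * \<xi>)" for \<xi>
    define k where "k \<xi> = h (\<xi> - 2 * pi * P)" for \<xi>
    have k_eq: "k \<xi> = h (\<xi> - 4 * (pi * real_of_int Q))" for \<xi> by (simp add: k_def Q mult_ac)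
    have h': "pcc h'" unfolding h'_def using h by (rule pcc_scale) simp
    have k: "pcc k" unfolding k_def using h by (rule pcc_shift)
    have hs': "\<xi> \<in> {pi * (a/2)<..<pi * (1 - a)}" if "h' \<xi> \<noteq> 0" for \<xi>
      using hs[of "2 * \<xi>"] that by (auto simp: h'_def algebra_simps)
    have ab: "- a \<le> a / 2" "1 - a \<le> 2 - a" "- a \<le> a" "2 - 2 * a \<le> 2 - a" using a_bounds by auto
    have "in_closed_span ?W (inv_fourier (\<lambda>\<xi>. \<Sum>i\<in>{0, Q}. ?r * h' (\<xi> - 2 * pi * real_of_int i)))"
      by (rule in_closed_span_period_pieces[OF h' hs' ab(1,2) _ U_period(4)]) auto
    then have "in_closed_span ?W (inv_fourier (\<lambda>\<xi>. ?r * h' \<xi> + ?r * h' (\<xi> - pi * P)))"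
      using Q0 sQ by simp
    from in_closed_span_dilate_hat[OF pcc_psi_hat this, of "-1"]
    have "in_closed_span ?W (inv_fourier (\<lambda>\<xi>. ?r * h' (2 powr real_of_int (-1) * \<xi>) + ?r * h' (2 powr real_of_int (-1) * \<xi> - pi * P)))" .
    moreover have "h' (2 powr real_of_int (-1) * \<xi>) = h \<xi>" "h' (2 powr real_of_int (-1) * \<xi> - pi * P) = k \<xi>" for \<xi>
      by (simp_all add: h'_def k_def powr_minus algebra_simps)
    ultimately have plus: "in_closed_span ?W (inv_fourier (\<lambda>\<xi>. ?r * h \<xi> + ?r * k \<xi>))" by simp
    have "in_closed_span ?W (inv_fourier (\<lambda>\<xi>. \<Sum>i\<in>{0, 2 * Q}. ((if i = 0 then 1 else -1) * ?r) * h (\<xi> - 2 * pi * real_of_int i)))"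
      by (rule in_closed_span_period_pieces[OF h hs ab(3,4) _ U_period(5)]) auto
    then have minus: "in_closed_span ?W (inv_fourier (\<lambda>\<xi>. ?r * h \<xi> - ?r * k \<xi>))"
      using Q0 by (simp add: k_eq)
    have rh: "pcc (\<lambda>\<xi>. ?r * h \<xi>)" "pcc (\<lambda>\<xi>. ?r * k \<xi>)" by (rule pcc_cmult[OF h], rule pcc_cmult[OF k])
    note e1 = inv_fourier_add[OF rh] and e2 = inv_fourier_diff[OF rh]
    have "in_closed_span ?W (\<lambda>x. (1 / (2 * ?r)) * (inv_fourier (\<lambda>\<xi>. ?r * h \<xi> + ?r * k \<xi>) x + inv_fourier (\<lambda>\<xi>. ?r * h \<xi> - ?r * k \<xi>) x))"
      by (intro in_closed_span_cmult in_closed_span_add plus minus sqW)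
    moreover have "(\<lambda>x. (1 / (2 * ?r)) * (inv_fourier (\<lambda>\<xi>. ?r * h \<xi> + ?r * k \<xi>) x + inv_fourier (\<lambda>\<xi>. ?r * h \<xi> - ?r * k \<xi>) x)) = inv_fourier h"
      unfolding e1 e2 unfolding inv_fourier_cmult by (rule ext) (simp add: field_simps)
    moreover have "in_closed_span ?W (\<lambda>x. (1 / (2 * ?r)) * (inv_fourier (\<lambda>\<xi>. ?r * h \<xi> + ?r * k \<xi>) x + (-1) * inv_fourier (\<lambda>\<xi>. ?r * h \<xi> - ?r * k \<xi>) x))"
      by (intro in_closed_span_cmult in_closed_span_add plus minus sqW)
    moreover have "(\<lambda>x. (1 / (2 * ?r)) * (inv_fourier (\<lambda>\<xi>. ?r * h \<xi> + ?r * k \<xi>) x + (-1) * inv_fourier (\<lambda>\<xi>. ?r * h \<xi> - ?r * k \<xi>) x)) = inv_fourier k"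
      unfolding e1 e2 unfolding inv_fourier_cmult by (rule ext) (simp add: field_simps)
    ultimately show ?thesis unfolding k_def by simp
  qed
  show "spanned (psi_hat n) {pi * a<..<pi * (2 - 2 * a)}"
    by (rule spannedI) (use both in blast)
  show "spanned (psi_hat n) {pi * (2 * P + a)<..<pi * (2 * P + 2 - 2 * a)}"
  proof (rule spannedI)
    fix h assume h: "pcc h" and hs: "\<And>\<xi>. h \<xi> \<noteq> 0 \<Longrightarrow> \<xi> \<in> {pi * (2 * P + a)<..<pi * (2 * P + 2 - 2 * a)}"
    have "pcc (\<lambda>\<xi>. h (\<xi> + 2 * pi * P))" using pcc_shift[OF h, of "- (2 * pi * P)"] by simp
    moreover have "\<xi> \<in> {pi * a<..<pi * (2 - 2 * a)}" if "h (\<xi> + 2 * pi * P) \<noteq> 0" for \<xi>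
      using hs[OF that] by (auto simp: algebra_simps)
    ultimately have "in_closed_span ?W (inv_fourier (\<lambda>\<xi>. h (\<xi> - 2 * pi * P + 2 * pi * P)))"
      using both[of "\<lambda>\<xi>. h (\<xi> + 2 * pi * P)"] by blast
    then show "in_closed_span ?W (inv_fourier h)" by simp
  qed
qed

lemma spanned_negative_octave: "spanned (psi_hat n) {- (2 * (pi * a))<..<- (pi * a)}"
proof -
  have "spanned (psi_hat n) {pi * (2 - 2 * a + 2 * real_of_int (-1))<..<pi * (2 - a + 2 * real_of_int (-1))}"
    by (rule spanned_single_piece[OF _ _ U_period(1)]) (use a_bounds in auto)
  then show ?thesis by (simp add: algebra_simps)
qed

text \<open>The part (a, 2 - 2a) is the low member of \<open>spanned_pair\<close>. The rest, (2 -
  2a, 2a), is the contraction by P = 2^(n-1) of (P - a, P + a): its outer parts carry the value 1,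
  and its middle part is one half of the high member of the pair.\<close>

lemma spanned_positive_octave: "spanned (psi_hat n) {pi * a<..<2 * (pi * a)}"
proof -
  have "- a + 2 * real_of_int Q = P - a" "a/2 + 2 * real_of_int Q = P + a/2"
    "1 - a + 2 * real_of_int Q = P + 1 - a" "a + 2 * real_of_int Q = P + a" using Q by simp_all
  note eqs = this
  have j1: "spanned (psi_hat n) {pi * (P - a)<..<pi * (P + a/2)}"
    unfolding eqs(1,2)[symmetric] by (rule spanned_single_piece[OF _ _ U_period(2)]) (use a_bounds in auto)
  have j2: "spanned (psi_hat n) {pi * (P + 1 - a)<..<pi * (P + a)}"
    unfolding eqs(3,4)[symmetric] by (rule spanned_single_piece[OF _ _ U_period(3)]) (use a_bounds in auto)
  have "2 powr real_of_int (-1) * (pi * (2 * P + a)) = pi * (P + a/2)"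
     "2 powr real_of_int (-1) * (pi * (2 * P + 2 - 2 * a)) = pi * (P + 1 - a)"
    by (simp_all add: powr_minus field_simps)
  then have "spanned (psi_hat n) {pi * (P + a/2)<..<pi * (P + 1 - a)}"
    using spanned_dilate[OF pcc_psi_hat spanned_pair(2), of "-1"] by (simp only:)
  from spanned_join[OF pcc_psi_hat spanned_join[OF pcc_psi_hat j1 this] j2]
  have "spanned (psi_hat n) {2 powr real_of_int (- int (n - 1)) * (pi * (P - a))<..<2 powr real_of_int (- int (n - 1)) * (pi * (P + a))}"
    by (rule spanned_dilate[OF pcc_psi_hat])
  moreover have "2 powr real_of_int (- int (n - 1)) * (pi * (P - a)) = pi * (2 - 2 * a)"
  proof -
    have "P - a = P * (2 - 2 * a)" using aP by (simp add: algebra_simps)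
    then show ?thesis unfolding powr_neg_nat P[symmetric] using P_ge by simp
  qed
  moreover have "2 powr real_of_int (- int (n - 1)) * (pi * (P + a)) = 2 * (pi * a)"
    unfolding powr_neg_nat P[symmetric] aP[symmetric] using P_ge by simp
  ultimately have "spanned (psi_hat n) {pi * (2 - 2 * a)<..<2 * (pi * a)}" by (simp only:)
  then show ?thesis by (rule spanned_join[OF pcc_psi_hat spanned_pair(1)])
qed

section \<open>Products of \<open>U\<close> with its dyadic dilates\<close>

definition breakpoints :: "real set" where
  "breakpoints = {-2*a, -a, a/2, 1 - a, a, 2 - 2*a, P - a, P + a/2, P + 1 - a, P + a, 2*P + a, 2*P + 2 - 2*a}"

lemma region_cases:
  assumes "y \<notin> breakpoints"
  obtains "y < -2*a" | "-2*a < y" "y < -a" | "-a < y" "y < a/2" | "a/2 < y" "y < 1 - a" | "1 - a < y" "y < a"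
    | "a < y" "y < 2 - 2*a" | "2 - 2*a < y" "y < P - a" | "P - a < y" "y < P + a/2" | "P + a/2 < y" "y < P + 1 - a"
    | "P + 1 - a < y" "y < P + a" | "P + a < y" "y < 2*P + a" | "2*P + a < y" "y < 2*P + 2 - 2*a" | "2*P + 2 - 2*a < y"
proof -
  have ne: "y \<noteq> -2*a" "y \<noteq> -a" "y \<noteq> a/2" "y \<noteq> 1 - a" "y \<noteq> a" "y \<noteq> 2 - 2*a" "y \<noteq> P - a"
    "y \<noteq> P + a/2" "y \<noteq> P + 1 - a" "y \<noteq> P + a" "y \<noteq> 2*P + a" "y \<noteq> 2*P + 2 - 2*a"
    using assms by (auto simp: breakpoints_def)
  show ?thesis
    by (rule linorder_cases[of y "-2*a"]; rule linorder_cases[of y "-a"]; rule linorder_cases[of y "a/2"])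
       (use ne that in \<open>(meson linorder_cases)+\<close>)
qed

lemma r_sq: "complex_of_real (1 / sqrt 2) * complex_of_real (1 / sqrt 2) = 1 / 2"
  by (simp flip: of_real_mult)

definition piece :: "real \<Rightarrow> real \<Rightarrow> complex \<Rightarrow> real \<Rightarrow> complex" where
  "piece s t c y = (if y \<in> {s<..<t} then c else 0)"

lemma U_sq:
  assumes "y \<notin> breakpoints"
  shows "U y * cnj (U y) = (\<Sum>(s,t,c)\<leftarrow>[(-2*a, -a, 1), (P - a, P + a/2, 1), (P + 1 - a, P + a, 1), (a/2, 1 - a, 1/2),
     (a, 2 - 2*a, 1/2), (P + a/2, P + 1 - a, 1/2), (2*P + a, 2*P + 2 - 2*a, 1/2)]. piece s t c y)"
  by (rule region_cases[OF assms]) (use P_ge a_bounds r_sq in \<open>auto simp: U_def piece_def\<close>)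

text \<open>The dilates move through the gaps: for 2 \<le> m \<le> n they stay in (2 - 2a, P - a),
  for m = n + 1 in (P + a, 2P + a), and from m = n + 2 on they lie beyond the support. By
  \<open>aP\<close> the bound P - a is sharp at m = n and the bound P + a at m = n + 1.\<close>

lemma U_dilated_zero:
  assumes y: "a/2 < y" "y < 1 - a" and m: "m \<ge> 2"
  shows "U (2 ^ m * y) = 0"
proof -
  have y0: "y > 0" using y a_bounds by simp
  have Pa: "a \<le> P * a" "4 * a \<le> P * a" using P_ge a_bounds mult_right_mono[of 4 P a] by auto
  have upper: "2 ^ m * y < x" if "2 ^ m \<le> C" "C * (1 - a) \<le> x" "C > 0" for C x
  proof -
    have "2 ^ m * y \<le> C * y" using that y0 by (intro mult_right_mono) auto
    also have "\<dots> < C * (1 - a)" using that y by (intro mult_strict_left_mono) auto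
    finally show ?thesis using that by simp
  qed
  have lower: "x < 2 ^ m * y" if "C \<le> 2 ^ m" "x \<le> C * (a / 2)" "C > 0" for C x
  proof -
    have "C * (a / 2) < C * y" using that y by (intro mult_strict_left_mono) auto
    also have "\<dots> \<le> 2 ^ m * y" using that y0 by (intro mult_right_mono) auto
    finally show ?thesis using that by simp
  qed
  have m4: "(4::real) \<le> 2 ^ m" using power_increasing[OF m, of "2::real"] by simp
  have pn: "(2::real) ^ (n + k) = 2 * 2 ^ k * P" for k
  proof -
    have "n + k = Suc (k + (n - 1))" using n by simp
    then show ?thesis by (simp only: power_Suc power_add P mult.assoc)
  qed
  consider "m \<le> n" | "m = n + 1" | "n + 2 \<le> m" by linarith
  then show ?thesis
  proof cases
    case 1
    have "(2::real) ^ m \<le> 2 ^ (n + 0)" using 1 by (intro power_increasing) auto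
    then have "2 ^ m \<le> 2 * P" unfolding pn by simp
    then have "2 ^ m * y < P - a" using P_ge aP by (intro upper[of "2 * P"]) (auto simp: algebra_simps)
    moreover have "2 - 2 * a < 2 ^ m * y" using m4 a_bounds by (intro lower[of 4]) auto
    ultimately show ?thesis by (intro U_gaps(4))
  next
    case 2
    then have m: "2 ^ m = 4 * P" using pn[of 1] by simp
    have "P + a < 2 ^ m * y" using m P_ge aP by (intro lower[of "4 * P"]) auto
    moreover have "2 ^ m * y < 2 * P + a" using m P_ge aP a_bounds by (intro upper[of "4 * P"]) (auto simp: algebra_simps)
    ultimately show ?thesis by (intro U_gaps(5))
  next
    case 3
    then have "(2::real) ^ (n + 2) \<le> 2 ^ m" by (intro power_increasing) auto
    then have "8 * P \<le> 2 ^ m" unfolding pn by simp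
    then have "2 * P + 2 - 2 * a < 2 ^ m * y" using P_ge aP a_bounds by (intro lower[of "8 * P"]) auto
    then show ?thesis by (intro U_gaps(6))
  qed
qed

text \<open>A point of the support away from the breakpoints is negative, and then its dilate is too
  far left; or it exceeds P - a, and then its dilate is beyond the support; or it lies in one of the
  two low bands, of which the second is twice the first, so that \<open>U_dilated_zero\<close>
  covers both.\<close>

lemma U_corr_far:
  assumes y: "y \<notin> breakpoints" and j: "j \<ge> 2" shows "U (2 ^ j * y) * cnj (U y) = 0"
proof -
  have j4: "(4::real) \<le> 2 ^ j" using power_increasing[OF j, of "2::real"] by simp
  have far: "U (2 ^ j * y) = 0" if "P - a < y"
  proof -
    have "4 * (P - a) < 4 * y" using that by simp
    also have "4 * y \<le> 2 ^ j * y" using j4 that P_ge a_bounds by (intro mult_right_mono) auto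
    finally show ?thesis using P_ge a_bounds by (intro U_gaps(6)) auto
  qed
  show ?thesis
  proof (rule region_cases[OF y])
    assume "-2*a < y" "y < -a"
    then have "2 ^ j * y \<le> 4 * y" using j4 a_bounds by (intro mult_right_mono_neg) auto
    also have "\<dots> < -2 * a" using \<open>y < -a\<close> a_bounds by simp
    finally show ?thesis by (simp add: U_gaps(1))
  next
    assume "a/2 < y" "y < 1 - a"
    then show ?thesis using j by (simp add: U_dilated_zero)
  next
    assume "a < y" "y < 2 - 2*a"
    then have "U (2 ^ Suc j * (y / 2)) = 0" using j by (intro U_dilated_zero) auto
    then show ?thesis by simp
  qed (use far P_ge a_bounds in \<open>auto simp: U_gaps\<close>)
qed

text \<open>Each of the two surviving products pairs a band of value 1 / sqrt 2 with its double; the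
  negative value on the last band of \<open>U\<close> makes them opposite. All other doubled bands
  fall into gaps.\<close>

lemma U_corr_near:
  assumes "y \<notin> breakpoints"
  shows "U (2 ^ 1 * y) * cnj (U y) = (\<Sum>(s,t,c)\<leftarrow>[(a/2, 1 - a, 1/2), (P + a/2, P + 1 - a, -1/2)]. piece s t c y)"
proof -
  have z: "U (2 * y) = 0" if "a < y" "y < 2 - 2*a"
    using U_dilated_zero[of "y/2" 2] that by simp
  show ?thesis
    by (rule region_cases[OF assms]) (use P_ge a_bounds r_sq z in \<open>auto simp: U_def piece_def\<close>)
qed

end

text \<open>The finite set \<open>E\<close> absorbs the endpoints, where the priority of cases in
  \<open>U\<close> and a sum over open pieces disagree.\<close>

lemma integral_cis_pieces:
  assumes fm: "f \<in> borel_measurable borel" and E: "finite E"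
    and f: "\<And>y. y \<notin> E \<Longrightarrow> f (pi * y) = (\<Sum>(x,t,c)\<leftarrow>xs. if y \<in> {x<..<t} then c else (0::complex))"
    and xs: "\<And>x t c. (x, t, c) \<in> set xs \<Longrightarrow> x \<le> t"
  shows "(LINT \<eta>|lborel. f \<eta> * cis (s * \<eta>)) = (\<Sum>(x,t,c)\<leftarrow>xs. c * (cis_prim s (pi * t) - cis_prim s (pi * x)))"
proof -
  let ?g = "\<lambda>(x,t,c) \<eta>. if \<eta> \<in> {pi * x<..<pi * t} then c else (0::complex)"
  note [measurable] = fm
  have pg: "pcc (\<lambda>\<eta>. ?g p \<eta> * cis (s * \<eta>))" for p
    by (cases p) (simp only: prod.case, intro pcc_times_cis' pcc_const_interval)
  have ps: "pcc (\<lambda>\<eta>. \<Sum>p\<leftarrow>ys. ?g p \<eta> * cis (s * \<eta>))" for ys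
  proof (induction ys)
    case (Cons p ys)
    from pcc_add[OF pg[of p] this] show ?case by simp
  qed (simp add: pcc_zero)
  have "AE \<eta> in lborel. \<eta> \<notin> (\<lambda>y. pi * y) ` E" using E by (intro AE_not_in finite_imp_null_set_lborel) auto
  then have "AE \<eta> in lborel. f \<eta> * cis (s * \<eta>) = (\<Sum>p\<leftarrow>xs. ?g p \<eta> * cis (s * \<eta>))"
  proof eventually_elim
    case (elim \<eta>)
    have "\<eta> / pi \<notin> E"
    proof
      assume "\<eta> / pi \<in> E"
      then have "pi * (\<eta> / pi) \<in> (\<lambda>y. pi * y) ` E" by (rule imageI)
      then show False using elim by simp
    qed
    from f[OF this] have "f \<eta> = (\<Sum>p\<leftarrow>xs. case p of (x,t,c) \<Rightarrow> if \<eta> / pi \<in> {x<..<t} then c else 0)" by simp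
    also have "\<dots> = (\<Sum>p\<leftarrow>xs. ?g p \<eta>)"
      by (intro arg_cong[where f=sum_list] map_cong refl) (auto simp: field_simps)
    finally show ?case by (simp add: sum_list_mult_const)
  qed
  then have "(LINT \<eta>|lborel. f \<eta> * cis (s * \<eta>)) = (LINT \<eta>|lborel. (\<Sum>p\<leftarrow>xs. ?g p \<eta> * cis (s * \<eta>)))"
    using pcc_measurable[OF ps[of xs]] by (intro integral_cong_AE) measurable
  also have "\<dots> = (\<Sum>p\<leftarrow>xs. (LINT \<eta>|lborel. ?g p \<eta> * cis (s * \<eta>)))"
  proof (induction xs)
    case (Cons p ys)
    then show ?case using pcc_integrable[OF pg[of p]] pcc_integrable[OF ps[of ys]] by simp
  qed simp
  also have "\<dots> = (\<Sum>(x,t,c)\<leftarrow>xs. c * (cis_prim s (pi * t) - cis_prim s (pi * x)))"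
  proof (intro arg_cong[where f=sum_list] map_cong refl)
    fix p assume p: "p \<in> set xs"
    obtain x t c where pe: "p = (x, t, c)" by (cases p)
    have "pi * x \<le> pi * t" using xs p pe by (intro mult_left_mono) auto
    then show "(LINT \<eta>|lborel. ?g p \<eta> * cis (s * \<eta>)) = (case p of (x,t,c) \<Rightarrow> c * (cis_prim s (pi * t) - cis_prim s (pi * x)))"
      unfolding pe prod.case by (rule integral_cis_interval)
  qed
  finally show ?thesis .
qed

section \<open>Values of \<open>scale_corr\<close> and the conclusion\<close>

context psi_params
begin

lemma corr_measurable: "(\<lambda>\<eta>. psi_hat n (2 ^ j * \<eta>) * cnj (psi_hat n \<eta>)) \<in> borel_measurable borel"
  by (intro pcc_measurable pcc_mult pcc_cnj pcc_scale pcc_psi_hat) auto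

lemma corr_scaled: "psi_hat n (2 ^ j * (pi * y)) * cnj (psi_hat n (pi * y)) = U (2 ^ j * y) * cnj (U y)"
  using psi_hat_scaled[of "2 ^ j * y"] psi_hat_scaled[of y] by (simp add: mult_ac)

lemma finite_breakpoints: "finite breakpoints" by (simp add: breakpoints_def)

text \<open>At integer frequency, moving an interval by a multiple of 2 \<pi> does not change its
  integral of cis, so all pieces can be brought into one period. The two members of each pair
  contribute one half each, the sum telescopes, and a full period remains.\<close>

lemma scale_corr_0: "scale_corr (psi_hat n) 0 (real_of_int k) = (if k = 0 then complex_of_real (2 * pi) else 0)"
proof -
  let ?F = "cis_prim (real_of_int k)"
  have sh: "?F (y + 2 * pi * real_of_int i) - ?F (x + 2 * pi * real_of_int i) = ?F y - ?F x" for x y i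
  proof -
    have "cis (real_of_int k * (2 * pi * real_of_int i)) = 1"
      using cis_multiple_2pi[of "real_of_int (k * i)"] by (simp add: mult_ac)
    then show ?thesis unfolding cis_prim_shift by simp
  qed
  have s1: "?F (pi * (-a)) - ?F (pi * (-2*a)) = ?F (pi * (2 - a)) - ?F (pi * (2 - 2*a))"
    using sh[of "pi * (-a)" 1 "pi * (-2*a)"] by (simp add: algebra_simps)
  have s2: "?F (pi * (P + y)) - ?F (pi * (P + x)) = ?F (pi * y) - ?F (pi * x)" for x y
    using sh[of "pi * y" Q "pi * x"] Q by (simp add: algebra_simps)
  have s3: "?F (pi * (2*P + y)) - ?F (pi * (2*P + x)) = ?F (pi * y) - ?F (pi * x)" for x y
    using sh[of "pi * y" "2 * Q" "pi * x"] Q by (simp add: algebra_simps)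
  have "scale_corr (psi_hat n) 0 (real_of_int k) = (\<Sum>(x,t,c)\<leftarrow>[(-2*a, -a, 1), (P - a, P + a/2, 1), (P + 1 - a, P + a, 1), (a/2, 1 - a, 1/2),
     (a, 2 - 2*a, 1/2), (P + a/2, P + 1 - a, 1/2), (2*P + a, 2*P + 2 - 2*a, 1/2)]. c * (?F (pi * t) - ?F (pi * x)))"
    unfolding scale_corr_def
  proof (rule integral_cis_pieces[OF corr_measurable finite_breakpoints])
    fix y assume "y \<notin> breakpoints"
    then show "psi_hat n (2 ^ 0 * (pi * y)) * cnj (psi_hat n (pi * y)) = (\<Sum>(x,t,c)\<leftarrow>[(-2*a, -a, 1), (P - a, P + a/2, 1), (P + 1 - a, P + a, 1), (a/2, 1 - a, 1/2),
     (a, 2 - 2*a, 1/2), (P + a/2, P + 1 - a, 1/2), (2*P + a, 2*P + 2 - 2*a, 1/2)]. if y \<in> {x<..<t} then c else 0)"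
      unfolding corr_scaled using U_sq by (simp add: piece_def)
  qed (use a_bounds in auto)
  also have "\<dots> = ?F (pi * (2 - a)) - ?F (pi * (-a))"
  proof -
    have s4: "?F (pi * (P + a/2)) - ?F (pi * (P - a)) = ?F (pi * (a/2)) - ?F (pi * (-a))"
      "?F (pi * (P + a)) - ?F (pi * (P + 1 - a)) = ?F (pi * a) - ?F (pi * (1 - a))"
      "?F (pi * (P + 1 - a)) - ?F (pi * (P + a/2)) = ?F (pi * (1 - a)) - ?F (pi * (a/2))"
      "?F (pi * (2*P + 2 - 2*a)) - ?F (pi * (2*P + a)) = ?F (pi * (2 - 2*a)) - ?F (pi * a)"
      using s2[of "a/2" "-a"] s2[of a "1 - a"] s2[of "1 - a" "a/2"] s3[of "2 - 2*a" a]
      by (simp_all only: add_diff_eq add_uminus_conv_diff)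
    show ?thesis
      by (simp only: list.map sum_list.Cons sum_list.Nil prod.case s1 s4) (simp add: field_simps)
  qed
  also have "\<dots> = (if k = 0 then complex_of_real (2 * pi) else 0)"
    using cis_prim_period[of k "pi * (-a)"] by (simp add: algebra_simps)
  finally show ?thesis .
qed

lemma scale_corr_far:
  assumes "j \<ge> 2" shows "scale_corr (psi_hat n) j s = 0"
proof -
  have "scale_corr (psi_hat n) j s = (\<Sum>(x,t,c)\<leftarrow>[]. c * (cis_prim s (pi * t) - cis_prim s (pi * x)))"
    unfolding scale_corr_def
    by (rule integral_cis_pieces[OF corr_measurable finite_breakpoints]) (use U_corr_far assms corr_scaled in auto)
  then show ?thesis by simp
qed

lemma scale_corr_1:
  "scale_corr (psi_hat n) 1 s = (1 - cis (s * (pi * P))) / 2 * (cis_prim s (pi * (1 - a)) - cis_prim s (pi * (a / 2)))"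
proof -
  have "scale_corr (psi_hat n) 1 s = (\<Sum>(x,t,c)\<leftarrow>[(a/2, 1 - a, 1/2), (P + a/2, P + 1 - a, -1/2)]. c * (cis_prim s (pi * t) - cis_prim s (pi * x)))"
    unfolding scale_corr_def
  proof (rule integral_cis_pieces[OF corr_measurable finite_breakpoints])
    fix y assume "y \<notin> breakpoints"
    then show "psi_hat n (2 ^ 1 * (pi * y)) * cnj (psi_hat n (pi * y)) = (\<Sum>(x,t,c)\<leftarrow>[(a/2, 1 - a, 1/2), (P + a/2, P + 1 - a, -1/2)]. if y \<in> {x<..<t} then c else 0)"
      unfolding corr_scaled using U_corr_near by (simp add: piece_def)
  qed (use a_bounds in auto)
  then have "scale_corr (psi_hat n) 1 s = 1/2 * (cis_prim s (pi * (1 - a)) - cis_prim s (pi * (a / 2))) +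
     (-1/2) * (cis_prim s (pi * (P + 1 - a)) - cis_prim s (pi * (P + a/2)))" by simp
  moreover have sh: "cis_prim s (pi * (P + 1 - a)) - cis_prim s (pi * (P + a/2)) = cis (s * (pi * P)) * (cis_prim s (pi * (1 - a)) - cis_prim s (pi * (a / 2)))"
    using cis_prim_shift[of s "pi * (1 - a)" "pi * P" "pi * (a/2)"] by (simp add: algebra_simps)
  moreover have "1/2 * X + (-1/2) * (w * X) = (1 - w) / 2 * X" for X w :: complex by (simp add: field_simps)
  ultimately show ?thesis by (simp only:)
qed

lemma scale_corr_dyadic:
  assumes "j \<ge> 1" shows "scale_corr (psi_hat n) j (real_of_int p / 2 ^ (n - 2)) = 0"
proof (cases "j = 1")
  case True
  have "P = 2 * 2 ^ (n - 2)"
  proof -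
    have "n - 1 = Suc (n - 2)" using n by simp
    then show ?thesis by (simp only: P power_Suc)
  qed
  then have "real_of_int p / 2 ^ (n - 2) * (pi * P) = 2 * pi * real_of_int p" by simp
  then show ?thesis unfolding True scale_corr_1 by (simp only: cis_multiple_2pi[OF Ints_of_int]) simp
next
  case False
  then show ?thesis using assms by (intro scale_corr_far) auto
qed

text \<open>At this frequency cis of the shift is -1, so the factor in \<open>scale_corr_1\<close>
  equals 1 and only the integral over one interval has to be nonzero. It is, because the scaled
  endpoints lie in (0, \<pi>/2], where the sine is strictly increasing.\<close>

lemma scale_corr_half_dyadic: "scale_corr (psi_hat n) 1 (- (1 / 2 ^ (n - 1))) \<noteq> 0"
proof -
  define s where "s = 1 / P"
  have s: "0 < s" "s \<le> 1 / 4" using P_ge by (auto simp: s_def field_simps)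
  have sP: "- s * (pi * P) = - pi" using P_ge by (simp add: s_def)
  let ?x = "s * (pi * (1 - a))" and ?y = "s * (pi * (a / 2))"
  have "s * (1 - a) \<le> 1 / 4 * (1 - a)" using s a_bounds by (intro mult_right_mono) auto
  also have "\<dots> \<le> 1 / 2" using a_bounds by simp
  finally have "s * (1 - a) \<le> 1 / 2" .
  then have "pi * (s * (1 - a)) \<le> pi * (1 / 2)" by (intro mult_left_mono) auto
  then have x: "?x \<le> pi / 2" by (simp add: mult_ac)
  have "?y < ?x" using s a_bounds by (intro mult_strict_left_mono) auto
  moreover have "0 < ?y" using s a_bounds by simp
  ultimately have "sin ?y < sin ?x" using x pi_gt_zero by (intro sin_monotone_2pi) linarith+
  then have "Im (cis (- s * (pi * (1 - a)))) \<noteq> Im (cis (- s * (pi * (a / 2))))" by simp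
  then have "cis (- s * (pi * (1 - a))) \<noteq> cis (- s * (pi * (a / 2)))" by metis
  then have ne: "cis_prim (- s) (pi * (1 - a)) - cis_prim (- s) (pi * (a / 2)) \<noteq> 0"
    using s by (simp add: cis_prim_def)
  have "scale_corr (psi_hat n) 1 (- s) \<noteq> 0" unfolding scale_corr_1 sP using ne by (simp add: complex_eq_iff[of "cis (- pi)"])
  then show ?thesis by (simp add: s_def P)
qed

theorem wavelet_psi: "is_wavelet (psi n)"
  unfolding is_wavelet_def psi_def
proof (intro conjI allI impI)
  show "sqint (inv_fourier (psi_hat n))" by (rule sqint_inv_fourier[OF pcc_psi_hat])
  show "l2_inner (wav (inv_fourier (psi_hat n)) j k) (wav (inv_fourier (psi_hat n)) j' k') = (if j = j' \<and> k = k' then 1 else 0)" for j k j' k'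
  proof (rule wav_orthonormal[OF pcc_psi_hat scale_corr_0])
    fix j :: nat and k :: int assume j: "1 \<le> j"
    \<comment> \<open>An integer is a multiple of 2^(2-n), so orthogonality between levels is a
      special case of the computation for invariance.\<close>
    show "scale_corr (psi_hat n) j (real_of_int k) = 0"
      using scale_corr_dyadic[OF j, of "k * 2 ^ (n - 2)"] by simp
  qed
  show "in_closed_span (wavelets (inv_fourier (psi_hat n))) f" if "sqint f" for f
    by (rule wavelets_complete[OF pcc_psi_hat _ spanned_positive_octave spanned_negative_octave that]) (use a_bounds in simp)
qed

theorem psi_in_wclass_M: "psi n \<in> wclass_M (n - 2)"
proof -
  have "Suc (n - 2) = n - 1" using n by simp
  then show ?thesis
    using wclass_L_I[OF pcc_psi_hat _ scale_corr_dyadic] not_wclass_L_I[OF pcc_psi_hat scale_corr_half_dyadic] wavelet_psi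
    by (simp add: wclass_M_def psi_def)
qed

end

theorem theorem6p2:
  fixes n :: nat
  assumes "n \<ge> 3"
  shows "is_wavelet (psi n) \<and> psi n \<in> wclass_M (n - 2)"
proof -
  define P :: real where "P = 2 ^ (n - 1)"
  have P: "P \<ge> 1" unfolding P_def by simp
  \<comment> \<open>The integer 2^(n-2) counts the periods 2 \<pi> contained in P \<pi>.\<close>
  interpret psi_params n "P / (2 * P - 1)" P "2 ^ (n - 2)"
  proof
    have "n - 1 = Suc (n - 2)" using assms by simp
    then show "P = 2 * real_of_int (2 ^ (n - 2))" by (simp add: P_def)
    show "P / (2 * P - 1) * (2 * P - 1) = P" using P by simp
  qed (use assms in \<open>auto simp: P_def\<close>)
  show ?thesis using wavelet_psi psi_in_wclass_M by simp
qed

end
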